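(* Let $T$ be a semistandard hook-valued tableau, $i\ge1$, and $\tilde{\mathcal U}(T)=(\tilde P(T),\tilde Q(T))$. (1) If $f_i(T)=0$, then $f_i(\tilde P(T))=0$. (2) If $e_i(T)=0$, then $e_i(\tilde P(T))=0$. (3) If $f_i(T)\ne0$, then $f_i(\tilde P(T))=\tilde P(f_i(T))$ and $\tilde Q(T)=\tilde Q(f_i(T))$. (4) If $e_i(T)\ne0$, then $e_i(\tilde P(T))=\tilde P(e_i(T))$ and $\tilde Q(T)=\tilde Q(e_i(T))$.
   Context: French notation: row $1$ is the bottom row, rows numbered upward, columns left to right; cell $(r,c)$ is in row $r$, column $c$. A semistandard tableau of hook shape $U$ consists of a hook entry $x$, a leg $\ell_1<\dots<\ell_p$ above $x$ with $x<\ell_1$, and an arm $a_1\le\dots\le a_q$ to the right of $x$ with $x\le a_1$ ($p,q\ge0$, positive integers); $\mathsf L(U)$ is the leg, $\mathsf L^+(U)=(x,\ell_1,\dots,\ell_p)$ the extended leg, $\mathsf A(U)$ the arm. A (semistandard) hook-valued tableau (HVT) of partition shape $\lambda$ is a filling of the cells of $\lambda$ by such hook tableaux with $\max(A)\le\min(B)$ whenever the cell of $A$ is left of that of $B$ in the same row, and $\max(A)<\min(C)$ whenever the cell of $A$ is below that of $C$ in the same column. Leg excess = total number of leg entries. Crystal operators: the column reading word $R(T)$ reads, for each column from left to right, the extended legs of its cells (cells top to bottom, each extended leg from top to bottom), followed by all arm entries of that column in weakly increasing order. Assign $-$ to each $i$ and $+$ to each $i+1$ in $R(T)$, and successively pair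 a $+$ that is adjacent to and left of a $-$, removing paired signs, until no more pairs. If there is no unpaired $-$, $f_i(T)=0$. Otherwise let $B$ be the cell containing the $i$ of the rightmost unpaired $-$. (M) If the cell $B^\uparrow$ above $B$ contains an $i+1$, $f_i$ removes an $i$ from $\mathsf A(B)$ and adds $i+1$ to $\mathsf A(B^\uparrow)$. (S) Otherwise, if the cell $B^\rightarrow$ right of $B$ contains an $i$ in $\mathsf L^+(B^\rightarrow)$, $f_i$ removes this $i$ from $\mathsf L^+(B^\rightarrow)$ and adds $i+1$ to $\mathsf L(B)$. (N) Otherwise $f_i$ changes that $i$ into $i+1$. If there is no unpaired $+$, $e_i(T)=0$; otherwise let $B$ be the cell containing the $i+1$ of the leftmost unpaired $+$. (M) If the cell $B^\downarrow$ below $B$ contains an $i$, $e_i$ removes the $i+1$ from $\mathsf A(B)$ and adds $i$ to $\mathsf A(B^\downarrow)$. (S) Otherwise, if the cell $B^\leftarrow$ left of $B$ contains an $i+1$ in $\mathsf L(B^\leftarrow)$, $e_i$ removes it and adds $i$ to $\mathsf L^+(B)$. (N) Otherwise $e_i$ changes that $i+1$ into $i$. Multiset uncrowding bumping $\tilde{\mathcal V}_b$: if the leg excess of $T$ is $0$, return $T$. Otherwise let $r$ be the topmost row containing a cell with nonempty leg; in that row let $(r,c)$ be the cell whose leg contains the largest value (the rightmost such cell); let $\ell$ be its largest leg entry and $a$ its rightmost arm entry. In row $r+1$ find the leftmost number strictly greater than $\ell$. If none exists, attach an empty cell at the end of row $r+1$, call it $(r+1,\tilde c)$, and let $k$ be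 empty; otherwise let $k$ be this number and $(r+1,\tilde c)$ its cell. (a) If $\tilde c\ne c$: remove $\ell$ from the leg of $(r,c)$, put $\ell$ in place of $k$ (as hook entry if the cell is new), attach $k$ (if nonempty) to the leg of $(r+1,\tilde c)$. (b) If $\tilde c=c$: remove the multiset $\{z\in\mathsf A(r,c):\ell\le z\le a\}$ from the arm of $(r,c)$ and $\ell$ from its leg, insert that multiset into the arm of $(r+1,\tilde c)$, replace the hook entry of $(r+1,\tilde c)$ by $\ell$, and attach $k$ (if nonempty) to the leg of $(r+1,\tilde c)$. Multiset uncrowding insertion: $\tilde{\mathcal V}(T)=\tilde{\mathcal V}_b^d(T)$, $d\ge1$ minimal such that the shape changes or $\tilde{\mathcal V}_b^d(T)=\tilde{\mathcal V}_b^{d-1}(T)$. Multiset uncrowding map: for $T$ of shape $\lambda$ with leg excess $\alpha$, $\tilde P_0=T$, $\tilde Q_0$ empty of shape $\lambda/\lambda$; for $1\le i\le\alpha$, $\tilde P_i=\tilde{\mathcal V}(\tilde P_{i-1})$, and $\tilde Q_i$ is $\tilde Q_{i-1}$ with the new cell $\mathsf{shape}(\tilde P_i)/\mathsf{shape}(\tilde P_{i-1})$ added and filled with $\tilde r-r$, where $\tilde r$ is the row of the new cell and $r$ the topmost row of $\tilde P_{i-1}$ containing a cell with nonzero leg excess; $\tilde{\mathcal U}(T)=(\tilde P(T),\tilde Q(T)):=(\tilde P_\alpha,\tilde Q_\alpha)$. *)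

theory Defs
  imports Main
begin

text \<open>A hook tableau is a triple (x, leg, arm): hook entry x, leg l1 < ... < lp
  (listed bottom to top), arm a1 <= ... <= aq (listed left to right).
  A hook-valued tableau is a list of rows, row 0 being the bottom row (French
  notation, row r+1 of the paper is index r), each row a list of cells from left
  to right.\<close>

type_synonym hook = "nat \<times> nat list \<times> nat list"
type_synonym hvt = "hook list list"

definition hx :: "hook \<Rightarrow> nat" where "hx h = fst h"
definition hleg :: "hook \<Rightarrow> nat list" where "hleg h = fst (snd h)"
definition harm :: "hook \<Rightarrow> nat list" where "harm h = snd (snd h)"
definition hLplus :: "hook \<Rightarrow> nat list" where "hLplus h = hx h # hleg h"
definition hentries :: "hook \<Rightarrow> nat list" where "hentries h = hx h # hleg h @ harm h"
definition hmin :: "hook \<Rightarrow> nat" where "hmin h = Min (set (hentries h))"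
definition hmax :: "hook \<Rightarrow> nat" where "hmax h = Max (set (hentries h))"

definition hook_valid :: "hook \<Rightarrow> bool" where
  "hook_valid h \<longleftrightarrow> 0 < hx h \<and> sorted_wrt (<) (hLplus h) \<and> sorted (hx h # harm h)"

definition in_shape :: "hvt \<Rightarrow> nat \<Rightarrow> nat \<Rightarrow> bool" where
  "in_shape T r c \<longleftrightarrow> r < length T \<and> c < length (T ! r)"

definition cell :: "hvt \<Rightarrow> nat \<Rightarrow> nat \<Rightarrow> hook" where
  "cell T r c = T ! r ! c"

definition shape :: "hvt \<Rightarrow> nat list" where
  "shape T = map length T"

definition hvt_valid :: "hvt \<Rightarrow> bool" where
  "hvt_valid T \<longleftrightarrow>
     (\<forall>row \<in> set T. row \<noteq> []) \<and>
     sorted_wrt (\<lambda>a b. b \<le> a) (map length T) \<and>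
     (\<forall>r c. in_shape T r c \<longrightarrow> hook_valid (cell T r c)) \<and>
     (\<forall>r c c'. in_shape T r c' \<and> c < c' \<longrightarrow> hmax (cell T r c) \<le> hmin (cell T r c')) \<and>
     (\<forall>r r' c. in_shape T r' c \<and> r < r' \<longrightarrow> hmax (cell T r c) < hmin (cell T r' c))"

definition upd_cell :: "hvt \<Rightarrow> nat \<Rightarrow> nat \<Rightarrow> (hook \<Rightarrow> hook) \<Rightarrow> hvt" where
  "upd_cell T r c g = T[r := (T ! r)[c := g (T ! r ! c)]]"

definition set_arm :: "hook \<Rightarrow> nat list \<Rightarrow> hook" where
  "set_arm h A = (hx h, hleg h, A)"
definition set_leg :: "hook \<Rightarrow> nat list \<Rightarrow> hook" where
  "set_leg h L = (hx h, L, harm h)"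
definition set_Lplus :: "hook \<Rightarrow> nat list \<Rightarrow> hook" where
  "set_Lplus h l = (hd l, tl l, harm h)"

text \<open>A letter: (value, cell (row, column), source), where the source is
  Some k for the k-th entry of the extended leg (k = 0 the hook entry) and
  None for an arm entry.\<close>
type_synonym letter = "nat \<times> (nat \<times> nat) \<times> nat option"

definition ncols :: "hvt \<Rightarrow> nat" where
  "ncols T = foldr max (map length T) 0"

definition lplus_letters :: "hvt \<Rightarrow> nat \<Rightarrow> nat \<Rightarrow> letter list" where
  "lplus_letters T r c = (let h = cell T r c in
     map (\<lambda>k. (hLplus h ! k, (r, c), Some k)) (rev [0..<length (hLplus h)]))"

definition arm_letters :: "hvt \<Rightarrow> nat \<Rightarrow> nat \<Rightarrow> letter list" where
  "arm_letters T r c = (let h = cell T r c in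
     map (\<lambda>j. (harm h ! j, (r, c), None)) [0..<length (harm h)])"

definition col_rows :: "hvt \<Rightarrow> nat \<Rightarrow> nat list" where
  "col_rows T c = filter (\<lambda>r. c < length (T ! r)) (rev [0..<length T])"

definition col_word :: "hvt \<Rightarrow> nat \<Rightarrow> letter list" where
  "col_word T c =
     concat (map (\<lambda>r. lplus_letters T r c) (col_rows T c)) @
     sort_key fst (concat (map (\<lambda>r. arm_letters T r c) (col_rows T c)))"

definition reading_word :: "hvt \<Rightarrow> letter list" where
  "reading_word T = concat (map (col_word T) [0..<ncols T])"

text \<open>Bracketing: input is the list of (position, is_plus) of the signed letters
  in reading order.  Pairing a + immediately to the left of a - (after removal of
  already paired signs) is realised by a stack of unpaired +.  Output:
  (positions of unpaired -, positions of unpaired +), both increasing.\<close>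
fun brk :: "(nat \<times> bool) list \<Rightarrow> nat list \<Rightarrow> nat list \<Rightarrow> nat list \<times> nat list" where
  "brk [] ps ms = (ms, rev ps)"
| "brk ((j, True) # w) ps ms = brk w (j # ps) ms"
| "brk ((j, False) # w) ps ms =
     (case ps of [] \<Rightarrow> brk w [] (ms @ [j]) | _ # ps' \<Rightarrow> brk w ps' ms)"

definition signs :: "nat \<Rightarrow> letter list \<Rightarrow> (nat \<times> bool) list" where
  "signs i w = [(j, fst (w ! j) = Suc i). j \<leftarrow> [0..<length w], fst (w ! j) = i \<or> fst (w ! j) = Suc i]"

section \<open>Crystal operators (None represents 0)\<close>

definition f_op :: "nat \<Rightarrow> hvt \<Rightarrow> hvt option" where
  "f_op i T = (let w = reading_word T; ms = fst (brk (signs i w) [] []) in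
     if ms = [] then None else
     (case w ! last ms of (v, (r, c), src) \<Rightarrow>
        if in_shape T (Suc r) c \<and> Suc i \<in> set (hentries (cell T (Suc r) c)) then
          Some (upd_cell (upd_cell T r c (\<lambda>h. set_arm h (remove1 i (harm h))))
                  (Suc r) c (\<lambda>h. set_arm h (insort (Suc i) (harm h))))
        else if in_shape T r (Suc c) \<and> i \<in> set (hLplus (cell T r (Suc c))) then
          Some (upd_cell (upd_cell T r (Suc c) (\<lambda>h. set_Lplus h (remove1 i (hLplus h))))
                  r c (\<lambda>h. set_leg h (insort (Suc i) (hleg h))))
        else
          Some (upd_cell T r c (\<lambda>h. case src of
                   Some k \<Rightarrow> set_Lplus h ((hLplus h)[k := Suc i])
                 | None \<Rightarrow> set_arm h (insort (Suc i) (remove1 i (harm h)))))))"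

definition e_op :: "nat \<Rightarrow> hvt \<Rightarrow> hvt option" where
  "e_op i T = (let w = reading_word T; ps = snd (brk (signs i w) [] []) in
     if ps = [] then None else
     (case w ! hd ps of (v, (r, c), src) \<Rightarrow>
        if 0 < r \<and> in_shape T (r - 1) c \<and> i \<in> set (hentries (cell T (r - 1) c)) then
          Some (upd_cell (upd_cell T r c (\<lambda>h. set_arm h (remove1 (Suc i) (harm h))))
                  (r - 1) c (\<lambda>h. set_arm h (insort i (harm h))))
        else if 0 < c \<and> in_shape T r (c - 1) \<and> Suc i \<in> set (hleg (cell T r (c - 1))) then
          Some (upd_cell (upd_cell T r (c - 1) (\<lambda>h. set_leg h (remove1 (Suc i) (hleg h))))
                  r c (\<lambda>h. set_Lplus h (insort i (hLplus h))))
        else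
          Some (upd_cell T r c (\<lambda>h. case src of
                   Some k \<Rightarrow> set_Lplus h ((hLplus h)[k := i])
                 | None \<Rightarrow> set_arm h (insort i (remove1 (Suc i) (harm h)))))))"

definition leg_excess :: "hvt \<Rightarrow> nat" where
  "leg_excess T = sum_list (map (\<lambda>row. sum_list (map (\<lambda>h. length (hleg h)) row)) T)"

definition top_leg_row :: "hvt \<Rightarrow> nat" where
  "top_leg_row T = (GREATEST r. \<exists>c. in_shape T r c \<and> hleg (cell T r c) \<noteq> [])"

definition add_cell :: "hvt \<Rightarrow> nat \<Rightarrow> hook \<Rightarrow> hvt" where
  "add_cell T r h = (if r < length T then T[r := (T ! r) @ [h]] else T @ [[h]])"

definition Vb :: "hvt \<Rightarrow> hvt" where
  "Vb T = (if leg_excess T = 0 then T else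
     (let r = top_leg_row T;
          lmax = Max (\<Union>c' \<in> {c'. c' < length (T ! r)}. set (hleg (cell T r c')));
          c = (GREATEST c'. c' < length (T ! r) \<and> lmax \<in> set (hleg (cell T r c')));
          h = cell T r c;
          l = Max (set (hleg h));
          a = last (harm h);
          moved = filter (\<lambda>z. l \<le> z \<and> z \<le> a) (harm h);
          row' = (if Suc r < length T then T ! Suc r else []);
          nums = concat (map (\<lambda>c'. (c', None, hx (row' ! c')) #
                     map (\<lambda>j. (c', Some j, harm (row' ! c') ! j)) [0..<length (harm (row' ! c'))])
                   [0..<length row']);
          Ta = upd_cell T r c (\<lambda>g. set_leg g (remove1 l (hleg g)));
          Tb = upd_cell T r c (\<lambda>g. (hx g, remove1 l (hleg g),
                                      filter (\<lambda>z. \<not> (l \<le> z \<and> z \<le> a)) (harm g)))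
      in (case find (\<lambda>(_, _, v). l < v) nums of
            None \<Rightarrow>
              (if length row' \<noteq> c then add_cell Ta (Suc r) (l, [], [])
               else add_cell Tb (Suc r) (l, [], sort moved))
          | Some (ct, p, k) \<Rightarrow>
              (if ct \<noteq> c then
                 upd_cell Ta (Suc r) ct (\<lambda>g. case p of
                      None \<Rightarrow> (l, insort k (hleg g), harm g)
                    | Some j \<Rightarrow> (hx g, insort k (hleg g), (harm g)[j := l]))
               else
                 upd_cell Tb (Suc r) c (\<lambda>g. (l, insort k (hleg g), sort (harm g @ moved)))))))"

definition V_ins :: "hvt \<Rightarrow> hvt" where
  "V_ins T = (Vb ^^ (LEAST d. 1 \<le> d \<and>
       (shape ((Vb ^^ d) T) \<noteq> shape T \<or> (Vb ^^ d) T = (Vb ^^ (d - 1)) T))) T"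

text \<open>Recording tableau: entries indexed by cells (row, column), 0-based.\<close>
definition unc_step :: "hvt \<times> ((nat \<times> nat) \<Rightarrow> nat option) \<Rightarrow> hvt \<times> ((nat \<times> nat) \<Rightarrow> nat option)" where
  "unc_step PQ = (let P = fst PQ; Q = snd PQ; P' = V_ins P; r = top_leg_row P;
      p = (THE p. in_shape P' (fst p) (snd p) \<and> \<not> in_shape P (fst p) (snd p))
    in (P', Q(p \<mapsto> fst p - r)))"

definition P_tilde :: "hvt \<Rightarrow> hvt" where
  "P_tilde T = fst ((unc_step ^^ leg_excess T) (T, Map.empty))"

text \<open>Q tilde as a skew tableau: (inner shape, filling of the cells).\<close>
definition Q_tilde :: "hvt \<Rightarrow> nat list \<times> ((nat \<times> nat) \<Rightarrow> nat option)" where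
  "Q_tilde T = (shape T, snd ((unc_step ^^ leg_excess T) (T, Map.empty)))"

end

(* A tableau is recorded by the set of extended leg entries and the multiset of arm
   entries of each cell. A prefix of the reading word has as height the number of its i's
   minus that of its (i+1)'s; f_i acts in the first column where the maximal height is
   attained, e_i in the last one. In a column the legs, which contain at most one i and at
   most one i+1, are read before the arms, so the maximum over a column is its peak, a
   quantity that depends only on the numbers of i's and (i+1)'s in the legs and arms of the
   columns up to it. A bump carries the entry l from column c to a column ct \<le> c, and this
   changes the peaks only in the columns ct, ..., c - 1, by at most one. The order relations
   around l show that neither the maximal height nor the height of the whole word changes, so
   f_i (and likewise e_i) acts on the bumped tableau if and only if it acts on the original
   one; the two columns in which f_i acts differ only if it acts on or next to the bumped
   letter, and in all cases f_i commutes with bumping. As f_i keeps the shape, the leg excess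
   and the rows that contain legs, it commutes with the whole uncrowding map and does not
   change the recording tableau; the remaining claims for e_i follow because e_i inverts f_i. *)

theory Submission
  imports Defs "HOL-Library.Multiset"
begin

text \<open>Columns increase strictly, so a column and a value determine a row. Hence each operator
  is fixed by a column (for e_i also by the kind of letter), and statements about brackets become
  arithmetic of column counts. The obstacle is that f_i and a bump read the same comparisons:
  raising an i to i + 1 may change the entry to be bumped, the cell in which the bump stops, or the
  outcome of the tests (M) and (S). Commutation is therefore stated existentially: some bump of
  f_i(T) from the same row agrees with f_i of the bumped tableau. This bump is the one performed,
  because the tableau determines the parameters of a bump. The number of bumps in an insertion is
  defined by comparing iterates, so its invariance under f_i rests on f_i being injective; the
  inverse is thus used for the claims on f_i as well. If e_i(T) = 0, there is nothing to invert;
  this case uses that e_i vanishes exactly when the final height is maximal.\<close>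

type_synonym legs = "nat \<times> nat \<Rightarrow> nat set"
type_synonym arms = "nat \<times> nat \<Rightarrow> nat multiset"

section \<open>Fillings and their order relations\<close>

definition ents :: "legs \<Rightarrow> arms \<Rightarrow> nat \<times> nat \<Rightarrow> nat set" where
  "ents L A x = L x \<union> set_mset (A x)"

text \<open>A cell is mapped to its set of extended leg entries and its multiset of arm entries; an
  empty leg set means that the cell is outside the shape.\<close>

definition semistd :: "legs \<Rightarrow> arms \<Rightarrow> bool" where
  "semistd L A \<longleftrightarrow> (\<forall>x. finite (L x)) \<and> (\<forall>x. 0 \<notin> L x) \<and>
     (\<forall>x v. v \<in># A x \<longrightarrow> (\<exists>u\<in>L x. u \<le> v)) \<and>
     (\<forall>r c r' c'. L (r, c) \<noteq> {} \<longrightarrow> r' \<le> r \<longrightarrow> c' \<le> c \<longrightarrow> L (r', c') \<noteq> {}) \<and>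
     (\<forall>r c c' u v. c < c' \<longrightarrow> u \<in> ents L A (r, c) \<longrightarrow> v \<in> ents L A (r, c') \<longrightarrow> u \<le> v) \<and>
     (\<forall>r r' c u v. r < r' \<longrightarrow> u \<in> ents L A (r, c) \<longrightarrow> v \<in> ents L A (r', c) \<longrightarrow> u < v)"

lemma entsI: "v \<in> L x \<Longrightarrow> v \<in> ents L A x" "v \<in># A x \<Longrightarrow> v \<in> ents L A x"
  by (auto simp: ents_def)

lemma semistd_finite: "semistd L A \<Longrightarrow> finite (L x)"
  unfolding semistd_def by (elim conjE) (erule spec)

lemma semistd_pos: "semistd L A \<Longrightarrow> 0 \<notin> L x"
  unfolding semistd_def by (elim conjE) (erule spec)

lemma semistd_arm [rule_format]: "semistd L A \<Longrightarrow> \<forall>x v. v \<in># A x \<longrightarrow> (\<exists>u\<in>L x. u \<le> v)"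
  unfolding semistd_def by (elim conjE)

lemma semistd_shape [rule_format]:
  "semistd L A \<Longrightarrow> \<forall>r c r' c'. L (r, c) \<noteq> {} \<longrightarrow> r' \<le> r \<longrightarrow> c' \<le> c \<longrightarrow> L (r', c') \<noteq> {}"
  unfolding semistd_def by (elim conjE)

lemma semistd_row [rule_format]:
  "semistd L A \<Longrightarrow> \<forall>r c c' u v. c < c' \<longrightarrow> u \<in> ents L A (r, c) \<longrightarrow> v \<in> ents L A (r, c') \<longrightarrow> u \<le> v"
  unfolding semistd_def by (elim conjE)

lemma semistd_col [rule_format]:
  "semistd L A \<Longrightarrow> \<forall>r r' c u v. r < r' \<longrightarrow> u \<in> ents L A (r, c) \<longrightarrow> v \<in> ents L A (r', c) \<longrightarrow> u < v"
  unfolding semistd_def by (elim conjE)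

lemma hvI:
  assumes "\<And>x. finite (L x)" "\<And>x. 0 \<notin> L x" "\<And>x v. v \<in># A x \<Longrightarrow> \<exists>u\<in>L x. u \<le> v"
    "\<And>r c r' c'. L (r, c) \<noteq> {} \<Longrightarrow> r' \<le> r \<Longrightarrow> c' \<le> c \<Longrightarrow> L (r', c') \<noteq> {}"
    "\<And>r c c' u v. c < c' \<Longrightarrow> u \<in> ents L A (r, c) \<Longrightarrow> v \<in> ents L A (r, c') \<Longrightarrow> u \<le> v"
    "\<And>r r' c u v. r < r' \<Longrightarrow> u \<in> ents L A (r, c) \<Longrightarrow> v \<in> ents L A (r', c) \<Longrightarrow> u < v"
  shows "semistd L A"
  unfolding semistd_def by (intro conjI allI impI) (fact assms | erule (1) assms | erule (2) assms)+

lemma ents_L: "semistd L A \<Longrightarrow> v \<in> ents L A x \<Longrightarrow> \<exists>u\<in>L x. u \<le> v"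
  using semistd_arm[of L A v x] by (auto simp: ents_def)

lemma ents_nonempty: "semistd L A \<Longrightarrow> v \<in> ents L A x \<Longrightarrow> L x \<noteq> {}"
  using ents_L by blast

text \<open>The shape is closed under going down and left, so the corner cell \<open>(r', c)\<close>
  exists. Its extended leg supplies an entry between \<open>u\<close> and \<open>v\<close>: the
  column relation on one side, the row relation on the other.\<close>

lemma semistd_le:
  assumes "semistd L A" "r \<le> r'" "c \<le> c'" "(r, c) \<noteq> (r', c')" "u \<in> ents L A (r, c)" "v \<in> ents L A (r', c')"
  shows "u \<le> v"
proof (cases "r = r'")
  case True
  then show ?thesis using assms semistd_row[of L A c c'] by auto
next
  case False
  then have r: "r < r'" using assms by simp
  show ?thesis
  proof (cases "c = c'")
    case True
    then show ?thesis using assms r semistd_col[of L A r r' u c v] by auto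
  next
    case False
    have "L (r', c) \<noteq> {}" using semistd_shape[OF assms(1) ents_nonempty[OF assms(1,6)]] assms by auto
    then obtain w where "w \<in> L (r', c)" by auto
    then have "w \<in> ents L A (r', c)" by (auto intro: entsI)
    then show ?thesis
      using semistd_col[OF assms(1) r assms(5)] semistd_row[OF assms(1), of c c' w r' v] False assms by force
  qed
qed

text \<open>The same detour through the corner cell; its column step makes the inequality
  strict.\<close>

lemma semistd_less:
  assumes "semistd L A" "r < r'" "c \<le> c'" "u \<in> ents L A (r, c)" "v \<in> ents L A (r', c')"
  shows "u < v"
proof (cases "c = c'")
  case True
  then show ?thesis using assms semistd_col by blast
next
  case False
  have "L (r', c) \<noteq> {}" using semistd_shape[OF assms(1) ents_nonempty[OF assms(1,5)]] assms by auto
  then obtain w where "w \<in> L (r', c)" by auto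
  then have "w \<in> ents L A (r', c)" by (auto intro: entsI)
  then show ?thesis
    using semistd_col[OF assms(1,2,4)] semistd_row[OF assms(1), of c c' w r' v] False assms by force
qed

text \<open>Columns increase strictly. This reduces a count over a column to a count in a single
  cell.\<close>

lemma semistd_same_row: "semistd L A \<Longrightarrow> v \<in> ents L A (r, c) \<Longrightarrow> v \<in> ents L A (r', c) \<Longrightarrow> r' = r"
  using semistd_col[of L A r r' v c v] semistd_col[of L A r' r v c v] by (cases r r' rule: linorder_cases) auto

text \<open>If \<open>r'\<close> were above \<open>Suc r\<close>, the cell \<open>(Suc r, c)\<close>
  would be in the shape and its entries would lie strictly between \<open>i\<close> and
  \<open>Suc i\<close>.\<close>

lemma semistd_suc_row:
  assumes "semistd L A" "i \<in> ents L A (r, c)" "Suc i \<in> ents L A (r', c)"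
  shows "r' = r \<or> r' = Suc r"
proof (rule ccontr)
  assume H: "\<not> ?thesis"
  show False
  proof (cases "r' < r")
    case True
    then show False using semistd_col[OF assms(1) True assms(3,2)] by simp
  next
    case False
    then have "Suc r < r'" using H by simp
    then have "L (Suc r, c) \<noteq> {}"
      using semistd_shape[OF assms(1) ents_nonempty[OF assms(1,3)], of "Suc r" c] by simp
    then obtain w where "w \<in> ents L A (Suc r, c)" by (auto intro: entsI)
    then show False
      using semistd_col[OF assms(1) _ assms(2), of "Suc r" w] semistd_col[OF assms(1) \<open>Suc r < r'\<close> _ assms(3)] by force
  qed
qed

section \<open>Counting a value in a column\<close>

definition leg_count :: "legs \<Rightarrow> nat \<Rightarrow> nat \<Rightarrow> int" where
  "leg_count L v c = int (card {r. v \<in> L (r, c)})"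

text \<open>The sum runs over the rows whose arm contains \<open>v\<close>; in a semistandard
  filling there is at most one, so no bound on the shape has to be carried along.\<close>

definition arm_count :: "arms \<Rightarrow> nat \<Rightarrow> nat \<Rightarrow> int" where
  "arm_count A v c = (\<Sum>r | v \<in># A (r, c). int (count (A (r, c)) v))"

section \<open>Heights\<close>

definition col_net :: "legs \<Rightarrow> arms \<Rightarrow> nat \<Rightarrow> nat \<Rightarrow> int" where
  "col_net L A i c = leg_count L i c + arm_count A i c - leg_count L (Suc i) c - arm_count A (Suc i) c"

text \<open>The height of the part of the reading word that consists of the columns before
  \<open>c\<close>.\<close>

definition col_base :: "legs \<Rightarrow> arms \<Rightarrow> nat \<Rightarrow> nat \<Rightarrow> int" where
  "col_base L A i c = (\<Sum>c'<c. col_net L A i c')"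

text \<open>The height after the last \<open>i\<close> of the column: its arms list every \<open>i\<close> before every \<open>i + 1\<close>.\<close>

definition peak :: "legs \<Rightarrow> arms \<Rightarrow> nat \<Rightarrow> nat \<Rightarrow> int" where
  "peak L A i c = col_base L A i c + leg_count L i c + arm_count A i c - leg_count L (Suc i) c"

lemma arm_count_ge0 [simp]: "0 \<le> arm_count A v c" by (auto simp: arm_count_def intro: sum_nonneg)
lemma leg_count_ge0 [simp]: "0 \<le> leg_count L v c" by (auto simp: leg_count_def)

lemma col_base_0 [simp]: "col_base L A i 0 = 0" by (simp add: col_base_def)
text \<open>After the peak only the arm entries \<open>Suc i\<close> of the column remain to be
  read.\<close>

lemma col_base_Suc: "col_base L A i (Suc c) = peak L A i c - arm_count A (Suc i) c"
  by (simp add: col_base_def peak_def col_net_def)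
lemma col_base_Suc_le: "col_base L A i (Suc c) \<le> peak L A i c"
  using arm_count_ge0[of A "Suc i" c] by (simp add: col_base_Suc)

lemma leg_count_loc: assumes "semistd L A" "v \<in> ents L A (r, c)" shows "leg_count L v c = of_bool (v \<in> L (r, c))"
proof -
  have "{r'. v \<in> L (r', c)} = (if v \<in> L (r, c) then {r} else {})"
    using semistd_same_row[OF assms(1,2)] by (auto dest: entsI)
  then show ?thesis by (simp add: leg_count_def)
qed

lemma arm_count_loc: assumes "semistd L A" "v \<in> ents L A (r, c)" shows "arm_count A v c = int (count (A (r, c)) v)"
proof -
  have "{r'. v \<in># A (r', c)} = (if v \<in># A (r, c) then {r} else {})"
    using semistd_same_row[OF assms(1,2)] by (auto dest: entsI)
  then show ?thesis by (simp add: arm_count_def not_in_iff)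
qed

lemma leg_count_0: "(\<And>r. v \<notin> L (r, c)) \<Longrightarrow> leg_count L v c = 0" by (simp add: leg_count_def)
lemma arm_count_0: "(\<And>r. v \<notin># A (r, c)) \<Longrightarrow> arm_count A v c = 0" by (simp add: arm_count_def)
lemma leg_count_ents_0: "(\<And>r. v \<notin> ents L A (r, c)) \<Longrightarrow> leg_count L v c = 0"
  by (rule leg_count_0) (auto simp: ents_def)
lemma arm_count_ents_0: "(\<And>r. v \<notin> ents L A (r, c)) \<Longrightarrow> arm_count A v c = 0"
  by (rule arm_count_0) (auto simp: ents_def)

lemma leg_count_cong: "(\<And>r. v \<in> L (r, c) \<longleftrightarrow> v \<in> L' (r, c)) \<Longrightarrow> leg_count L v c = leg_count L' v c" by (simp add: leg_count_def)
lemma arm_count_cong: assumes "\<And>r. count (A (r, c)) v = count (A' (r, c)) v" shows "arm_count A v c = arm_count A' v c"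
proof -
  have "v \<in># A (r, c) \<longleftrightarrow> v \<in># A' (r, c)" for r using assms[of r] by (metis not_in_iff)
  then show ?thesis unfolding arm_count_def by (intro sum.cong) (auto simp: assms)
qed

lemma leg_count_le1: "semistd L A \<Longrightarrow> leg_count L v c \<le> 1"
  by (cases "\<exists>r. v \<in> L (r, c)") (use leg_count_loc entsI(1) in \<open>fastforce simp: leg_count_0\<close>)+

lemma leg_count_pos: "semistd L A \<Longrightarrow> v \<in> L (r, c) \<Longrightarrow> leg_count L v c = 1"
  using leg_count_loc[of L A v r c] entsI(1)[of v L "(r,c)" A] by simp

lemma leg_count_nonzeroE: assumes "leg_count L v c \<noteq> 0" obtains r where "v \<in> L (r, c)"
  using assms leg_count_0 by blast

text \<open>The condition \<open>0 \<le> M\<close> accounts for the empty prefix. The bound 0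
  characterises the vanishing of f_i; that the height of the whole word is a bound characterises the
  vanishing of e_i.\<close>

definition height_bound :: "legs \<Rightarrow> arms \<Rightarrow> nat \<Rightarrow> int \<Rightarrow> bool" where
  "height_bound L A i M \<longleftrightarrow> 0 \<le> M \<and> (\<forall>c. peak L A i c \<le> M)"

text \<open>The column in which f_i acts. Positivity is the comparison with the empty prefix: it
  says that some sign - stays unpaired.\<close>

definition first_max :: "legs \<Rightarrow> arms \<Rightarrow> nat \<Rightarrow> nat \<Rightarrow> bool" where
  "first_max L A i c \<longleftrightarrow> 0 < peak L A i c \<and> (\<forall>c'<c. peak L A i c' < peak L A i c) \<and>
     (\<forall>c'. peak L A i c' \<le> peak L A i c)"

lemma height_bound_col_base: "height_bound L A i M \<Longrightarrow> col_base L A i c \<le> M"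
proof (cases c)
  case (Suc d)
  then show "height_bound L A i M \<Longrightarrow> ?thesis" using col_base_Suc_le[of L A i d] by (auto simp: height_bound_def intro: order_trans)
qed (simp add: height_bound_def)

lemma first_max_height_bound: "first_max L A i c \<Longrightarrow> height_bound L A i (peak L A i c)"
  by (auto simp: first_max_def height_bound_def)

text \<open>A base is 0 or at most the peak of the preceding column; up to column \<open>c\<close>
  both lie below the first maximum.\<close>

lemma first_max_col_base: assumes "first_max L A i c" "x \<le> c" shows "col_base L A i x < peak L A i c"
proof (cases x)
  case 0
  then show ?thesis using assms by (simp add: first_max_def)
next
  case (Suc d)
  then show ?thesis using col_base_Suc_le[of L A i d] assms unfolding first_max_def
    by (meson Suc_le_eq le_less_trans)
qed

text \<open>The maximum exceeds the base of its own column, so the letters of the column up to the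
  peak contribute positively. Most local facts about the place where f_i acts come from this
  inequality.\<close>

lemma first_max_pos: "first_max L A i c \<Longrightarrow> leg_count L (Suc i) c < leg_count L i c + arm_count A i c"
  using first_max_col_base[of L A i c c] by (simp add: peak_def)

lemma first_max_unique: "first_max L A i c \<Longrightarrow> first_max L A i c' \<Longrightarrow> c = c'"
  unfolding first_max_def by (meson leD linorder_neqE_nat)

lemma col_base_eq_upto: "(\<And>x. x < y \<Longrightarrow> col_net L A i x = col_net L' A' i x) \<Longrightarrow> col_base L A i y = col_base L' A' i y"
  by (simp add: col_base_def)

lemma no_i_col_net: assumes "\<And>r. i \<notin> ents L A (r, x)"
  shows "peak L A i x = col_base L A i x - leg_count L (Suc i) x" "col_net L A i x = - leg_count L (Suc i) x - arm_count A (Suc i) x"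
  using leg_count_ents_0[OF assms] arm_count_ents_0[OF assms] by (auto simp: peak_def col_net_def)

lemma col_base_mono:
  assumes "\<And>x r. u \<le> x \<Longrightarrow> x < v \<Longrightarrow> i \<notin> ents L A (r, x)" "u \<le> v"
  shows "col_base L A i v \<le> col_base L A i u"
  using assms(2,1)
proof (induction v rule: dec_induct)
  case (step n)
  have "peak L A i n \<le> col_base L A i n"
    using no_i_col_net(1)[of i L A n] leg_count_ge0[of L "Suc i" n] step.prems step.hyps by simp
  moreover have "col_base L A i n \<le> col_base L A i u" using step.prems by (intro step.IH) auto
  ultimately show ?case using col_base_Suc_le[of L A i n] by linarith
qed simp

lemma peak_mono:
  assumes "\<And>x r. u \<le> x \<Longrightarrow> x < v \<Longrightarrow> i \<notin> ents L A (r, x)" "u \<le> x" "x < v"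
  shows "peak L A i x \<le> col_base L A i u"
proof -
  have "col_base L A i x \<le> col_base L A i u" using assms by (intro col_base_mono) auto
  moreover have "peak L A i x \<le> col_base L A i x"
    using no_i_col_net(1)[of i L A x] assms leg_count_ge0[of L "Suc i" x] by simp
  ultimately show ?thesis by linarith
qed

section \<open>Crystal operators on fillings\<close>

text \<open>The branches are (M), (S) and (N). In (N) the entry changed is an arm entry whenever the
  arm contains \<open>i\<close>: arms are read after legs, so the maximal height is reached
  there.\<close>

definition f_legs :: "nat \<Rightarrow> legs \<Rightarrow> arms \<Rightarrow> nat \<Rightarrow> nat \<Rightarrow> legs" where
  "f_legs i L A r c = (if Suc i \<in> ents L A (Suc r, c) then L
     else if i \<in> L (r, Suc c) then L((r, Suc c) := L (r, Suc c) - {i}, (r, c) := insert (Suc i) (L (r, c)))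
     else if i \<in># A (r, c) then L else L((r, c) := insert (Suc i) (L (r, c) - {i})))"

definition f_arms :: "nat \<Rightarrow> legs \<Rightarrow> arms \<Rightarrow> nat \<Rightarrow> nat \<Rightarrow> arms" where
  "f_arms i L A r c = (if Suc i \<in> ents L A (Suc r, c)
     then A((r, c) := A (r, c) - {#i#}, (Suc r, c) := add_mset (Suc i) (A (Suc r, c)))
     else if i \<in> L (r, Suc c) then A
     else if i \<in># A (r, c) then A((r, c) := add_mset (Suc i) (A (r, c) - {#i#})) else A)"

locale filling =
  fixes L :: legs and A :: arms
  assumes semistd: "semistd L A"
begin

lemma leg_ents: "v \<in> L x \<Longrightarrow> v \<in> ents L A x" and arm_ents: "v \<in># A x \<Longrightarrow> v \<in> ents L A x"
  by (auto simp: ents_def)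

end

text \<open>The column comes from the heights; \<open>r\<close> is then the only row of this column
  that contains \<open>i\<close>.\<close>

locale f_site = filling L A for L A +
  fixes i r c
  assumes fmx: "first_max L A i c" and inc: "i \<in> ents L A (r, c)"
begin

abbreviation "M \<equiv> Suc i \<in> ents L A (Suc r, c)"
abbreviation "S \<equiv> i \<in> L (r, Suc c)"

lemma i_row: "i \<in> ents L A (r', c) \<Longrightarrow> r' = r" using semistd_same_row[OF semistd inc] .
lemma nLi: "leg_count L i c = of_bool (i \<in> L (r, c))" using leg_count_loc[OF semistd inc] .
lemma nAi: "arm_count A i c = int (count (A (r, c)) i)" using arm_count_loc[OF semistd inc] .

text \<open>The entries above exceed \<open>i\<close> and the least one is at most
  \<open>Suc i\<close>, so it is a \<open>Suc i\<close> in the extended leg. It lowers the height by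
  one before the peak, hence \<open>first_max_pos\<close> asks for two letters \<open>i\<close> in
  \<open>(r, c)\<close>, of which the leg holds at most one.\<close>

lemma M_arm: assumes M shows "i \<in># A (r, c)" "Suc i \<in> L (Suc r, c)" "i \<in> L (r, c) \<or> count (A (r, c)) i \<ge> 2"
proof -
  obtain u where u: "u \<in> L (Suc r, c)" "u \<le> Suc i" using ents_L[OF semistd assms] by auto
  then have "u = Suc i" using semistd_col[OF semistd _ inc leg_ents[OF u(1)]] by simp
  then show *: "Suc i \<in> L (Suc r, c)" using u by simp
  have p: "leg_count L (Suc i) c = 1" using leg_count_loc[OF semistd assms] * by simp
  have "1 < of_bool (i \<in> L (r, c)) + int (count (A (r, c)) i)" using first_max_pos[OF fmx] p nLi nAi by simp
  then show "i \<in># A (r, c)" "i \<in> L (r, c) \<or> count (A (r, c)) i \<ge> 2"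
    by (auto simp: of_bool_def count_greater_zero_iff[symmetric] split: if_splits simp del: count_greater_zero_iff)
qed

text \<open>A single \<open>i\<close> in the leg would be cancelled by a leg entry
  \<open>Suc i\<close>, against \<open>first_max_pos\<close>.\<close>

lemma leg_no_suc: assumes "i \<notin># A (r, c)" shows "Suc i \<notin> L (r', c)"
proof
  assume "Suc i \<in> L (r', c)"
  then have "leg_count L (Suc i) c = 1" using leg_count_pos[OF semistd] by simp
  then show False using first_max_pos[OF fmx] nLi nAi assms by (auto simp: not_in_iff of_bool_def split: if_splits)
qed

lemma leg_i: assumes "i \<notin># A (r, c)" shows "i \<in> L (r, c)" using inc assms by (auto simp: ents_def)

lemma nM_up: assumes "\<not> M" "r < r'" "v \<in> ents L A (r', c)" shows "Suc i < v"
proof -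
  have "i < v" using semistd_col[OF semistd assms(2) inc assms(3)] .
  moreover have "v \<noteq> Suc i" using semistd_suc_row[OF semistd inc, of r'] assms by auto
  ultimately show ?thesis by simp
qed

lemma nM_suc: assumes "\<not> M" "Suc i \<in> ents L A (r', c)" shows "r' = r"
  using semistd_suc_row[OF semistd inc assms(2)] assms by auto

context assumes nM: "\<not> M" and SS: S begin
lemma S_le: "v \<in> ents L A (r, c) \<Longrightarrow> v \<le> i"
  using semistd_row[OF semistd lessI _ leg_ents[OF SS]] .
lemma S_nosuc: "Suc i \<notin> ents L A (r', c)"
  using nM_suc[OF nM] S_le by fastforce
text \<open>Such a \<open>Suc i\<close> would force the cell \<open>(Suc r, c)\<close> to exist with
  entries at most \<open>Suc i\<close>, whereas the failure of (M) makes them larger.\<close>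

lemma S_noup: "Suc i \<notin> ents L A (Suc r, Suc c)"
proof
  assume H: "Suc i \<in> ents L A (Suc r, Suc c)"
  then have "L (Suc r, c) \<noteq> {}" using semistd_shape[OF semistd ents_nonempty[OF semistd H], of "Suc r" c] by simp
  then obtain w where w: "w \<in> ents L A (Suc r, c)" by (auto intro: entsI)
  have "w \<le> Suc i" using semistd_row[OF semistd _ w H] by simp
  then show False using nM_up[OF nM lessI w] by simp
qed
text \<open>Column \<open>c\<close> contains no \<open>Suc i\<close>, so column \<open>Suc c\<close>
  starts at the maximal height. Its leg entry \<open>i\<close> must then be cancelled by a leg entry
  \<open>Suc i\<close>, and no arm entry \<open>i\<close> is left room for; \<open>S_noup\<close>
  puts this \<open>Suc i\<close> into the same cell.\<close>

lemma S_data: "arm_count A i (Suc c) = 0" "leg_count L (Suc i) (Suc c) = 1" "leg_count L i (Suc c) = 1" "arm_count A (Suc i) c = 0" "leg_count L (Suc i) c = 0"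
  "Suc i \<in> L (r, Suc c)" "i \<notin># A (r, Suc c)"
proof -
  show b: "arm_count A (Suc i) c = 0" using S_nosuc arm_count_ents_0 by blast
  show p: "leg_count L (Suc i) c = 0" using S_nosuc leg_count_ents_0 by blast
  show m: "leg_count L i (Suc c) = 1" using leg_count_pos[OF semistd SS] .
  have "peak L A i (Suc c) \<le> peak L A i c" using fmx by (simp add: first_max_def)
  then have "1 + arm_count A i (Suc c) \<le> leg_count L (Suc i) (Suc c)"
    using b m by (simp add: peak_def[of L A i "Suc c"] col_base_Suc)
  then show a: "arm_count A i (Suc c) = 0" "leg_count L (Suc i) (Suc c) = 1"
    using leg_count_le1[OF semistd, of "Suc i" "Suc c"] arm_count_ge0[of A i "Suc c"] by linarith+
  then have "leg_count L (Suc i) (Suc c) \<noteq> 0" by simp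
  then obtain r' where r': "Suc i \<in> L (r', Suc c)" by (rule leg_count_nonzeroE)
  then show "Suc i \<in> L (r, Suc c)"
    using semistd_suc_row[OF semistd leg_ents[OF SS] leg_ents[OF r']] S_noup by (auto intro: entsI)
  show "i \<notin># A (r, Suc c)" using a arm_count_loc[OF semistd leg_ents[OF SS]] by (simp add: not_in_iff)
qed
lemma S_right: "v \<in> ents L A (r, Suc c) \<Longrightarrow> v \<noteq> i \<Longrightarrow> Suc i \<le> v"
  using semistd_row[OF semistd lessI inc] by fastforce
end

context assumes nM: "\<not> M" and nS: "\<not> S" begin
text \<open>An \<open>i\<close> further right would squeeze all entries of the right neighbour to
  \<open>i\<close>; an \<open>i\<close> in the neighbour has its least entry equal to
  \<open>i\<close>. Either way (S) would apply.\<close>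

lemma N_right: assumes "c < c'" "v \<in> ents L A (r, c')" shows "Suc i \<le> v"
proof -
  have le: "i \<le> v" using semistd_row[OF semistd assms(1) inc assms(2)] .
  moreover have "v \<noteq> i"
  proof
    assume "v = i"
    have "L (r, Suc c) \<noteq> {}" using semistd_shape[OF semistd ents_nonempty[OF semistd assms(2)], of r "Suc c"] assms by simp
    then obtain w where w: "w \<in> L (r, Suc c)" by auto
    have iw: "i \<le> w" using semistd_row[OF semistd lessI inc leg_ents[OF w]] .
    show False
    proof (cases "c' = Suc c")
      case True
      then obtain u where u: "u \<in> L (r, Suc c)" "u \<le> i" using ents_L[OF semistd assms(2)] \<open>v = i\<close> by auto
      then have "u = i" using semistd_row[OF semistd lessI inc leg_ents[OF u(1)]] by simp
      then show False using u nS by simp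
    next
      case False
      then have "w \<le> i" using semistd_row[OF semistd _ leg_ents[OF w] assms(2)] assms(1) \<open>v = i\<close> by simp
      then show False using iw w nS by simp
    qed
  qed
  ultimately show ?thesis by simp
qed
end

end

text \<open>Each operation enlarges the value set of only one cell, by a set \<open>W\<close>. The
  order relations then have to be checked only between \<open>W\<close> and the row and column of
  this cell; all others are inherited.\<close>

lemma semistd_modify:
  assumes semistd: "semistd L A" and fin: "\<And>x. finite (L' x)"
    and shape: "\<And>r c r' c'. L' (r, c) \<noteq> {} \<Longrightarrow> r' \<le> r \<Longrightarrow> c' \<le> c \<Longrightarrow> L' (r', c') \<noteq> {}"
    and arm: "\<And>x v. v \<in># A' x \<Longrightarrow> \<exists>u\<in>L' x. u \<le> v"
    and sub: "\<And>x. x \<noteq> (r, c) \<Longrightarrow> ents L' A' x \<subseteq> ents L A x" "ents L' A' (r, c) \<subseteq> ents L A (r, c) \<union> W"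
    and pos: "0 \<notin> W"
    and right: "\<And>c' v w. c < c' \<Longrightarrow> v \<in> ents L' A' (r, c') \<Longrightarrow> w \<in> W \<Longrightarrow> w \<le> v"
    and left: "\<And>c' v w. c' < c \<Longrightarrow> v \<in> ents L' A' (r, c') \<Longrightarrow> w \<in> W \<Longrightarrow> v \<le> w"
    and up: "\<And>r' v w. r < r' \<Longrightarrow> v \<in> ents L' A' (r', c) \<Longrightarrow> w \<in> W \<Longrightarrow> w < v"
    and down: "\<And>r' v w. r' < r \<Longrightarrow> v \<in> ents L' A' (r', c) \<Longrightarrow> w \<in> W \<Longrightarrow> v < w"
  shows "semistd L' A'"
proof (rule hvI)
  have 0: "v \<in> ents L A x \<or> x = (r, c) \<and> v \<in> W" if "v \<in> ents L' A' x" for v x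
    using that sub(1)[of x] sub(2) by (cases "x = (r, c)") blast+
  have z: "v \<in> ents L A x \<Longrightarrow> v \<noteq> 0" for v x
    using ents_L[OF semistd, of v x] semistd_pos[OF semistd, of x] by (metis le_zero_eq)
  show "0 \<notin> L' x" for x using 0[of 0 x] z[of 0 x] pos by (auto simp: ents_def)
  show "u \<le> v" if "d < d'" "u \<in> ents L' A' (q, d)" "v \<in> ents L' A' (q, d')" for q d d' u v
    using 0[OF that(2)] 0[OF that(3)] semistd_row[OF semistd that(1)] right[of d' v u] left[of d u v] that by auto
  show "u < v" if "q < q'" "u \<in> ents L' A' (q, d)" "v \<in> ents L' A' (q', d)" for q q' d u v
    using 0[OF that(2)] 0[OF that(3)] semistd_col[OF semistd that(1)] up[of q' v u] down[of q u v] that by auto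
qed (fact fin shape arm)+

text \<open>In contrast to \<open>arm_count_loc\<close>, this applies to a changed arm map from
  which \<open>v\<close> may have disappeared.\<close>

lemma arm_count_only: assumes "\<And>r'. r' \<noteq> r \<Longrightarrow> v \<notin># A (r', c)" shows "arm_count A v c = int (count (A (r, c)) v)"
proof -
  have "{r'. v \<in># A (r', c)} = (if v \<in># A (r, c) then {r} else {})"
    using assms by (intro set_eqI) (metis empty_iff mem_Collect_eq singleton_iff)
  then show ?thesis unfolding arm_count_def by (simp add: not_in_iff)
qed

lemma col_base_shift:
  assumes "\<And>y. y \<noteq> c \<Longrightarrow> y \<noteq> d \<Longrightarrow> col_net L' A' i y = col_net L A i y"
    "col_net L' A' i c = col_net L A i c + \<alpha>" "col_net L' A' i d = col_net L A i d + \<beta>" "c \<noteq> d"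
  shows "col_base L' A' i x = col_base L A i x + (if c < x then \<alpha> else 0) + (if d < x then \<beta> else 0)"
proof (induction x)
  case (Suc x)
  have "col_base L' A' i (Suc x) = col_base L' A' i x + col_net L' A' i x" for L' :: legs and A' by (simp add: col_base_def)
  then show ?case using Suc assms by (cases "x = c"; cases "x = d") auto
qed simp

lemma col_base_shift1:
  assumes "\<And>y. y \<noteq> c \<Longrightarrow> col_net L' A' i y = col_net L A i y" "col_net L' A' i c = col_net L A i c + \<alpha>"
  shows "col_base L' A' i x = col_base L A i x + (if c < x then \<alpha> else 0)"
  using col_base_shift[of c "Suc c" L' A' i L A \<alpha> 0] assms by simp

text \<open>The maximal height is attained for the last time in column \<open>c\<close>, and the letter \<open>i + 1\<close> that
  follows is an arm entry of column \<open>c\<close> if \<open>arm\<close> holds and a leg entry of it otherwise.\<close>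

definition last_max :: "legs \<Rightarrow> arms \<Rightarrow> nat \<Rightarrow> bool \<Rightarrow> nat \<Rightarrow> bool" where
  "last_max L A i arm c \<longleftrightarrow>
    (if arm then 0 \<le> peak L A i c \<and> 1 \<le> arm_count A (Suc i) c \<and>
       (\<forall>c'. peak L A i c' \<le> peak L A i c) \<and> (\<forall>c'>c. peak L A i c' < peak L A i c)
     else 0 \<le> col_base L A i c \<and> (\<forall>c'<c. peak L A i c' \<le> col_base L A i c) \<and> (\<forall>c'\<ge>c. peak L A i c' < col_base L A i c))"

text \<open>A set of extended leg entries does not single out the hook entry, so lying in the proper
  leg is expressed by the presence of a smaller element. A cell may have \<open>Suc i\<close> both
  in its leg and in its arm; the flag \<open>arm\<close> says which one is lowered.\<close>

definition e_legs :: "nat \<Rightarrow> bool \<Rightarrow> legs \<Rightarrow> arms \<Rightarrow> nat \<Rightarrow> nat \<Rightarrow> legs" where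
  "e_legs i arm L A r c = (if 0 < r \<and> i \<in> ents L A (r - 1, c) then L
     else if 0 < c \<and> Suc i \<in> L (r, c - 1) \<and> (\<exists>u\<in>L (r, c - 1). u < Suc i)
       then L((r, c - 1) := L (r, c - 1) - {Suc i}, (r, c) := insert i (L (r, c)))
     else if arm then L else L((r, c) := insert i (L (r, c) - {Suc i})))"

definition e_arms :: "nat \<Rightarrow> bool \<Rightarrow> legs \<Rightarrow> arms \<Rightarrow> nat \<Rightarrow> nat \<Rightarrow> arms" where
  "e_arms i arm L A r c = (if 0 < r \<and> i \<in> ents L A (r - 1, c)
       then A((r, c) := A (r, c) - {#Suc i#}, (r - 1, c) := add_mset i (A (r - 1, c)))
     else if 0 < c \<and> Suc i \<in> L (r, c - 1) \<and> (\<exists>u\<in>L (r, c - 1). u < Suc i) then A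
     else if arm then A((r, c) := add_mset i (A (r, c) - {#Suc i#})) else A)"

lemma col_base_le_max: "col_base L A i x \<le> 0 \<or> (\<exists>y<x. col_base L A i x \<le> peak L A i y)"
  using col_base_Suc_le[of L A i "x - 1"] by (cases x) auto

lemma col_base_le_bound: "0 \<le> M \<Longrightarrow> (\<And>y. y < x \<Longrightarrow> peak L A i y \<le> M) \<Longrightarrow> col_base L A i x \<le> M"
  using col_base_le_max[of L A i x] by (meson order_trans)

text \<open>\<open>M\<close> is the maximal height. All bases after column \<open>c\<close> stay
  below it, so the height of the whole word is not a bound, which excludes the vanishing of
  e_i.\<close>

lemma last_max_top: assumes "last_max L A i arm c"
  shows "\<exists>M\<ge>0. (\<forall>B. height_bound L A i B \<longrightarrow> M \<le> B) \<and> (\<forall>N>c. col_base L A i N < M)"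
proof (cases arm)
  case True
  show ?thesis
  proof (intro exI[of _ "peak L A i c"] conjI allI impI)
    fix N assume N: "c < N"
    then obtain n where n: "N = Suc n" by (cases N) auto
    show "col_base L A i N < peak L A i c"
    proof (cases "n = c")
      case True
      then show ?thesis using assms \<open>arm\<close> n by (simp add: last_max_def col_base_Suc)
    next
      case False
      then have "peak L A i n < peak L A i c" using assms \<open>arm\<close> n N by (simp add: last_max_def)
      then show ?thesis using n col_base_Suc_le[of L A i n] by simp
    qed
  qed (use assms True in \<open>auto simp: last_max_def height_bound_def\<close>)
next
  case False
  show ?thesis
  proof (intro exI[of _ "col_base L A i c"] conjI allI impI)
    fix N assume N: "c < N"
    then obtain n where n: "N = Suc n" by (cases N) auto
    then have "peak L A i n < col_base L A i c" using assms False N by (simp add: last_max_def)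
    then show "col_base L A i N < col_base L A i c" using n col_base_Suc_le[of L A i n] by simp
  qed (use assms False height_bound_col_base in \<open>auto simp: last_max_def\<close>)
qed

text \<open>The marked letter follows the last prefix of maximal height. Two different marked places
  contradict each other, since after the earlier one the height stays below the maximum that the
  later one attains.\<close>

lemma last_max_unique: assumes "last_max L A i arm c" "last_max L A i arm' c'" shows "arm = arm' \<and> c = c'"
proof -
  have leg_arm: False if a: "last_max L A i True x" and l: "last_max L A i False y" for x y
  proof (cases "y \<le> x")
    case True
    then have "peak L A i x < col_base L A i y" using l by (simp add: last_max_def)
    then show False using col_base_le_bound[of "peak L A i x" y L A i] a by (simp add: last_max_def)
  next
    case False
    then obtain z where z: "y = Suc z" "x \<le> z" by (cases y) auto
    have p: "peak L A i x \<le> col_base L A i y" using l False by (simp add: last_max_def)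
    show False
    proof (cases "z = x")
      case True
      then show False using p z a by (simp add: col_base_Suc last_max_def)
    next
      case False
      then have "peak L A i z < peak L A i x" using a z by (simp add: last_max_def)
      then show False using p z col_base_Suc_le[of L A i z] by simp
    qed
  qed
  have leg: False if a: "last_max L A i False x" and l: "last_max L A i False y" and "x < y" for x y
  proof -
    obtain z where z: "y = Suc z" "x \<le> z" using \<open>x < y\<close> by (cases y) auto
    then have "peak L A i z < col_base L A i x" using a by (simp add: last_max_def)
    then have "col_base L A i y < col_base L A i x" using z col_base_Suc_le[of L A i z] by simp
    moreover have "col_base L A i x \<le> col_base L A i y" using l \<open>x < y\<close>
      by (intro col_base_le_bound) (auto simp: last_max_def)
    ultimately show False by simp
  qed
  have arm: False if a: "last_max L A i True x" and l: "last_max L A i True y" and "x < y" for x y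
    using that unfolding last_max_def by (meson leD)
  show ?thesis
    using assms leg_arm[of c c'] leg_arm[of c' c] leg[of c c'] leg[of c' c] arm[of c c'] arm[of c' c]
    by (cases arm; cases arm'; cases c c' rule: linorder_cases) auto
qed

section \<open>f_i preserves semistandardness and is undone by e_i\<close>

context f_site
begin

abbreviation "L' \<equiv> f_legs i L A r c"
abbreviation "A' \<equiv> f_arms i L A r c"

lemma upd_M: "M \<Longrightarrow> L' = L" "M \<Longrightarrow> A' = A((r, c) := A (r, c) - {#i#}, (Suc r, c) := add_mset (Suc i) (A (Suc r, c)))"
  by (simp_all add: f_legs_def f_arms_def)
lemma upd_S: "\<not> M \<Longrightarrow> S \<Longrightarrow> L' = L((r, Suc c) := L (r, Suc c) - {i}, (r, c) := insert (Suc i) (L (r, c)))"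
  "\<not> M \<Longrightarrow> S \<Longrightarrow> A' = A"
  by (simp_all add: f_legs_def f_arms_def)
lemma upd_Na: "\<not> M \<Longrightarrow> \<not> S \<Longrightarrow> i \<in># A (r, c) \<Longrightarrow> L' = L"
  "\<not> M \<Longrightarrow> \<not> S \<Longrightarrow> i \<in># A (r, c) \<Longrightarrow> A' = A((r, c) := add_mset (Suc i) (A (r, c) - {#i#}))"
  by (simp_all add: f_legs_def f_arms_def)
lemma upd_Nl: "\<not> M \<Longrightarrow> \<not> S \<Longrightarrow> i \<notin># A (r, c) \<Longrightarrow> L' = L((r, c) := insert (Suc i) (L (r, c) - {i}))"
  "\<not> M \<Longrightarrow> \<not> S \<Longrightarrow> i \<notin># A (r, c) \<Longrightarrow> A' = A"
  by (simp_all add: f_legs_def f_arms_def)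

text \<open>A cell that loses \<open>i\<close> keeps or gains \<open>Suc i\<close>; for (S) this is
  part of \<open>S_data\<close>. So f_i preserves the shape.\<close>

lemma L'_nonempty: "L' x \<noteq> {} \<longleftrightarrow> L x \<noteq> {}"
proof (cases "\<not> M \<and> S")
  case True
  then show ?thesis using S_data(6) upd_S ents_nonempty[OF semistd inc] by auto
next
  case False
  then show ?thesis using leg_i by (auto simp: f_legs_def)
qed

lemma semistd_f: "semistd L' A'"
proof -
  have shape: "\<And>r c r' c'. L' (r, c) \<noteq> {} \<Longrightarrow> r' \<le> r \<Longrightarrow> c' \<le> c \<Longrightarrow> L' (r', c') \<noteq> {}"
    unfolding L'_nonempty using semistd_shape[OF semistd] by blast
  have fin: "finite (L' x)" for x using semistd_finite[OF semistd] by (auto simp: f_legs_def)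
  have arm: "\<exists>u\<in>L x. u \<le> v" if "v \<in># A x" for v x using semistd_arm[OF semistd that] .
  show ?thesis
  proof (cases M)
    case True
    have eA': "v \<in># A' x \<Longrightarrow> v \<in> ents L' A' x" for v x by (auto simp: ents_def)
    have 1: "ents L' A' x \<subseteq> ents L A x" for x
      using True by (auto simp: upd_M ents_def dest: in_diffD split: if_splits)
    show ?thesis
    \<comment> \<open>In (M) the moved \<open>Suc i\<close> already occurs in the upper cell, so no
      cell gains a value.\<close>
    proof (rule semistd_modify[where L = L and A = A and L' = L' and A' = A' and W = "{}", OF semistd fin shape])
      show "\<exists>u\<in>L' x. u \<le> v" if "v \<in># A' x" for v x
        using ents_L[OF semistd subsetD[OF 1 eA']] that True by (simp add: upd_M)
    qed (use 1 in auto)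
  next
    case nM: False
    show ?thesis
    \<comment> \<open>Otherwise only \<open>(r, c)\<close> gains a value, namely
      \<open>Suc i\<close>; in (S) the neighbour merely loses \<open>i\<close>.\<close>
    proof (rule semistd_modify[where L = L and A = A and L' = L' and A' = A' and W = "{Suc i}" and r = r and c = c, OF semistd fin shape])
      show a: "\<exists>u\<in>L' x. u \<le> v" if v: "v \<in># A' x" for v x
      proof (cases S)
        case S: True
        obtain u where u: "u \<in> L x" "u \<le> v" using arm[of v x] v nM S by (auto simp: upd_S)
        show ?thesis
        \<comment> \<open>When the neighbour loses its least entry \<open>i\<close>, its
          \<open>Suc i\<close> takes over: its arm contains no \<open>i\<close> by
          \<open>S_data\<close>.\<close>
        proof (cases "x = (r, Suc c) \<and> u = i")
          case True
          have "v \<noteq> i" using True v nM S S_data(7) by (auto simp: upd_S)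
          then have "Suc i \<le> v" using S_right[OF nM S, of v] v nM S True by (auto simp: upd_S ents_def)
          then show ?thesis using S_data(6)[OF nM S] True nM S by (intro bexI[of _ "Suc i"]) (auto simp: upd_S)
        next
          case False
          then show ?thesis using u nM S by (intro bexI[of _ u]) (auto simp: upd_S)
        qed
      next
        case nS: False
        show ?thesis
        proof (cases "i \<in># A (r, c)")
          case True
          then obtain u where "u \<in> L (r, c)" "u \<le> i" using arm by blast
          then show ?thesis using arm[of v x] v nM nS True
            by (auto simp: upd_Na dest: in_diffD split: if_splits intro: le_SucI)
        next
          case False
          obtain u where u: "u \<in> L x" "u \<le> v" using arm[of v x] v nM nS False by (auto simp: upd_Nl)
          show ?thesis
          proof (cases "x = (r, c) \<and> u = i")
            case True
            then have "Suc i \<le> v" using u v False nM nS by (auto simp: upd_Nl le_less)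
            then show ?thesis using True nM nS False by (intro bexI[of _ "Suc i"]) (auto simp: upd_Nl)
          next
            case F: False
            then show ?thesis using u nM nS False by (intro bexI[of _ u]) (auto simp: upd_Nl)
          qed
        qed
      qed
      have s0: "ents L' A' x \<subseteq> ents L A x \<union> (if x = (r, c) then {Suc i} else {})" for x
        using nM by (cases S; cases "i \<in># A (r, c)")
          (auto simp: ents_def upd_S upd_Na upd_Nl dest: in_diffD split: if_splits)
      show sub: "ents L' A' x \<subseteq> ents L A x" if "x \<noteq> (r, c)" for x using s0[of x] that by simp
      show "ents L' A' (r, c) \<subseteq> ents L A (r, c) \<union> {Suc i}" using s0[of "(r, c)"] by simp
      show "w \<le> v" if "c < c'" "v \<in> ents L' A' (r, c')" "w \<in> {Suc i}" for c' v w
      proof -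
        have v: "v \<in> ents L A (r, c')" using sub[of "(r, c')"] that by auto
        show ?thesis
        proof (cases S)
          case S: True
          show ?thesis
          proof (cases "c' = Suc c")
            case True
            have "v \<noteq> i" using that True nM S S_data(7)[OF nM S] by (auto simp: upd_S ents_def)
            then show ?thesis using S_right[OF nM S] v True that by auto
          next
            case False
            then show ?thesis using semistd_row[OF semistd _ leg_ents[OF S_data(6)[OF nM S]] v] that by simp
          qed
        next
          case False
          then show ?thesis using N_right[OF nM False that(1) v] that by simp
        qed
      qed
      show "v \<le> w" if "c' < c" "v \<in> ents L' A' (r, c')" "w \<in> {Suc i}" for c' v w
      proof -
        have "v \<le> i" using semistd_row[OF semistd that(1) _ inc] sub[of "(r, c')"] that by auto
        then show ?thesis using that by simp
      qed
      show "w < v" if "r < r'" "v \<in> ents L' A' (r', c)" "w \<in> {Suc i}" for r' v w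
        using nM_up[OF nM that(1)] sub[of "(r', c)"] that by auto
      show "v < w" if "r' < r" "v \<in> ents L' A' (r', c)" "w \<in> {Suc i}" for r' v w
      proof -
        have "v < i" using semistd_col[OF semistd that(1) _ inc] sub[of "(r', c)"] that by auto
        then show ?thesis using that by simp
      qed
    qed simp_all
  qed
qed

end

text \<open>An arm \<open>Suc i\<close> is read after the peak, so the peak of \<open>c\<close>
  drops by 1 only, while all later peaks drop by 2. The new maximum is the old one minus 1; earlier
  columns can reach it, later ones cannot.\<close>

lemma last_max_arm_step:
  assumes "first_max L A i c" "arm_count A' i c = arm_count A i c - 1" "arm_count A' (Suc i) c = arm_count A (Suc i) c + 1"
    "\<And>y v. y \<noteq> c \<Longrightarrow> arm_count A' v y = arm_count A v y"
  shows "last_max L A' i True c"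
proof -
  have b: "col_base L A' i x = col_base L A i x + (if c < x then -2 else 0)" for x
    by (rule col_base_shift1) (use assms in \<open>simp_all add: col_net_def\<close>)
  have p: "peak L A' i x = peak L A i x + (if x = c then -1 else if c < x then -2 else 0)" for x
    using assms(2,4) b[of x] by (cases "x = c") (simp_all add: peak_def)
  have "0 < peak L A i c" "\<And>x. x < c \<Longrightarrow> peak L A i x < peak L A i c" "\<And>x. peak L A i x \<le> peak L A i c"
    using assms(1) by (simp_all add: first_max_def)
  moreover have "1 \<le> arm_count A' (Suc i) c" using assms(3) arm_count_ge0[of A "Suc i" c] by linarith
  ultimately show ?thesis by (auto simp: last_max_def p intro: add_mono order_trans[of _ "_ - _"] less_imp_le)
      (smt (verit))+
qed

lemma first_max_arm_step:
  assumes "last_max L A i True c" "arm_count A' i c = arm_count A i c + 1" "arm_count A' (Suc i) c = arm_count A (Suc i) c - 1"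
    "\<And>y v. y \<noteq> c \<Longrightarrow> arm_count A' v y = arm_count A v y"
  shows "first_max L A' i c"
proof -
  have b: "col_base L A' i x = col_base L A i x + (if c < x then 2 else 0)" for x
    by (rule col_base_shift1) (use assms in \<open>simp_all add: col_net_def\<close>)
  have p: "peak L A' i x = peak L A i x + (if x = c then 1 else if c < x then 2 else 0)" for x
    using assms(2,4) b[of x] by (cases "x = c") (simp_all add: peak_def)
  have "0 \<le> peak L A i c" "\<And>x. peak L A i x \<le> peak L A i c" "\<And>x. c < x \<Longrightarrow> peak L A i x < peak L A i c"
    using assms(1) by (simp_all add: last_max_def)
  then show ?thesis by (auto simp: first_max_def p) (smt (verit))+
qed

context f_site
begin

lemma f_last_max_M: assumes M shows "last_max L' A' i True c"
proof -
  note m = M_arm[OF assms]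
  have i': "i \<in> ents L' A' (r, c)" using m(1,3) assms by (auto simp: upd_M ents_def in_diff_count)
  have s': "Suc i \<in> ents L' A' (Suc r, c)" using assms by (auto simp: upd_M ents_def)
  have "last_max L A' i True c"
  proof (rule last_max_arm_step[OF fmx])
    show "arm_count A' i c = arm_count A i c - 1"
      using m(1) assms arm_count_loc[OF semistd_f i'] nAi by (simp add: upd_M of_nat_diff Suc_le_eq)
    show "arm_count A' (Suc i) c = arm_count A (Suc i) c + 1"
      using assms arm_count_loc[OF semistd_f s'] arm_count_loc[OF semistd assms] by (simp add: upd_M)
    show "arm_count A' v y = arm_count A v y" if "y \<noteq> c" for v y
      using that assms by (intro arm_count_cong) (simp add: upd_M)
  qed
  then show ?thesis using assms by (simp add: upd_M)
qed

lemma f_last_max_Na: assumes "\<not> M" "\<not> S" "i \<in># A (r, c)" shows "last_max L' A' i True c"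
proof -
  have s': "Suc i \<in> ents L' A' (r, c)" using assms by (auto simp: upd_Na ents_def)
  have o: "i \<notin># A' (r', c)" if "r' \<noteq> r" for r'
    using i_row[OF arm_ents, of r'] that assms by (auto simp: upd_Na)
  have "last_max L A' i True c"
  proof (rule last_max_arm_step[OF fmx])
    show "arm_count A' i c = arm_count A i c - 1"
      using assms arm_count_only[where r = r and c = c and v = i and A = A', OF o] nAi by (simp add: upd_Na of_nat_diff Suc_le_eq)
    have "arm_count A (Suc i) c = int (count (A (r, c)) (Suc i))"
      using nM_suc[OF assms(1) arm_ents] by (intro arm_count_only) blast
    then show "arm_count A' (Suc i) c = arm_count A (Suc i) c + 1"
      using assms arm_count_loc[OF semistd_f s'] by (simp add: upd_Na)
    show "arm_count A' v y = arm_count A v y" if "y \<noteq> c" for v y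
      using that assms by (intro arm_count_cong) (simp add: upd_Na)
  qed
  then show ?thesis using assms by (simp add: upd_Na)
qed

text \<open>With a leg \<open>i\<close> and no arm \<open>i\<close> the old maximum is the base of
  \<open>c\<close> plus 1. The new maximum is this base, and the raised leg entry is the first
  relevant letter after it.\<close>

lemma f_last_max_Nl: assumes "\<not> M" "\<not> S" "i \<notin># A (r, c)" shows "last_max L' A' i False c"
proof -
  note u = upd_Nl[OF assms]
  have s': "Suc i \<in> ents L' A' (r, c)" by (auto simp: u ents_def)
  have arm_count: "arm_count A' = arm_count A" by (simp add: u)
  have d: "leg_count L i c = 1" "arm_count A i c = 0" "leg_count L (Suc i) c = 0"
    using nLi nAi leg_i[OF assms(3)] assms(3) leg_count_0 leg_no_suc[OF assms(3)] by (auto simp: not_in_iff)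
  have d': "leg_count L' (Suc i) c = 1" using leg_count_loc[OF semistd_f s'] by (simp add: u)
  have "i \<notin> L' (r', c)" for r' using i_row[OF leg_ents, of r'] by (auto simp: u)
  then have e': "leg_count L' i c = 0" by (rule leg_count_0)
  have o: "leg_count L' v y = leg_count L v y" if "y \<noteq> c" for v y
    using that by (intro leg_count_cong) (simp add: u)
  have b: "col_base L' A' i x = col_base L A i x + (if c < x then -2 else 0)" for x
    by (rule col_base_shift1) (use o d d' e' in \<open>simp_all add: col_net_def arm_count\<close>)
  have p: "peak L' A' i x = peak L A i x + (if c = x then -2 else if c < x then -2 else 0)" for x
    using o d d' e' b[of x] by (cases "x = c") (simp_all add: peak_def arm_count)
  have pc: "peak L A i c = col_base L A i c + 1" using d by (simp add: peak_def)
  have "0 < peak L A i c" "\<And>x. x < c \<Longrightarrow> peak L A i x < peak L A i c" "\<And>x. peak L A i x \<le> peak L A i c"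
    using fmx by (simp_all add: first_max_def)
  then show ?thesis using pc by (auto simp: last_max_def p b) (smt (verit))+
qed

text \<open>The new \<open>Suc i\<close> stands in column \<open>c\<close>, but e_i acts on the old
  \<open>Suc i\<close> in the leg of \<open>(r, Suc c)\<close>, which follows the last maximum; rule
  (S) for e_i then undoes the move.\<close>

lemma f_last_max_S: assumes "\<not> M" S shows "last_max L' A' i False (Suc c)"
proof -
  note u = upd_S[OF assms] and sd = S_data[OF assms]
  have s': "Suc i \<in> ents L' A' (r, c)" by (auto simp: u ents_def)
  have arm_count: "arm_count A' = arm_count A" by (simp add: u)
  have d': "leg_count L' (Suc i) c = 1" using leg_count_loc[OF semistd_f s'] by (simp add: u)
  have "i \<notin> L' (r', Suc c)" for r' using semistd_same_row[OF semistd leg_ents[OF assms(2)] leg_ents, of r'] by (auto simp: u)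
  then have e': "leg_count L' i (Suc c) = 0" by (rule leg_count_0)
  have o: "leg_count L' v y = leg_count L v y" if "y \<noteq> c \<or> v \<noteq> Suc i" "y \<noteq> Suc c \<or> v \<noteq> i" for v y
    using that by (intro leg_count_cong) (auto simp: u)
  have b: "col_base L' A' i x = col_base L A i x + (if c < x then -1 else 0) + (if Suc c < x then -1 else 0)" for x
    by (rule col_base_shift) (use o sd d' e' in \<open>simp_all add: col_net_def arm_count\<close>)
  have p: "peak L' A' i x = peak L A i x + (if c = x then -1 else if c < x then -2 else 0)" for x
    using o sd d' e' b[of x] by (cases "x = c"; cases "x = Suc c") (simp_all add: peak_def arm_count)
  have bc: "col_base L A i (Suc c) = peak L A i c" using sd by (simp add: col_base_Suc)
  have "0 < peak L A i c" "\<And>x. x < c \<Longrightarrow> peak L A i x < peak L A i c" "\<And>x. peak L A i x \<le> peak L A i c"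
    using fmx by (simp_all add: first_max_def)
  then show ?thesis using bc by (auto simp: last_max_def p b less_Suc_eq Suc_le_eq) (smt (verit))+
qed

text \<open>e_i acts at the upper cell after (M), at the right cell after (S) and at the same cell
  after (N).\<close>

lemma f_inverse:
  "\<exists>arm r' c'. last_max L' A' i arm c' \<and> (if arm then Suc i \<in># A' (r', c') else Suc i \<in> L' (r', c')) \<and>
     e_legs i arm L' A' r' c' = L \<and> e_arms i arm L' A' r' c' = A"
proof -
  \<comment> \<open>\<open>i\<close> does not occur below \<open>(r, c)\<close> and
    \<open>Suc i\<close> not in the leg to its left, so after (N) the tests of e_i for (M) and (S)
    fail.\<close>
  have down: "\<not> (0 < r \<and> i \<in> ents L A (r - 1, c))" using i_row[of "r - 1"] by auto
  have left: "\<not> (0 < c \<and> Suc i \<in> L (r, c - 1))"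
    using semistd_row[OF semistd, of "c - 1" c "Suc i" r i] inc by (auto dest: leg_ents)
  consider (M) M | (S) "\<not> M" S | (Na) "\<not> M" "\<not> S" "i \<in># A (r, c)" | (Nl) "\<not> M" "\<not> S" "i \<notin># A (r, c)" by blast
  then show ?thesis
  proof cases
    case M
    have "i \<in> ents L' A' (r, c)" using M_arm[OF M] M by (auto simp: upd_M ents_def in_diff_count)
    then have "e_legs i True L' A' (Suc r) c = L" "e_arms i True L' A' (Suc r) c = A"
      using M_arm(1)[OF M] by (auto simp: e_legs_def e_arms_def upd_M[OF M] fun_eq_iff)
    then show ?thesis using f_last_max_M[OF M] by (intro exI[of _ True] exI[of _ "Suc r"] exI[of _ c]) (simp add: upd_M[OF M])
  next
    case S
    obtain u where "u \<in> L (r, c)" "u < Suc i" using ents_L[OF semistd inc] by (auto simp: less_Suc_eq_le)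
    then have "Suc i \<in> L' (r, c) \<and> (\<exists>u\<in>L' (r, c). u < Suc i)" by (auto simp: upd_S[OF S])
    moreover have "\<not> (0 < r \<and> i \<in> ents L' A' (r - 1, Suc c))"
      using semistd_same_row[OF semistd leg_ents[OF S(2)], of "r - 1"] by (auto simp: upd_S[OF S] ents_def)
    ultimately have "e_legs i False L' A' r (Suc c) = L" "e_arms i False L' A' r (Suc c) = A"
      using S(2) S_nosuc[OF S, of r] by (auto simp: e_legs_def e_arms_def upd_S[OF S] fun_eq_iff ents_def)
    then show ?thesis using f_last_max_S[OF S] S_data(6)[OF S]
      by (intro exI[of _ False] exI[of _ r] exI[of _ "Suc c"]) (simp add: upd_S[OF S])
  next
    case Na
    have "\<not> (0 < r \<and> i \<in> ents L' A' (r - 1, c))"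
      using down by (auto simp: upd_Na[OF Na] ents_def)
    moreover have "\<not> (0 < c \<and> Suc i \<in> L' (r, c - 1))" using left by (simp add: upd_Na[OF Na])
    ultimately have "e_legs i True L' A' r c = L" "e_arms i True L' A' r c = A"
      using Na(3) by (auto simp: e_legs_def e_arms_def upd_Na[OF Na] fun_eq_iff)
    then show ?thesis using f_last_max_Na[OF Na]
      by (intro exI[of _ True] exI[of _ r] exI[of _ c]) (simp add: upd_Na[OF Na])
  next
    case Nl
    have "\<not> (0 < r \<and> i \<in> ents L' A' (r - 1, c))"
      using down by (auto simp: upd_Nl[OF Nl] ents_def)
    moreover have "\<not> (0 < c \<and> Suc i \<in> L' (r, c - 1))" using left by (auto simp: upd_Nl[OF Nl])
    ultimately have "e_legs i False L' A' r c = L" "e_arms i False L' A' r c = A"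
      using leg_i[OF Nl(3)] leg_no_suc[OF Nl(3)] by (auto simp: e_legs_def e_arms_def upd_Nl[OF Nl] fun_eq_iff)
    then show ?thesis using f_last_max_Nl[OF Nl]
      by (intro exI[of _ False] exI[of _ r] exI[of _ c]) (simp add: upd_Nl[OF Nl])
  qed
qed

end

section \<open>e_i preserves semistandardness and is undone by f_i\<close>

locale e_site = filling L A for L A +
  fixes i r c arm
  assumes i: "1 \<le> i" and emx: "last_max L A i arm c" and inc: "if arm then Suc i \<in># A (r, c) else Suc i \<in> L (r, c)"
begin

abbreviation "M \<equiv> 0 < r \<and> i \<in> ents L A (r - 1, c)"
abbreviation "S \<equiv> 0 < c \<and> Suc i \<in> L (r, c - 1) \<and> (\<exists>u\<in>L (r, c - 1). u < Suc i)"
definition "L' = e_legs i arm L A r c"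
definition "A' = e_arms i arm L A r c"

lemma sinc: "Suc i \<in> ents L A (r, c)" using inc by (auto simp: ents_def split: if_splits)

lemma s_row: "Suc i \<in> ents L A (r', c) \<Longrightarrow> r' = r" using semistd_same_row[OF semistd sinc] .

lemma i_rows: "i \<in> ents L A (r', c) \<Longrightarrow> r' = r \<or> r = Suc r'" using semistd_suc_row[OF semistd _ sinc] by blast

text \<open>For a leg letter the peak of the column lies below its base, so the letters
  \<open>i\<close> are outnumbered by the leg entries \<open>Suc i\<close>, of which there is at
  most one.\<close>

lemma leg_no_i: assumes "\<not> arm" shows "i \<notin> ents L A (r', c)"
proof
  assume *: "i \<in> ents L A (r', c)"
  have "peak L A i c < col_base L A i c" using emx assms by (simp add: last_max_def)
  then have "leg_count L i c + arm_count A i c < 1" using leg_count_le1[OF semistd, of "Suc i" c] by (simp add: peak_def)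
  then have "leg_count L i c = 0 \<and> arm_count A i c = 0" using leg_count_ge0[of L i c] arm_count_ge0[of A i c] by linarith
  then show False using * leg_count_loc[OF semistd *] arm_count_loc[OF semistd *] by (auto simp: ents_def count_eq_zero_iff)
qed

lemma leg_data: assumes "\<not> arm" shows "leg_count L i c = 0" "arm_count A i c = 0" "leg_count L (Suc i) c = 1" "Suc i \<in> L (r, c)"
  using leg_count_ents_0[OF leg_no_i[OF assms]] arm_count_ents_0[OF leg_no_i[OF assms]] assms inc leg_count_pos[OF semistd] by simp_all

text \<open>A leg letter is impossible because \<open>i\<close> occurs in the column. The cell has
  an extended leg entry that is at most \<open>Suc i\<close> and exceeds the \<open>i\<close> below,
  so it is \<open>Suc i\<close>.\<close>

lemma M_arm: assumes M shows arm "Suc i \<in> L (r, c)"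
proof -
  show arm using leg_no_i assms by blast
  obtain u where u: "u \<in> L (r, c)" "u \<le> Suc i" using ents_L[OF semistd sinc] by auto
  have "i < u" using semistd_col[OF semistd, of "r - 1" r i c u] u assms by (auto dest: leg_ents)
  then show "Suc i \<in> L (r, c)" using u by (metis Suc_leI antisym)
qed

text \<open>Otherwise \<open>Suc i\<close> is the least entry of the cell and the column has no
  \<open>i\<close>. The peak would be the base minus 1, although it is maximal. This is what keeps
  the hook below the lowered arm entry.\<close>

lemma arm_hook: assumes arm "\<not> M" shows "\<exists>u\<in>L (r, c). u \<le> i"
proof (rule ccontr)
  assume H: "\<not> ?thesis"
  obtain u where u: "u \<in> L (r, c)" "u \<le> Suc i" using ents_L[OF semistd sinc] by auto
  then have "u = Suc i" using H by force
  then have p: "leg_count L (Suc i) c = 1" using leg_count_pos[OF semistd] u by simp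
  have no: "i \<notin> ents L A (r', c)" for r'
  proof
    assume *: "i \<in> ents L A (r', c)"
    then consider "r' = r" | "r = Suc r'" using i_rows by blast
    then show False using * H ents_L[OF semistd *] assms(2) by cases auto
  qed
  have "peak L A i c = col_base L A i c - 1" using p leg_count_ents_0[OF no] arm_count_ents_0[OF no] by (simp add: peak_def)
  moreover have "col_base L A i c \<le> peak L A i c"
    using emx assms(1) by (intro col_base_le_bound) (simp_all add: last_max_def)
  ultimately show False by simp
qed

lemma arm_left: assumes arm "\<not> M" "c' < c" "v \<in> ents L A (r, c')" shows "v \<le> i"
proof -
  obtain u where u: "u \<in> L (r, c)" "u \<le> i" using arm_hook assms by blast
  then show ?thesis using semistd_row[OF semistd assms(3,4) leg_ents[OF u(1)]] by simp
qed

lemma arm_nS: "arm \<Longrightarrow> \<not> M \<Longrightarrow> \<not> S" using arm_left[of "c - 1" "Suc i"] by (auto dest: leg_ents)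

lemma down: assumes "\<not> M" "r' < r" "v \<in> ents L A (r', c)" shows "v < i"
proof -
  have "v < Suc i" using semistd_col[OF semistd assms(2,3) sinc] .
  moreover have "v \<noteq> i" using i_rows[of r'] assms by auto
  ultimately show ?thesis by simp
qed

context
  fixes d
  assumes leg: "\<not> arm" and c: "c = Suc d"
begin

text \<open>Column \<open>c\<close> starts at the maximal height, so column \<open>d\<close> peaks
  there and does not descend afterwards.\<close>

lemma leg_peak: "peak L A i d = col_base L A i c" "arm_count A (Suc i) d = 0"
proof -
  have "peak L A i d \<le> col_base L A i c" using emx leg c by (simp add: last_max_def)
  then show "peak L A i d = col_base L A i c" "arm_count A (Suc i) d = 0"
    using c arm_count_ge0[of A "Suc i" d] by (simp_all add: col_base_Suc)
qed

lemma leg_noA: "Suc i \<notin># A (r', d)"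
proof
  assume "Suc i \<in># A (r', d)"
  then show False using leg_peak(2) arm_count_loc[OF semistd arm_ents, of "Suc i" r' d] by (simp add: count_eq_zero_iff)
qed

text \<open>Without an \<open>i\<close> in column \<open>d\<close> its leg entry
  \<open>Suc i\<close> would put the peak below the base, but that peak is the maximal
  height.\<close>

lemma leg_prev: assumes "Suc i \<in> L (r, d)" shows "\<exists>r'. i \<in> ents L A (r', d)"
proof (rule ccontr)
  assume "\<not> ?thesis"
  then have no: "\<And>r'. i \<notin> ents L A (r', d)" by simp
  have "peak L A i d = col_base L A i d - 1"
    using leg_count_pos[OF semistd assms] leg_count_ents_0[OF no] arm_count_ents_0[OF no] by (simp add: peak_def)
  moreover have "col_base L A i d \<le> peak L A i d"
    unfolding leg_peak(1) using emx leg c by (intro col_base_le_bound) (simp_all add: last_max_def)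
  ultimately show False by simp
qed

lemma S_prev: assumes S shows "i \<in> ents L A (r, d)"
proof -
  obtain r' where r': "i \<in> ents L A (r', d)" using leg_prev assms c by auto
  have s: "Suc i \<in> ents L A (r, d)" using assms c by (auto intro: leg_ents)
  obtain u where u: "u \<in> L (r, d)" "u \<le> i" using assms c by auto
  have "r' = r" using semistd_suc_row[OF semistd r' s] semistd_col[OF semistd _ r' leg_ents[OF u(1)], of ] u by auto
  then show ?thesis using r' by simp
qed

end

text \<open>If \<open>Suc i\<close> occurred to the left in row \<open>r\<close>, it would be in the
  extended leg of \<open>(r, d)\<close>, and as the least entry since (S) fails. The
  \<open>i\<close> of column \<open>d\<close> would then lie in the row below and force an
  \<open>i\<close> into column \<open>c\<close>, against \<open>leg_no_i\<close>.\<close>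

lemma leg_nS_left: assumes "\<not> arm" "\<not> S" "c' < c" "v \<in> ents L A (r, c')" shows "v \<le> i"
proof -
  obtain d where d: "c = Suc d" "c' \<le> d" using assms(3) by (cases c) auto
  note leg = assms(1) d(1)
  have v: "v \<le> Suc i" using semistd_row[OF semistd assms(3,4) sinc] .
  have "v \<noteq> Suc i"
  proof
    assume "v = Suc i"
    have "L (r, d) \<noteq> {}" using semistd_shape[OF semistd ents_nonempty[OF semistd sinc], of r d] d by simp
    then obtain w where w: "w \<in> L (r, d)" by auto
    have s: "Suc i \<in> ents L A (r, d)"
    proof (cases "c' = d")
      case True then show ?thesis using assms \<open>v = Suc i\<close> by simp
    next
      case False
      then have "v \<le> w" using semistd_row[OF semistd _ assms(4) leg_ents[OF w]] d by simp
      moreover have "w \<le> Suc i" using semistd_row[OF semistd _ leg_ents[OF w] sinc] d by simp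
      ultimately show ?thesis using w \<open>v = Suc i\<close> by (auto intro: leg_ents)
    qed
    then have sL: "Suc i \<in> L (r, d)" using leg_noA[OF leg] by (auto simp: ents_def)
    then have ge: "Suc i \<le> u" if "u \<in> L (r, d)" for u using assms(2) d that by force
    obtain r' where r': "i \<in> ents L A (r', d)" using leg_prev[OF leg sL] by blast
    have "r' \<noteq> r" using ents_L[OF semistd r'] ge by force
    then have r: "r = Suc r'" using semistd_suc_row[OF semistd r' s] by simp
    have "L (r', c) \<noteq> {}" using semistd_shape[OF semistd ents_nonempty[OF semistd sinc], of r' c] r by simp
    then obtain w where w: "w \<in> L (r', c)" by auto
    have "i \<le> w" using semistd_row[OF semistd _ r' leg_ents[OF w]] d by simp
    moreover have "w < Suc i" using semistd_col[OF semistd _ leg_ents[OF w] sinc] r by simp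
    ultimately show False using leg_no_i[OF assms(1), of r'] w by (auto simp: le_antisym less_Suc_eq_le dest: leg_ents)
  qed
  then show ?thesis using v by simp
qed

lemma upd_M: "M \<Longrightarrow> L' = L" "M \<Longrightarrow> A' = A((r, c) := A (r, c) - {#Suc i#}, (r - 1, c) := add_mset i (A (r - 1, c)))"
  by (simp_all add: L'_def A'_def e_legs_def e_arms_def)
lemma upd_S: "\<not> M \<Longrightarrow> S \<Longrightarrow> L' = L((r, c - 1) := L (r, c - 1) - {Suc i}, (r, c) := insert i (L (r, c)))"
  "\<not> M \<Longrightarrow> S \<Longrightarrow> A' = A"
  unfolding L'_def A'_def e_legs_def e_arms_def by presburger+
lemma upd_Na: "\<not> M \<Longrightarrow> arm \<Longrightarrow> L' = L" "\<not> M \<Longrightarrow> arm \<Longrightarrow> A' = A((r, c) := add_mset i (A (r, c) - {#Suc i#}))"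
  using arm_nS unfolding L'_def A'_def e_legs_def e_arms_def by presburger+
lemma upd_Nl: "\<not> M \<Longrightarrow> \<not> S \<Longrightarrow> \<not> arm \<Longrightarrow> L' = L((r, c) := insert i (L (r, c) - {Suc i}))"
  "\<not> M \<Longrightarrow> \<not> S \<Longrightarrow> \<not> arm \<Longrightarrow> A' = A"
  unfolding L'_def A'_def e_legs_def e_arms_def by presburger+

lemma e_cases:
  obtains (M) M | (S) d where "\<not> M" S "\<not> arm" "c = Suc d" | (Na) "\<not> M" arm | (Nl) "\<not> M" "\<not> S" "\<not> arm"
  using arm_nS by (cases c) blast+

lemma nM: "\<not> arm \<Longrightarrow> \<not> M" using M_arm by blast

lemma L'_nonempty: "L' x \<noteq> {} \<longleftrightarrow> L x \<noteq> {}"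
proof (cases rule: e_cases)
  case (S d)
  then show ?thesis using upd_S(1) ents_nonempty[OF semistd sinc] by auto
next
  case Nl
  then show ?thesis using upd_Nl(1) leg_data by auto
next
  case M show ?thesis unfolding upd_M[OF M] ..
next
  case Na show ?thesis unfolding upd_Na[OF Na] ..
qed

lemma semistd_e: "semistd L' A'"
proof -
  have shape: "\<And>r c r' c'. L' (r, c) \<noteq> {} \<Longrightarrow> r' \<le> r \<Longrightarrow> c' \<le> c \<Longrightarrow> L' (r', c') \<noteq> {}"
    unfolding L'_nonempty using semistd_shape[OF semistd] by blast
  have fin: "finite (L' x)" for x using semistd_finite[OF semistd] by (auto simp: L'_def e_legs_def)
  have eA': "v \<in># A' x \<Longrightarrow> v \<in> ents L' A' x" for v x by (auto simp: ents_def)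
  show ?thesis
  proof (cases M)
    case True
    have 1: "ents L' A' x \<subseteq> ents L A x" for x
      using True by (auto simp: upd_M ents_def dest: in_diffD split: if_splits)
    show ?thesis
    proof (rule semistd_modify[where L = L and A = A and L' = L' and A' = A' and W = "{}", OF semistd fin shape])
      show "\<exists>u\<in>L' x. u \<le> v" if "v \<in># A' x" for v x
        using ents_L[OF semistd subsetD[OF 1 eA']] that True by (simp add: upd_M)
    qed (use 1 in auto)
  next
    case nM: False
    show ?thesis
    \<comment> \<open>Only \<open>(r, c)\<close> gains a value, namely \<open>i\<close>, which is
      positive by assumption.\<close>
    proof (rule semistd_modify[where L = L and A = A and L' = L' and A' = A' and W = "{i}" and r = r and c = c, OF semistd fin shape])
      show "\<exists>u\<in>L' x. u \<le> v" if v: "v \<in># A' x" for v x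
      proof (cases rule: e_cases)
        case M then show ?thesis using nM by blast
      next
        case (S d)
        obtain u where u: "u \<in> L x" "u \<le> v" using semistd_arm[OF semistd, of v x] v upd_S(2)[OF S(1,2)] by auto
        obtain w where w: "w \<in> L (r, d)" "w \<le> i" using S by auto
        show ?thesis
        proof (cases "x = (r, d) \<and> u = Suc i")
          case True
          then show ?thesis using u w S(4) by (intro bexI[of _ w]) (unfold upd_S(1)[OF S(1,2)], auto)
        next
          case False
          then show ?thesis using u S(4) by (intro bexI[of _ u]) (unfold upd_S(1)[OF S(1,2)], auto)
        qed
      next
        case Na
        obtain w where "w \<in> L (r, c)" "w \<le> i" using arm_hook Na by blast
        then show ?thesis using semistd_arm[OF semistd, of v x] v
          by (auto simp: upd_Na[OF Na] dest: in_diffD split: if_splits)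
      next
        case Nl
        obtain u where u: "u \<in> L x" "u \<le> v" using semistd_arm[OF semistd, of v x] v by (auto simp: upd_Nl[OF Nl])
        then show ?thesis by (cases "u = Suc i") (auto simp: upd_Nl[OF Nl] intro: Suc_leD)
      qed
      have s0: "ents L' A' x \<subseteq> ents L A x \<union> (if x = (r, c) then {i} else {})" for x
      proof (cases rule: e_cases)
        case M then show ?thesis using nM by blast
      next
        case (S d) show ?thesis unfolding upd_S[OF S(1,2)] by (auto simp: ents_def)
      next
        case Na show ?thesis unfolding upd_Na[OF Na] by (auto simp: ents_def dest: in_diffD)
      next
        case Nl show ?thesis unfolding upd_Nl[OF Nl] by (auto simp: ents_def)
      qed
      show sub: "ents L' A' x \<subseteq> ents L A x" if "x \<noteq> (r, c)" for x using s0[of x] that by simp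
      show "ents L' A' (r, c) \<subseteq> ents L A (r, c) \<union> {i}" using s0[of "(r, c)"] by simp
      show "w \<le> v" if "c < c'" "v \<in> ents L' A' (r, c')" "w \<in> {i}" for c' v w
      proof -
        have "Suc i \<le> v" using semistd_row[OF semistd that(1) sinc] sub[of "(r, c')"] that by auto
        then show ?thesis using that by simp
      qed
      show "v \<le> w" if "c' < c" "v \<in> ents L' A' (r, c')" "w \<in> {i}" for c' v w
      proof -
        have v: "v \<in> ents L A (r, c')" using sub[of "(r, c')"] that by auto
        have "v \<le> i"
        proof (cases rule: e_cases)
          case M then show ?thesis using nM by blast
        next
          case (S d)
          obtain u where u: "u \<in> L (r, d)" "u \<le> i" using S by auto
          show ?thesis
          proof (cases "c' = d")
            case True
            have "v \<le> Suc i" using semistd_row[OF semistd that(1) v sinc] .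
            moreover have "v \<noteq> Suc i"
              using that(2) leg_noA[OF S(3,4), of r] S(4) True unfolding upd_S[OF S(1,2)] by (auto simp: ents_def)
            ultimately show ?thesis by simp
          next
            case False
            then show ?thesis using semistd_row[OF semistd _ v leg_ents[OF u(1)]] u that S by simp
          qed
        next
          case Na then show ?thesis using arm_left that(1) v by blast
        next
          case Nl then show ?thesis using leg_nS_left that(1) v by blast
        qed
        then show ?thesis using that by simp
      qed
      show "w < v" if "r < r'" "v \<in> ents L' A' (r', c)" "w \<in> {i}" for r' v w
      proof -
        have "Suc i < v" using semistd_col[OF semistd that(1) sinc] sub[of "(r', c)"] that by auto
        then show ?thesis using that by simp
      qed
      show "v < w" if "r' < r" "v \<in> ents L' A' (r', c)" "w \<in> {i}" for r' v w
        using down[OF nM that(1)] sub[of "(r', c)"] that by auto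
    qed (use i in simp_all)
  qed
qed

text \<open>(M) and (N) on an arm entry differ only in the row that receives \<open>i\<close>; the
  counts of column \<open>c\<close> change in the same way.\<close>

lemma e_first_max_arm: assumes arm shows "first_max L' A' i c"
proof -
  have s: "arm_count A (Suc i) c = int (count (A (r, c)) (Suc i))" using arm_count_loc[OF semistd sinc] .
  have inA: "Suc i \<in># A (r, c)" using inc assms by simp
  have o: "Suc i \<notin># A (r', c)" if "r' \<noteq> r" for r' using s_row[OF arm_ents, of r'] that by blast
  have os: "Suc i \<notin># A' (r', c)" if "r' \<noteq> r" for r'
  proof (cases M)
    case True
    show ?thesis using o[OF that] that unfolding upd_M[OF True] by auto
  next
    case False
    show ?thesis using o[OF that] that unfolding upd_Na[OF False assms] by auto
  qed
  have nn: "arm_count A' (Suc i) c = int (count (A' (r, c)) (Suc i))"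
    using arm_count_only[where r = r and c = c and v = "Suc i" and A = A', OF os] .
  have n: "arm_count A' (Suc i) c = arm_count A (Suc i) c - 1"
  proof (cases M)
    case True
    then have "r - 1 \<noteq> r" by auto
    then show ?thesis using inA s nn unfolding upd_M(2)[OF True] by (simp add: of_nat_diff Suc_le_eq)
  next
    case False
    show ?thesis using inA s nn unfolding upd_Na(2)[OF False assms] by (simp add: of_nat_diff Suc_le_eq)
  qed
  have oth: "arm_count A' v y = arm_count A v y" if "y \<noteq> c" for v y
  proof (cases M)
    case True
    show ?thesis using that unfolding upd_M[OF True] by (intro arm_count_cong) simp
  next
    case False
    show ?thesis using that unfolding upd_Na[OF False assms] by (intro arm_count_cong) simp
  qed
  have m: "arm_count A' i c = arm_count A i c + 1"
  proof (cases M)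
    case True
    have "i \<in> ents L' A' (r - 1, c)" unfolding upd_M[OF True] by (auto simp: ents_def)
    then have "arm_count A' i c = int (count (A' (r - 1, c)) i)" using arm_count_loc[OF semistd_e] by blast
    then show ?thesis using arm_count_loc[OF semistd, of i "r - 1" c] True unfolding upd_M(2)[OF True] by simp
  next
    case False
    have "i \<notin># A (r', c)" if "r' \<noteq> r" for r' using i_rows[OF arm_ents, of r'] that False by (auto simp: arm_ents)
    then have "arm_count A i c = int (count (A (r, c)) i)" by (rule arm_count_only)
    moreover have "i \<in> ents L' A' (r, c)" unfolding upd_Na[OF False assms] by (auto simp: ents_def)
    then have "arm_count A' i c = int (count (A' (r, c)) i)" using arm_count_loc[OF semistd_e] by blast
    ultimately show ?thesis unfolding upd_Na(2)[OF False assms] by simp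
  qed
  have "L' = L" using assms upd_M(1) upd_Na(1) by blast
  then show ?thesis using first_max_arm_step[where L = L and A = A and A' = A', OF _ m n oth] emx assms by simp
qed

lemma e_first_max_Nl: assumes "\<not> S" "\<not> arm" shows "first_max L' A' i c"
proof -
  note u = upd_Nl[OF nM[OF assms(2)] assms] and d = leg_data[OF assms(2)]
  have i': "i \<in> ents L' A' (r, c)" by (auto simp: u ents_def)
  have arm_count: "arm_count A' = arm_count A" by (simp add: u)
  have d': "leg_count L' i c = 1" using leg_count_loc[OF semistd_e i'] by (simp add: u)
  have "Suc i \<notin> L' (r', c)" for r' using s_row[OF leg_ents, of r'] by (auto simp: u)
  then have e': "leg_count L' (Suc i) c = 0" by (rule leg_count_0)
  have o: "leg_count L' v y = leg_count L v y" if "y \<noteq> c" for v y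
    using that by (intro leg_count_cong) (simp add: u)
  have b: "col_base L' A' i x = col_base L A i x + (if c < x then 2 else 0)" for x
    by (rule col_base_shift1) (use o d d' e' in \<open>simp_all add: col_net_def arm_count\<close>)
  have p: "peak L' A' i x = peak L A i x + (if c \<le> x then 2 else 0)" for x
    using o d d' e' b[of x] by (cases "x = c") (simp_all add: peak_def arm_count)
  have pc: "peak L A i c = col_base L A i c - 1" using d by (simp add: peak_def)
  have "0 \<le> col_base L A i c" "\<And>x. x < c \<Longrightarrow> peak L A i x \<le> col_base L A i c" "\<And>x. c \<le> x \<Longrightarrow> peak L A i x < col_base L A i c"
    using emx assms(2) by (simp_all add: last_max_def)
  then show ?thesis using pc by (auto simp: first_max_def p) (smt (verit) not_le)+
qed

text \<open>The new \<open>i\<close> stands in column \<open>c\<close>, but f_i acts in column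
  \<open>d\<close>: losing \<open>Suc i\<close> raises its peak by 1 to the new maximum, and column
  \<open>c\<close> reaches the same height only later.\<close>

lemma e_first_max_S: assumes S "\<not> arm" "c = Suc d" shows "first_max L' A' i d"
proof -
  note u = upd_S[OF nM[OF assms(2)] assms(1)] and dd = leg_data[OF assms(2)] leg_peak[OF assms(2,3)]
  have i': "i \<in> ents L' A' (r, c)" by (auto simp: u ents_def)
  have arm_count: "arm_count A' = arm_count A" by (simp add: u)
  have d': "leg_count L' i c = 1" using leg_count_loc[OF semistd_e i'] by (simp add: u)
  have sd: "Suc i \<in> L (r, d)" using assms by simp
  have "Suc i \<notin> L' (r', d)" for r' using semistd_same_row[OF semistd leg_ents[OF sd] leg_ents, of r'] assms(3) unfolding u by auto
  then have e': "leg_count L' (Suc i) d = 0" by (rule leg_count_0)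
  have e: "leg_count L (Suc i) d = 1" using leg_count_pos[OF semistd sd] .
  have o: "leg_count L' v y = leg_count L v y" if "y \<noteq> c \<or> v \<noteq> i" "y \<noteq> d \<or> v \<noteq> Suc i" for v y
    using that assms(3) unfolding u by (intro leg_count_cong) auto
  have o1: "leg_count L' i d = leg_count L i d" "leg_count L' (Suc i) c = leg_count L (Suc i) c" using o[of d i] o[of c "Suc i"] assms(3) by auto
  have o2: "leg_count L' v y = leg_count L v y" if "y \<noteq> c" "y \<noteq> d" for v y using o that by blast
  have cd: "d \<noteq> c" "d < c" "\<And>x. d < x \<longleftrightarrow> c \<le> x" using assms(3) by auto
  have b: "col_base L' A' i x = col_base L A i x + (if d < x then 1 else 0) + (if c < x then 1 else 0)" for x
    by (rule col_base_shift) (use o1 o2 dd d' e e' cd(1) in \<open>simp_all add: col_net_def arm_count\<close>)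
  have p: "peak L' A' i x = peak L A i x + (if x = d then 1 else if c \<le> x then 2 else 0)" for x
    using o1 o2 dd d' e e' cd b[of x] by (cases "x = c"; cases "x = d") (auto simp add: peak_def arm_count)
  have pc: "peak L A i c = col_base L A i c - 1" using dd by (simp add: peak_def)
  have h: "0 \<le> col_base L A i c" "\<And>x. x < c \<Longrightarrow> peak L A i x \<le> col_base L A i c" "\<And>x. c \<le> x \<Longrightarrow> peak L A i x < col_base L A i c"
    using emx assms(2) by (simp_all add: last_max_def)
  have pd: "peak L' A' i d = col_base L A i c + 1" using p[of d] dd(5) by simp
  have "peak L' A' i x \<le> col_base L A i c + 1 \<and> (x < d \<longrightarrow> peak L' A' i x < col_base L A i c + 1)" for x
  proof -
    consider "x < d" | "x = d" | "c \<le> x" using cd(3) by (meson linorder_neqE_nat)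
    then show ?thesis
    proof cases
      case 1
      then show ?thesis using p[of x] h(2)[of x] cd(2) by simp
    next
      case 2
      then show ?thesis using pd by simp
    next
      case 3
      then show ?thesis using p[of x] h(3)[of x] cd(2) by simp
    qed
  qed
  then show ?thesis using pd h(1) by (simp add: first_max_def)
qed

text \<open>f_i acts at the lower cell after (M), at the left cell after (S) and at the same cell
  after (N).\<close>

lemma e_inverse:
  "\<exists>r' c'. first_max L' A' i c' \<and> i \<in> ents L' A' (r', c') \<and> f_legs i L' A' r' c' = L \<and> f_arms i L' A' r' c' = A"
proof (cases rule: e_cases)
  case M
  then obtain q where q: "r = Suc q" by (cases r) auto
  note m = M_arm[OF M]
  have u: "L' = L" "A' = A((Suc q, c) := A (Suc q, c) - {#Suc i#}, (q, c) := add_mset i (A (q, c)))"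
    using upd_M[OF M] q by auto
  have inA: "Suc i \<in># A (Suc q, c)" using inc m(1) q by simp
  have c1: "Suc i \<in> ents L' A' (Suc q, c)" unfolding u using m(2) q by (simp add: ents_def)
  have "f_legs i L' A' q c = L" using c1 by (simp add: f_legs_def u(1))
  moreover have "f_arms i L' A' q c = A'((q, c) := A' (q, c) - {#i#}, (Suc q, c) := add_mset (Suc i) (A' (Suc q, c)))"
    using c1 by (simp add: f_arms_def)
  then have "f_arms i L' A' q c = A" unfolding u(2) using inA by (intro ext) simp
  moreover have "i \<in> ents L' A' (q, c)" unfolding u by (simp add: ents_def)
  ultimately show ?thesis using e_first_max_arm[OF m(1)] by blast
next
  case (S d)
  have u: "L' = L((r, d) := L (r, d) - {Suc i}, (r, Suc d) := insert i (L (r, Suc d)))" "A' = A"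
    using upd_S[OF S(1,2)] S(4) by auto
  have c1: "Suc i \<notin> ents L' A' (Suc r, d)"
    unfolding u using semistd_same_row[OF semistd leg_ents, of "Suc i" r d "Suc r"] S(2,4) by (auto simp: ents_def)
  have c2: "i \<in> L' (r, Suc d)" unfolding u by simp
  have ni: "i \<notin> L (r, Suc d)" using leg_no_i[OF S(3), of r] S(4) by (auto simp: ents_def)
  have "f_legs i L' A' r d = L'((r, Suc d) := L' (r, Suc d) - {i}, (r, d) := insert (Suc i) (L' (r, d)))"
    using c1 c2 by (simp add: f_legs_def)
  then have "f_legs i L' A' r d = L" unfolding u(1) using ni S(2,4) by (intro ext) auto
  moreover have "f_arms i L' A' r d = A" using c1 c2 by (simp add: f_arms_def u(2))
  moreover have "i \<in> ents L' A' (r, d)" unfolding u using S_prev[OF S(3,4,2)] by (auto simp: ents_def)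
  ultimately show ?thesis using e_first_max_S[OF S(2-4)] by blast
next
  case Na
  note u = upd_Na[OF Na]
  have inA: "Suc i \<in># A (r, c)" using inc Na(2) by simp
  have c1: "Suc i \<notin> ents L' A' (Suc r, c)" unfolding u using s_row[of "Suc r"] by (auto simp: ents_def)
  have c2: "i \<notin> L' (r, Suc c)" unfolding u using semistd_row[OF semistd lessI sinc leg_ents, of i] by auto
  have c3: "i \<in># A' (r, c)" unfolding u by simp
  have "f_legs i L' A' r c = L" using c1 c2 c3 by (simp add: f_legs_def u(1))
  moreover have "f_arms i L' A' r c = A'((r, c) := add_mset (Suc i) (A' (r, c) - {#i#}))"
    using c1 c2 c3 by (simp add: f_arms_def)
  then have "f_arms i L' A' r c = A" unfolding u(2) using inA by (intro ext) simp
  moreover have "i \<in> ents L' A' (r, c)" using c3 by (simp add: ents_def)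
  ultimately show ?thesis using e_first_max_arm[OF Na(2)] by blast
next
  case Nl
  note u = upd_Nl[OF Nl]
  have c1: "Suc i \<notin> ents L' A' (Suc r, c)" unfolding u using s_row[of "Suc r"] by (auto simp: ents_def)
  have c2: "i \<notin> L' (r, Suc c)" unfolding u using semistd_row[OF semistd lessI sinc leg_ents, of i] by auto
  have n: "i \<notin># A (r, c)" "i \<notin> L (r, c)" using leg_no_i[OF Nl(3), of r] by (auto simp: ents_def)
  then have c3: "i \<notin># A' (r, c)" unfolding u by simp
  have "f_legs i L' A' r c = L'((r, c) := insert (Suc i) (L' (r, c) - {i}))"
    using c1 c2 c3 by (simp add: f_legs_def)
  then have "f_legs i L' A' r c = L" unfolding u(1) using n(2) leg_data(4)[OF Nl(3)] by (intro ext) auto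
  moreover have "f_arms i L' A' r c = A" using c1 c2 c3 by (simp add: f_arms_def u(2))
  moreover have "i \<in> ents L' A' (r, c)" unfolding u by (simp add: ents_def)
  ultimately show ?thesis using e_first_max_Nl[OF Nl(2,3)] by blast
qed

end

section \<open>Bumping\<close>

definition next_greater :: "nat \<Rightarrow> nat multiset \<Rightarrow> nat" where
  "next_greater l X = (LEAST v. v \<in># X \<and> l < v)"

text \<open>This holds vacuously if the target lies outside the shape, so that creating a cell and
  replacing a hook entry become one case.\<close>

definition hook_above :: "legs \<Rightarrow> nat \<Rightarrow> nat \<Rightarrow> nat \<Rightarrow> bool" where
  "hook_above L r l ct \<longleftrightarrow> (\<forall>v\<in>L (Suc r, ct). l < v)"

text \<open>If the hook of the target exceeds \<open>l\<close>, then \<open>l\<close> becomes the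
  hook and the old hook joins the leg; on sets this is just the insertion of \<open>l\<close>.
  Otherwise \<open>l\<close> replaces an arm entry and this entry joins the leg.\<close>

definition bump_legs :: "legs \<Rightarrow> arms \<Rightarrow> nat \<Rightarrow> nat \<Rightarrow> nat \<Rightarrow> nat \<Rightarrow> legs" where
  "bump_legs L A r c l ct = L((r, c) := L (r, c) - {l},
     (Suc r, ct) := insert (if hook_above L r l ct then l else next_greater l (A (Suc r, ct))) (L (Suc r, ct)))"

definition bump_arms :: "legs \<Rightarrow> arms \<Rightarrow> nat \<Rightarrow> nat \<Rightarrow> nat \<Rightarrow> nat \<Rightarrow> arms" where
  "bump_arms L A r c l ct =
    (if hook_above L r l ct then
       (if ct = c then A((r, c) := filter_mset (\<lambda>z. z < l) (A (r, c)),
                         (Suc r, c) := A (Suc r, c) + filter_mset (\<lambda>z. l \<le> z) (A (r, c)))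
        else A)
     else A((Suc r, ct) := add_mset l (A (Suc r, ct) - {#next_greater l (A (Suc r, ct))#})))"

lemma nxtI: assumes "v \<in># X" "l < v" shows "next_greater l X \<in># X" "l < next_greater l X" "next_greater l X \<le> v"
  using LeastI[of "\<lambda>v. v \<in># X \<and> l < v" v] Least_le[of "\<lambda>v. v \<in># X \<and> l < v" v] assms
  by (auto simp: next_greater_def)

lemma next_greater_eqI: assumes "v \<in># X" "l < v" "\<And>w. w \<in># X \<Longrightarrow> l < w \<Longrightarrow> v \<le> w" shows "next_greater l X = v"
  unfolding next_greater_def using assms by (intro Least_equality) auto

text \<open>The parameters of a bump through their extremal properties: no proper leg above row
  \<open>r\<close>, the largest proper leg entry \<open>l\<close> of this row, its rightmost cell,
  and the first cell of the next row that is empty or has an entry above \<open>l\<close>. A proper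
  leg shows as two distinct extended leg entries.\<close>

locale bump = filling L A for L A +
  fixes r c l ct
  assumes top: "\<And>r' c' u v. r < r' \<Longrightarrow> u \<in> L (r', c') \<Longrightarrow> v \<in> L (r', c') \<Longrightarrow> u = v"
    and lin: "l \<in> L (r, c)" and leg: "\<exists>u\<in>L (r, c). u < l"
    and lmax: "\<And>c' u v. u \<in> L (r, c') \<Longrightarrow> v \<in> L (r, c') \<Longrightarrow> u < v \<Longrightarrow> v < l \<or> v = l \<and> c' \<le> c"
    and before: "\<And>c'. c' < ct \<Longrightarrow> L (Suc r, c') \<noteq> {}"
      "\<And>c' v. c' < ct \<Longrightarrow> v \<in> ents L A (Suc r, c') \<Longrightarrow> v \<le> l"
    and at_ct: "L (Suc r, ct) = {} \<or> (\<exists>v\<in>ents L A (Suc r, ct). l < v)"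
begin

abbreviation "hk \<equiv> hook_above L r l ct"
definition "SL = bump_legs L A r c l ct"
definition "SA = bump_arms L A r c l ct"
definition "k = next_greater l (A (Suc r, ct))"
definition "ins = (if hk then l else k)"

lemma linE: "l \<in> ents L A (r, c)" using lin by (rule leg_ents)

text \<open>Strictness comes from a smaller entry \<open>u\<close> in the cell of \<open>l\<close>
  itself, which these cells precede weakly.\<close>

lemma left: assumes "r' \<le> r" "c' \<le> c" "(r', c') \<noteq> (r, c)" "v \<in> ents L A (r', c')" shows "v < l"
proof -
  obtain u where u: "u \<in> L (r, c)" "u < l" using leg by auto
  have "v \<le> u" using semistd_le[OF semistd assms leg_ents[OF u(1)]] .
  then show ?thesis using u by simp
qed

lemma right: "c < c' \<Longrightarrow> v \<in> ents L A (r, c') \<Longrightarrow> l \<le> v" using semistd_row[OF semistd _ linE] .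

lemma above: "r < r' \<Longrightarrow> c \<le> c' \<Longrightarrow> v \<in> ents L A (r', c') \<Longrightarrow> l < v" using semistd_less[OF semistd _ _ linE] .

lemma Lle: assumes "v \<in> L (r, c)" shows "v \<le> l"
proof -
  obtain u where u: "u \<in> L (r, c)" "u < l" using leg by auto
  show ?thesis using lmax[OF u(1) assms] u by (cases "u < v") auto
qed

text \<open>A target right of \<open>c\<close> would make the cell above \<open>(r, c)\<close> exist
  with entries at most \<open>l\<close>, against the strict increase of column
  \<open>c\<close>.\<close>

lemma ct_le: "ct \<le> c"
proof (rule ccontr)
  assume "\<not> ?thesis"
  then have c: "c < ct" by simp
  obtain v where v: "v \<in> L (Suc r, c)" using before(1)[OF c] by auto
  show False using before(2)[OF c leg_ents[OF v]] above[OF lessI le_refl leg_ents[OF v]] by simp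
qed

lemma at_ct': assumes "L (Suc r, ct) \<noteq> {}" shows "\<exists>v\<in>ents L A (Suc r, ct). l < v"
  using at_ct assms by blast

text \<open>As soon as such a cell exists, the target is nonempty and contains by choice an entry
  above \<open>l\<close>; this entry is at most \<open>v\<close>.\<close>

lemma after: assumes "Suc r \<le> r'" "ct \<le> c'" "(r', c') \<noteq> (Suc r, ct)" "v \<in> ents L A (r', c')"
  shows "\<exists>w\<in>ents L A (Suc r, ct). l < w \<and> w \<le> v" "l < v"
proof -
  have "L (Suc r, ct) \<noteq> {}" using semistd_shape[OF semistd ents_nonempty[OF semistd assms(4)] assms(1,2)] .
  then obtain w where w: "w \<in> ents L A (Suc r, ct)" "l < w" using at_ct' by auto
  have "w \<le> v" using semistd_le[OF semistd assms(1,2) _ w(1) assms(4)] assms(3) by auto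
  then show "\<exists>w\<in>ents L A (Suc r, ct). l < w \<and> w \<le> v" "l < v" using w by auto
qed

lemma hk_above: assumes hk "v \<in> ents L A (Suc r, ct)" shows "l < v"
  using ents_L[OF semistd assms(2)] assms(1) by (auto simp: hook_above_def)

lemma ct_c_hk: "ct = c \<Longrightarrow> hk" using above[OF lessI le_refl leg_ents] by (auto simp: hook_above_def)

text \<open>The only extended leg entry of the target is at most \<open>l\<close>, so the entry
  above \<open>l\<close> that the choice of \<open>ct\<close> provides lies in the arm. Above
  \<open>(r, c)\<close> all entries exceed \<open>l\<close>, which excludes
  \<open>ct = c\<close>.\<close>

lemma nhk: assumes "\<not> hk"
  shows "ct < c" "k \<in># A (Suc r, ct)" "l < k" "\<And>v. v \<in># A (Suc r, ct) \<Longrightarrow> l < v \<Longrightarrow> k \<le> v"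
    "\<exists>h. L (Suc r, ct) = {h} \<and> h \<le> l" "k \<notin> L (Suc r, ct)"
proof -
  show "ct < c" using ct_c_hk ct_le assms by (cases "ct = c") auto
  obtain h where h: "h \<in> L (Suc r, ct)" "h \<le> l" using assms by (auto simp: hook_above_def not_less)
  then have L: "L (Suc r, ct) = {h}" using top[OF lessI] by blast
  then show "\<exists>h. L (Suc r, ct) = {h} \<and> h \<le> l" using h by blast
  obtain v where v: "v \<in> ents L A (Suc r, ct)" "l < v" using at_ct' h by blast
  then have v': "v \<in># A (Suc r, ct)" using L h by (auto simp: ents_def)
  show "k \<in># A (Suc r, ct)" "l < k" "\<And>v. v \<in># A (Suc r, ct) \<Longrightarrow> l < v \<Longrightarrow> k \<le> v"
    using nxtI[OF v' v(2)] nxtI(3) by (auto simp: k_def)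
  then show "k \<notin> L (Suc r, ct)" using L h by auto
qed

lemma SL_eq: "SL = L((r, c) := L (r, c) - {l}, (Suc r, ct) := insert ins (L (Suc r, ct)))"
  by (simp add: SL_def bump_legs_def ins_def k_def)

lemma SA_hk_c: "ct = c \<Longrightarrow> SA = A((r, c) := filter_mset (\<lambda>z. z < l) (A (r, c)),
    (Suc r, c) := A (Suc r, c) + filter_mset (\<lambda>z. l \<le> z) (A (r, c)))"
  unfolding SA_def bump_arms_def using ct_c_hk by simp
lemma SA_hk: "hk \<Longrightarrow> ct \<noteq> c \<Longrightarrow> SA = A" by (simp add: SA_def bump_arms_def)
lemma SA_nhk: "\<not> hk \<Longrightarrow> SA = A((Suc r, ct) := add_mset l (A (Suc r, ct) - {#k#}))"
  by (simp add: SA_def bump_arms_def k_def)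

lemma ins_hk: "hk \<Longrightarrow> ins = l" and ins_nhk: "\<not> hk \<Longrightarrow> ins = k"
  by (simp_all add: ins_def)

lemma bump_cases:
  obtains (c) "ct = c" hk | (h) "ct < c" hk | (a) "ct < c" "\<not> hk"
  using ct_le ct_c_hk by (cases "ct = c"; cases hk) auto

lemma SL_nonempty: "SL x \<noteq> {} \<longleftrightarrow> L x \<noteq> {} \<or> x = (Suc r, ct)"
  using leg by (auto simp: SL_eq)

lemma semistd_b: "semistd SL SA"
proof -
  \<comment> \<open>The values that the target gains: \<open>l\<close> and, in a vertical bump, the
    arm entries carried along. The entry \<open>k\<close> only moves within the target cell.\<close>
  define W where "W = insert l (if ct = c then {z. z \<in># A (r, c) \<and> l \<le> z} else {})"
  have lW: "l \<le> w" if "w \<in> W" for w using that by (auto simp: W_def split: if_splits)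
  have s: "ents SL SA x \<subseteq> ents L A x \<union> (if x = (Suc r, ct) then W else {})" for x
  proof (cases rule: bump_cases)
    case c
    then show ?thesis unfolding SL_eq SA_hk_c[OF c(1)] ins_hk[OF c(2)] by (auto simp: ents_def W_def)
  next
    case h
    then show ?thesis unfolding SL_eq SA_hk[OF h(2) less_imp_neq[OF h(1)]] by (auto simp: ents_def ins_def W_def)
  next
    case a
    then show ?thesis using nhk(2)[OF a(2)] unfolding SL_eq SA_nhk[OF a(2)]
      by (auto simp: ents_def ins_def W_def dest: in_diffD)
  qed
  show ?thesis
  proof (rule semistd_modify[where L = L and A = A and L' = SL and A' = SA and W = W and r = "Suc r" and c = ct, OF semistd])
    show "finite (SL x)" for x using semistd_finite[OF semistd] by (auto simp: SL_eq)
    show "SL (a', b') \<noteq> {}" if H: "SL (a, b) \<noteq> {}" "a' \<le> a" "b' \<le> b" for a b a' b'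
    proof (cases "L (a, b) \<noteq> {}")
      case True
      then show ?thesis using semistd_shape[OF semistd True H(2,3)] by (simp add: SL_nonempty)
    next
      case False
      then have ab: "a = Suc r" "b = ct" using H(1) by (auto simp: SL_nonempty)
      show ?thesis
      proof (cases "a' = Suc r")
        case True
        then show ?thesis using before(1)[of b'] H(3) ab by (cases "b' = ct") (simp_all add: SL_nonempty)
      next
        case False
        have "L (r, c) \<noteq> {}" using lin by auto
        then show ?thesis using semistd_shape[OF semistd, of r c a' b'] H ab False ct_le by (simp add: SL_nonempty)
      qed
    qed
    show "\<exists>u\<in>SL x. u \<le> v" if v: "v \<in># SA x" for x v
    proof -
      have 1: ?thesis if a: "v \<in># A x"
      proof -
        obtain u where u: "u \<in> L x" "u \<le> v" using semistd_arm[OF semistd a] by auto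
        obtain w where "w \<in> L (r, c)" "w < l" using leg by auto
        then show ?thesis using u by (cases "x = (r, c) \<and> u = l") (auto simp: SL_eq intro: bexI[of _ w] bexI[of _ u])
      qed
      show ?thesis
      proof (cases "v \<in># A x")
        case vA: False
        show ?thesis
        proof (cases rule: bump_cases)
          case c
          have "x = (Suc r, ct) \<and> l \<le> v"
            using v vA c(1) unfolding SA_hk_c[OF c(1)] by (auto split: if_splits)
          then show ?thesis unfolding SL_eq ins_hk[OF c(2)] by auto
        next
          case h
          then show ?thesis using v vA unfolding SA_hk[OF h(2) less_imp_neq[OF h(1)]] by simp
        next
          case a
          have "x = (Suc r, ct) \<and> v = l"
            using v vA unfolding SA_nhk[OF a(2)] by (auto dest: in_diffD split: if_splits)
          then show ?thesis using nhk(5)[OF a(2)] unfolding SL_eq by auto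
        qed
      qed (rule 1)
    qed
    show "ents SL SA x \<subseteq> ents L A x" if "x \<noteq> (Suc r, ct)" for x using s[of x] that by simp
    show "ents SL SA (Suc r, ct) \<subseteq> ents L A (Suc r, ct) \<union> W" using s[of "(Suc r, ct)"] by simp
    show "0 \<notin> W" using lW[of 0] leg by force
    show "w \<le> v" if "ct < c'" "v \<in> ents SL SA (Suc r, c')" "w \<in> W" for c' v w
    proof -
      have v: "v \<in> ents L A (Suc r, c')" using s[of "(Suc r, c')"] that by auto
      show ?thesis
      proof (cases "w = l")
        case True
        then show ?thesis using after(2)[OF le_refl _ _ v] that by simp
      next
        case False
        then have "w \<in> ents L A (r, c)" "ct = c" using that by (auto simp: W_def ents_def split: if_splits)
        then show ?thesis using semistd_less[OF semistd lessI _ _ v, of c w] that by simp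
      qed
    qed
    show "v \<le> w" if "c' < ct" "v \<in> ents SL SA (Suc r, c')" "w \<in> W" for c' v w
      using before(2)[OF that(1), of v] s[of "(Suc r, c')"] that lW[OF that(3)] by auto
    show "w < v" if "Suc r < r'" "v \<in> ents SL SA (r', ct)" "w \<in> W" for r' v w
    proof -
      have v: "v \<in> ents L A (r', ct)" using s[of "(r', ct)"] that by auto
      show ?thesis
      proof (cases "w = l")
        case True
        then show ?thesis using after(2)[OF _ le_refl _ v] that by simp
      next
        case False
        then have "w \<in> ents L A (r, c)" "ct = c" using that by (auto simp: W_def ents_def split: if_splits)
        then show ?thesis using semistd_less[OF semistd _ _ _ v, of r c w] that by simp
      qed
    qed
    show "v < w" if "r' < Suc r" "v \<in> ents SL SA (r', ct)" "w \<in> W" for r' v w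
    proof -
      have v: "v \<in> ents L A (r', ct)" using s[of "(r', ct)"] that by auto
      have "v < l"
      proof (cases "(r', ct) = (r, c)")
        case True
        then have "ct = c" by simp
        \<comment> \<open>In a vertical bump \<open>(r, c)\<close> has lost \<open>l\<close> and all
          arm entries from \<open>l\<close> on.\<close>
        have "v \<noteq> l \<and> (v \<in> L (r, c) \<or> v < l)"
          using that(2) True unfolding SL_eq SA_hk_c[OF \<open>ct = c\<close>] by (auto simp: ents_def)
        then show ?thesis using Lle[of v] by auto
      next
        case False
        then show ?thesis using left[OF _ ct_le False v] that by simp
      qed
      then show ?thesis using lW[OF that(3)] by simp
    qed
  qed
qed

lemma l_col: assumes "ct < c" "l \<in> ents L A (r', ct)" shows "r' = Suc r"
  using left[of r' ct l] after(2)[of r' ct l] assms ct_le by (cases "r' \<le> r") auto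

lemma leg_count_bump: assumes "ct < c"
  shows "leg_count SL v y = leg_count L v y + of_bool (v = ins \<and> y = ct) - of_bool (v = l \<and> y = c)"
proof -
  consider "v = ins" "y = ct" | "v = l" "y = c" | "\<not> (v = ins \<and> y = ct)" "\<not> (v = l \<and> y = c)" by blast
  then show ?thesis
  proof cases
    case 1
    have "leg_count SL v y = 1" using 1 by (intro leg_count_pos[OF semistd_b, of _ "Suc r"]) (simp add: SL_eq)
    moreover have "ins \<notin> L (r', ct)" for r'
    proof (cases hk)
      case True
      then show ?thesis using l_col[OF assms leg_ents, of r'] hk_above[OF True leg_ents, of l] by (auto simp: ins_def)
    next
      case False
      then show ?thesis using semistd_same_row[OF semistd arm_ents[OF nhk(2)[OF False]] leg_ents, of r'] nhk(6)[OF False] by (auto simp: ins_def)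
    qed
    then have "leg_count L v y = 0" using 1 by (intro leg_count_0) simp
    ultimately show ?thesis using 1 assms by simp
  next
    case 2
    have "l \<notin> SL (r', c)" for r' using semistd_same_row[OF semistd linE leg_ents, of r'] assms by (auto simp: SL_eq)
    then have "leg_count SL v y = 0" using 2 by (intro leg_count_0) simp
    moreover have "leg_count L v y = 1" using 2 lin by (intro leg_count_pos[OF semistd]) auto
    ultimately show ?thesis using 2 assms by simp
  next
    case 3
    then have "leg_count SL v y = leg_count L v y" by (intro leg_count_cong) (auto simp: SL_eq)
    then show ?thesis using 3 by auto
  qed
qed

lemma arm_count_bump: assumes "ct < c"
  shows "arm_count SA v y = arm_count A v y + of_bool (\<not> hk \<and> v = l \<and> y = ct) - of_bool (\<not> hk \<and> v = k \<and> y = ct)"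
proof (cases hk)
  case True
  then show ?thesis using assms by (simp add: SA_hk)
next
  case False
  note n = nhk[OF False]
  consider "v = l" "y = ct" | "v = k" "y = ct" | "\<not> (v = l \<and> y = ct)" "\<not> (v = k \<and> y = ct)" by blast
  then show ?thesis
  proof cases
    case 1
    have "arm_count SA v y = int (count (SA (Suc r, ct)) l)"
      unfolding 1 by (intro arm_count_loc[OF semistd_b]) (simp add: SA_nhk False ents_def)
    moreover have "l \<notin># A (r', ct)" if "r' \<noteq> Suc r" for r' using l_col[OF assms arm_ents, of r'] that by blast
    then have "arm_count A v y = int (count (A (Suc r, ct)) l)" unfolding 1 by (rule arm_count_only)
    ultimately show ?thesis using 1 n(3) False by (simp add: SA_nhk)
  next
    case 2
    have "arm_count SA v y = int (count (SA (Suc r, ct)) k)"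
      unfolding 2 by (intro arm_count_loc[OF semistd_b]) (simp add: SL_eq ins_def False ents_def)
    moreover have "arm_count A v y = int (count (A (Suc r, ct)) k)" unfolding 2 by (intro arm_count_loc[OF semistd] arm_ents n)
    ultimately show ?thesis using 2 n(2,3) False by (simp add: SA_nhk of_nat_diff Suc_le_eq)
  next
    case 3
    then have "arm_count SA v y = arm_count A v y" by (intro arm_count_cong) (auto simp: SA_nhk False)
    then show ?thesis using 3 by auto
  qed
qed

text \<open>A vertical bump moves leg entries to the extended leg and arm entries to the arm of the
  same column, so no count and no height changes.\<close>

lemma data_c: assumes "ct = c" shows "leg_count SL v y = leg_count L v y" "arm_count SA v y = arm_count A v y"
proof -
  note u = SL_eq SA_hk_c[OF assms]
  have ins: "ins = l" using ins_hk[OF ct_c_hk[OF assms]] .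
  show "leg_count SL v y = leg_count L v y"
  proof (cases "v = l \<and> y = c")
    case True
    have "l \<in> SL (Suc r, c)" unfolding SL_eq ins using assms by simp
    then have "leg_count SL v y = 1" using True leg_count_pos[OF semistd_b] by simp
    moreover have "leg_count L v y = 1" using True lin by (intro leg_count_pos[OF semistd]) auto
    ultimately show ?thesis by simp
  next
    case False
    then show ?thesis unfolding SL_eq ins using assms by (intro leg_count_cong) auto
  qed
  show "arm_count SA v y = arm_count A v y"
  proof (cases "y = c \<and> v \<in># A (r, c) \<and> l \<le> v")
    case True
    then have vE: "v \<in> ents L A (r, c)" by (auto intro: arm_ents)
    have "arm_count SA v c = int (count (SA (Suc r, c)) v)"
      using True by (intro arm_count_loc[OF semistd_b]) (simp add: u ents_def)
    moreover have "v \<notin># A (Suc r, c)" using semistd_same_row[OF semistd vE arm_ents, of "Suc r"] by auto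
    then have "count (SA (Suc r, c)) v = count (A (r, c)) v" using True by (simp add: u not_in_iff)
    ultimately show ?thesis using True arm_count_loc[OF semistd vE] by simp
  next
    case False
    then have "v \<notin># A (r, c) \<or> v < l \<or> y \<noteq> c" by auto
    then show ?thesis by (intro arm_count_cong) (auto simp: u not_in_iff)
  qed
qed

lemma peak_c: assumes "ct = c" shows "peak SL SA i = peak L A i" "col_base SL SA i = col_base L A i"
proof -
  show *: "col_base SL SA i = col_base L A i"
    by (rule ext, rule col_base_eq_upto) (simp add: col_net_def data_c[OF assms])
  show "peak SL SA i = peak L A i" by (rule ext) (simp add: peak_def * data_c[OF assms])
qed

section \<open>Heights under a bump into an earlier column\<close>

context fixes i :: nat assumes ctc: "ct < c" begin

text \<open>The contribution of the bumped letter \<open>l\<close> to a height.\<close>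

abbreviation "\<alpha> \<equiv> (of_bool (l = i) - of_bool (l = Suc i) :: int)"

lemma col_base_bump: "col_base SL SA i x = col_base L A i x + (if ct < x \<and> x \<le> c then \<alpha> else 0)"
proof -
  have "col_base SL SA i x = col_base L A i x + (if ct < x then \<alpha> else 0) + (if c < x then - \<alpha> else 0)"
    by (rule col_base_shift) (use ctc in \<open>auto simp: col_net_def leg_count_bump arm_count_bump ins_def\<close>)
  then show ?thesis using ctc by auto
qed

text \<open>At the target, a hook \<open>l\<close> counts fully before the peak. An arm entry
  \<open>l\<close> counts there only if \<open>l = i\<close>, and the transfer of
  \<open>k = Suc i\<close> from arm to leg moves it from after the peak to before it.\<close>

lemma peak_bump: "peak SL SA i y = peak L A i y +
   (if y = ct then (if hk then \<alpha> else of_bool (l = i) - of_bool (k = Suc i))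
    else if ct < y \<and> y < c then \<alpha> else 0)"
  using ctc col_base_bump[of y] by (auto simp: peak_def leg_count_bump arm_count_bump ins_def)

lemma low_col: assumes "y < c" "r' \<le> r" "v \<in> ents L A (r', y)" shows "v < l"
  using left[OF assms(2) _ _ assms(3)] assms(1) by auto

text \<open>Up to row \<open>r\<close> the entries are less than \<open>l\<close>, further up they
  are greater; in column \<open>ct\<close> the latter requires that the hook of the target exceeds
  \<open>l\<close>.\<close>

lemma mid_col: assumes "ct \<le> y" "y < c" "y = ct \<Longrightarrow> hk" "v \<in> ents L A (r', y)" shows "v \<noteq> l"
proof (cases "r' \<le> r")
  case True
  then show ?thesis using low_col[OF assms(2) _ assms(4)] by auto
next
  case False
  show ?thesis
  proof (cases "(r', y) = (Suc r, ct)")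
    case True
    then show ?thesis using hk_above[of v] assms by auto
  next
    case F: False
    then show ?thesis using after(2)[OF _ assms(1) F assms(4)] False by auto
  qed
qed

text \<open>A \<open>Suc l\<close> beyond the target forces an entry of the target into the range
  from \<open>l + 1\<close> to \<open>Suc l\<close>.\<close>

lemma mid_col_suc: assumes "ct \<le> y" "y < c" "Suc l \<notin> ents L A (Suc r, ct)" shows "Suc l \<notin> ents L A (r', y)"
proof
  assume H: "Suc l \<in> ents L A (r', y)"
  show False
  proof (cases "r' \<le> r")
    case True
    then show False using low_col[OF assms(2) _ H] by auto
  next
    case False
    show ?thesis
    proof (cases "(r', y) = (Suc r, ct)")
      case True
      then show ?thesis using assms H by auto
    next
      case F: False
      obtain w where w: "w \<in> ents L A (Suc r, ct)" "l < w" "w \<le> Suc l"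
        using after(1)[OF _ assms(1) F H] False by auto
      have e: "w = Suc l" using w(2,3) by simp
      show ?thesis using w(1) assms(3) unfolding e by simp
    qed
  qed
qed

text \<open>The \<open>Suc i\<close> of the target pays for the additional \<open>i\<close>. If
  \<open>Suc i\<close> is the hook, it lowers the height before the peak of \<open>ct\<close>, hence
  the comparison with the base; if it is an arm entry, it does so after the peak, hence the
  comparison with the peak. The columns strictly between have no \<open>i\<close> and cannot rise
  again.\<close>

lemma peak_i_suc:
  assumes "l = i" "Suc i \<in> ents L A (Suc r, ct)" "ct \<le> y" "y < c"
  shows "peak SL SA i y \<le> (if hk then col_base L A i ct else peak L A i ct)"
    "col_base L A i c < (if hk then col_base L A i ct else peak L A i ct)"
proof -
  have no: "i \<notin> ents L A (r', x)" if "Suc ct \<le> x" "x < c" for x r'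
    using mid_col[of x i r'] that assms(1) by auto
  have bs: "col_base L A i (Suc ct) + 1 \<le> (if hk then col_base L A i ct else peak L A i ct)"
  proof (cases hk)
    case True
    have n: "i \<notin> ents L A (r', ct)" for r' using mid_col[of ct i r'] assms(1) ctc True by auto
    obtain u where u: "u \<in> L (Suc r, ct)" "u \<le> Suc i" using ents_L[OF semistd assms(2)] by auto
    then have "u = Suc i" using hk_above[OF True leg_ents[OF u(1)]] assms(1) by simp
    then have "leg_count L (Suc i) ct = 1" using leg_count_pos[OF semistd] u by simp
    then show ?thesis using no_i_col_net(1)[of i L A ct, OF n] col_base_Suc_le[of L A i ct] True by simp
  next
    case False
    have "Suc i \<in># A (Suc r, ct)" using nhk(5)[OF False] assms(1,2) by (auto simp: ents_def)
    then have "0 < count (A (Suc r, ct)) (Suc i)" by simp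
    then have "1 \<le> arm_count A (Suc i) ct" using arm_count_loc[OF semistd assms(2)] by linarith
    then show ?thesis using False by (simp add: col_base_Suc)
  qed
  have "col_base L A i c \<le> col_base L A i (Suc ct)"
    using no ctc by (intro col_base_mono) auto
  then show "col_base L A i c < (if hk then col_base L A i ct else peak L A i ct)" using bs by linarith
  show "peak SL SA i y \<le> (if hk then col_base L A i ct else peak L A i ct)"
  proof (cases "y = ct")
    case True
    show ?thesis
    proof (cases hk)
      case hk: True
      have n: "i \<notin> ents L A (r', ct)" for r' using mid_col[of ct i r'] assms(1) ctc hk by auto
      obtain u where u: "u \<in> L (Suc r, ct)" "u \<le> Suc i" using ents_L[OF semistd assms(2)] by auto
      then have "u = Suc i" using hk_above[OF hk leg_ents[OF u(1)]] assms(1) by simp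
      then have "leg_count L (Suc i) ct = 1" using leg_count_pos[OF semistd] u by simp
      then show ?thesis
        using no_i_col_net(1)[of i L A ct, OF n] True hk peak_bump[of y] assms(1) by simp
    next
      case False
      have "Suc i \<in># A (Suc r, ct)" using nhk(5)[OF False] assms(1,2) by (auto simp: ents_def)
      \<comment> \<open>The incoming arm entry \<open>i\<close> and the \<open>Suc i\<close> that
        enters the leg cancel at the peak of \<open>ct\<close>.\<close>
      then have "k = Suc i" using nhk(3,4)[OF False] assms(1) by (meson Suc_leI le_antisym lessI)
      then show ?thesis using True False peak_bump[of y] assms(1) by simp
    qed
  next
    case False
    then have "peak L A i y \<le> col_base L A i (Suc ct)"
      using no assms by (intro peak_mono[where v = c]) auto
    then show ?thesis using bs peak_bump[of y] False assms by simp
  qed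
qed

text \<open>No \<open>Suc i\<close> occurs from \<open>ct\<close> to \<open>c - 1\<close> and no
  \<open>i\<close> strictly between, so the height is constant from the peak of \<open>ct\<close> up
  to column \<open>c\<close>. Raised by one it is the height after the leg entry \<open>i\<close> of
  column \<open>c\<close>, that is the peak of \<open>c\<close> without the arm entries
  \<open>i\<close>.\<close>

lemma peak_i_nosuc:
  assumes "l = i" "Suc i \<notin> ents L A (Suc r, ct)"
  shows "peak SL SA i ct = peak L A i c - arm_count A i c"
    "ct \<le> y \<Longrightarrow> y < c \<Longrightarrow> peak SL SA i y = peak L A i y + 1 \<and> peak SL SA i y \<le> peak L A i c - arm_count A i c"
proof -
  have no: "i \<notin> ents L A (r', x)" if "Suc ct \<le> x" "x < c" for x r'
    using mid_col[of x i r'] that assms(1) by auto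
  have nos: "Suc i \<notin> ents L A (r', x)" if "ct \<le> x" "x < c" for x r'
    using mid_col_suc[OF that] assms by auto
  have nsL: "Suc i \<notin> L (r', c)" for r'
  proof
    assume H: "Suc i \<in> L (r', c)"
    then have "r' = r \<or> r' = Suc r" using semistd_suc_row[OF semistd linE] assms(1) leg_ents by blast
    then have r': "r' = Suc r" using Lle[of "Suc i"] H assms(1) by auto
    obtain w where w: "w \<in> ents L A (Suc r, ct)" "l < w" "w \<le> Suc i"
      using after(1)[OF le_refl _ _ leg_ents[of _ "(Suc r, c)"]] H r' ctc by (metis Pair_inject less_imp_le_nat nat_neq_iff)
    have e: "w = Suc i" using w(2,3) assms(1) by simp
    show False using w(1) assms(2) unfolding e by simp
  qed
  have z: "peak L A i x = col_base L A i (Suc ct) \<and> col_base L A i (Suc x) = col_base L A i (Suc ct)" if "ct \<le> x" "x < c" for x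
    using that
  proof (induction x rule: dec_induct)
    case base
    show ?case using arm_count_ents_0[of "Suc i" L A ct, OF nos] ctc by (simp add: col_base_Suc)
  next
    case (step n)
    then have n: "col_base L A i (Suc n) = col_base L A i (Suc ct)" by simp
    have "peak L A i (Suc n) = col_base L A i (Suc n)" "arm_count A (Suc i) (Suc n) = 0"
      using no_i_col_net(1)[of i L A "Suc n", OF no] leg_count_ents_0[of "Suc i" L A "Suc n", OF nos]
        arm_count_ents_0[of "Suc i" L A "Suc n", OF nos] step by simp_all
    then show ?case using n by (simp add: col_base_Suc)
  qed
  have bc: "col_base L A i c = col_base L A i (Suc ct)" using z[of "c - 1"] ctc by simp
  have pc: "peak L A i c = col_base L A i (Suc ct) + 1 + arm_count A i c"
    using bc leg_count_0[of "Suc i" L c, OF nsL] leg_count_pos[OF semistd lin] assms(1) by (simp add: peak_def)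
  have k: "k \<noteq> Suc i" if "\<not> hk" using nhk(2)[OF that] assms(2) arm_ents by metis
  show "peak SL SA i ct = peak L A i c - arm_count A i c"
    using z[of ct] ctc pc peak_bump[of ct] k assms(1) by simp
  show "peak SL SA i y = peak L A i y + 1 \<and> peak SL SA i y \<le> peak L A i c - arm_count A i c" if "ct \<le> y" "y < c"
    using z[OF that] pc peak_bump[of y] k assms(1) that by simp
qed

end

text \<open>Only \<open>l = i\<close> can raise a peak, and then the raised peaks stay within
  heights attained before: at column \<open>ct\<close>, or in column \<open>c\<close> after its
  legs.\<close>

lemma height_bound_bump: assumes "height_bound L A i M" shows "height_bound SL SA i M"
proof (cases "ct = c")
  case True
  show ?thesis using assms unfolding height_bound_def peak_c[OF True] .
next
  case False
  then have ctc: "ct < c" using ct_le by simp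
  have p: "0 \<le> M" "\<And>y. peak L A i y \<le> M" and b: "\<And>y. col_base L A i y \<le> M"
    using assms height_bound_col_base[OF assms] by (auto simp: height_bound_def)
  have "peak SL SA i y \<le> M" for y
  proof (cases "l = i \<and> ct \<le> y \<and> y < c")
    case True
    show ?thesis
    proof (cases "Suc i \<in> ents L A (Suc r, ct)")
      case s: True
      show ?thesis using peak_i_suc(1)[OF ctc _ s, of y] True p(2)[of ct] b[of ct] by (auto split: if_splits)
    next
      case s: False
      have "peak SL SA i y \<le> peak L A i c - arm_count A i c" using peak_i_nosuc(2)[OF ctc _ s, of y] True by simp
      then show ?thesis using p(2)[of c] arm_count_ge0[of A i c] by linarith
    qed
  next
    case False
    then have "peak SL SA i y \<le> peak L A i y" using peak_bump[OF ctc, of i y] ctc by auto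
    then show ?thesis using p(2)[of y] by simp
  qed
  then show ?thesis using p by (simp add: height_bound_def)
qed

end

section \<open>Interference of f_i with a bump\<close>

context f_site
begin

lemma ents_f: "ents L' A' x \<subseteq> ents L A x \<union> (if \<not> M \<and> x = (r, c) then {Suc i} else {})"
proof -
  consider (M) M | (S) "\<not> M" S | (Na) "\<not> M" "\<not> S" "i \<in># A (r, c)" | (Nl) "\<not> M" "\<not> S" "i \<notin># A (r, c)" by blast
  then show ?thesis
  proof cases
    case M then show ?thesis unfolding upd_M[OF M] by (auto simp: ents_def dest: in_diffD)
  next
    case S then show ?thesis unfolding upd_S[OF S] by (auto simp: ents_def)
  next
    case Na then show ?thesis unfolding upd_Na[OF Na] by (auto simp: ents_def dest: in_diffD)
  next
    case Nl then show ?thesis unfolding upd_Nl[OF Nl] by (auto simp: ents_def)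
  qed
qed

text \<open>A cell loses its last \<open>i\<close> only if it then contains \<open>Suc i\<close>, so
  having an entry above \<open>l\<close> survives f_i.\<close>

lemma ents_f_rev: assumes "v \<in> ents L A x" shows "v \<in> ents L' A' x \<or> v = i \<and> Suc i \<in> ents L' A' x"
proof -
  consider (M) M | (S) "\<not> M" S | (Na) "\<not> M" "\<not> S" "i \<in># A (r, c)" | (Nl) "\<not> M" "\<not> S" "i \<notin># A (r, c)" by blast
  then show ?thesis
  proof cases
    case M then show ?thesis using assms M_arm(3)[OF M] unfolding upd_M[OF M] by (auto simp: ents_def in_diff_count)
  next
    case S then show ?thesis using assms S_data(6)[OF S] unfolding upd_S[OF S] by (auto simp: ents_def)
  next
    case Na then show ?thesis using assms unfolding upd_Na[OF Na] by (auto simp: ents_def in_diff_count)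
  next
    case Nl then show ?thesis using assms unfolding upd_Nl[OF Nl] by (auto simp: ents_def)
  qed
qed

end

locale bump_f = bump L A r c l ct + F: f_site L A i r0 c0 for L A r c l ct i r0 c0
begin

text \<open>The situations in which \<open>f\<close> and the bump interfere: in \<open>E1\<close> the bumped entry is itself the \<open>i\<close>
  that \<open>f\<close> changes; in \<open>E2\<close> \<open>f\<close> raises an \<open>i = l\<close> of row \<open>r + 1\<close>, where the bump then stops
  instead of in column \<open>ct\<close>; in \<open>E3\<close> \<open>f\<close> moves the entry to be bumped one column to the left.\<close>

abbreviation "E1 \<equiv> l = i \<and> \<not> F.M \<and> r0 = r \<and> c0 = c \<and> i \<notin># A (r, c)"
abbreviation "E2 \<equiv> l = i \<and> \<not> F.M \<and> r0 = Suc r \<and> c0 < ct"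
abbreviation "E3 \<equiv> \<not> F.M \<and> F.S \<and> r0 = r \<and> Suc i = l \<and> Suc c0 = c"

lemma fm: "0 < peak L A i c0" "x < c0 \<Longrightarrow> peak L A i x < peak L A i c0" "peak L A i x \<le> peak L A i c0"
  using F.fmx by (simp_all add: first_max_def)

lemma peak_out: "y < ct \<or> c \<le> y \<Longrightarrow> peak SL SA i y = peak L A i y"
proof (cases "ct = c")
  case True
  show ?thesis unfolding peak_c[OF True] ..
next
  case False
  then have "ct < c" using ct_le by simp
  then show "y < ct \<or> c \<le> y \<Longrightarrow> ?thesis" using peak_bump[of i y] by auto
qed

lemma nhk_k_suc: assumes "\<not> hk" "Suc l \<in> ents L A (Suc r, ct)" shows "k = Suc l"
proof -
  have "Suc l \<in># A (Suc r, ct)" using nhk(5)[OF assms(1)] assms(2) by (auto simp: ents_def)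
  then show ?thesis using nhk(3)[OF assms(1)] nhk(4)[OF assms(1), of "Suc l"] by simp
qed

text \<open>The column of a lone leg \<open>i\<close> peaks at most 1 above its base. With
  \<open>Suc i\<close> in the target this base lies below the base or the peak of \<open>ct\<close>,
  which must themselves lie below the first maximum in column \<open>c\<close>.\<close>

lemma E1_nosuc: assumes E1 shows "Suc i \<notin> ents L A (Suc r, ct)"
proof
  assume H: "Suc i \<in> ents L A (Suc r, ct)"
  have ctc: "ct < c" using assms H ct_le by (cases "ct = c") auto
  note p = peak_i_suc(2)[OF ctc conjunct1[OF assms] H le_refl ctc]
  have "leg_count L i c = 1" "arm_count A i c = 0" using F.nLi F.nAi assms lin by (auto simp: count_eq_zero_iff)
  then have "peak L A i c \<le> col_base L A i c + 1" using leg_count_ge0[of L "Suc i" c] by (simp add: peak_def)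
  moreover have "col_base L A i ct < peak L A i c" using first_max_col_base[OF F.fmx, of ct] assms ctc by simp
  moreover have "peak L A i ct < peak L A i c" using fm(2)[of ct] assms ctc by simp
  ultimately show False using p by (auto split: if_splits)
qed

text \<open>The \<open>i\<close> on which f_i acts has been bumped to column \<open>ct\<close>; the
  raised heights from \<open>ct\<close> to \<open>c - 1\<close> do not exceed the old maximum, and
  \<open>ct\<close> attains it first.\<close>

lemma colA: assumes E1 shows "first_max SL SA i ct"
proof (cases "ct = c")
  case True
  then show ?thesis using F.fmx assms unfolding first_max_def peak_c[OF True] by simp
next
  case False
  then have ctc: "ct < c" using ct_le by simp
  have li: "l = i" and c0: "c0 = c" using assms by auto
  have a: "arm_count A i c = 0" using F.nAi assms by (simp add: count_eq_zero_iff)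
  note p = peak_i_nosuc[OF ctc li E1_nosuc[OF assms]]
  have pc: "peak SL SA i ct = peak L A i c" using p(1) a by simp
  have "peak SL SA i y \<le> peak L A i c \<and> (y < ct \<longrightarrow> peak SL SA i y < peak L A i c)" for y
  proof (cases "ct \<le> y \<and> y < c")
    case True
    then show ?thesis using p(2)[of y] a by simp
  next
    case False
    then show ?thesis using peak_out[of y] fm(2,3)[of y] c0 ctc by auto
  qed
  then show ?thesis using pc fm(1) c0 by (simp add: first_max_def)
qed

text \<open>As (M) fails, all entries above \<open>(r, c0)\<close> exceed \<open>Suc i = l\<close>.
  So that cell cannot precede the target, and if it is the target, its hook exceeds
  \<open>l\<close>.\<close>

lemma E3_range: assumes E3 shows "ct < c" "ct \<le> c0" "ct = c0 \<Longrightarrow> hk"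
proof -
  have nM: "\<not> F.M" using assms by blast
  have up: "Suc i < v" if "v \<in> ents L A (Suc r, c0)" for v
    using F.nM_up[OF nM, of "Suc r" v] that assms by auto
  show ctc: "ct < c"
  proof (rule ccontr)
    assume "\<not> ?thesis"
    then have "c0 < ct" using assms ct_le by auto
    then obtain v where v: "v \<in> L (Suc r, c0)" "v \<le> l" using before[of c0] leg_ents by blast
    then show False using up[OF leg_ents[OF v(1)]] assms by auto
  qed
  then show "ct \<le> c0" using assms by auto
  show hk if "ct = c0"
  proof (rule ccontr)
    assume "\<not> hk"
    then obtain h where h: "h \<in> L (Suc r, ct)" "h \<le> l" using nhk(5) by auto
    then show False using up[of h] leg_ents[of h] that assms by auto
  qed
qed

text \<open>Columns \<open>c0\<close> and \<open>c\<close> have equal peaks because of (S). The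
  bumped \<open>l = Suc i\<close> now comes before the peak of \<open>c0\<close> and lowers it,
  which leaves \<open>c\<close> as the first maximum.\<close>

lemma colB: assumes E3 shows "first_max SL SA i c"
proof -
  note e = E3_range[OF assms]
  have S: "\<not> F.M" "F.S" and c: "Suc c0 = c" and l: "Suc i = l" using assms by auto
  have pc: "peak L A i c = peak L A i c0"
    using F.S_data[OF S] c by (auto simp: peak_def[of L A i "Suc c0"] col_base_Suc)
  have "peak SL SA i y \<le> peak L A i c0 \<and> (y < c \<longrightarrow> peak SL SA i y < peak L A i c0)" for y
  proof -
    have "peak SL SA i y \<le> peak L A i y" "y = c0 \<Longrightarrow> peak SL SA i y < peak L A i y"
      using peak_bump[OF e(1), of i y] l e c by auto
    then show ?thesis using fm(2,3)[of y] c by (cases y c0 rule: linorder_cases) auto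
  qed
  moreover have "peak SL SA i c = peak L A i c0" using peak_out[of c] pc by simp
  ultimately show ?thesis using fm(1) by (simp add: first_max_def)
qed

text \<open>A smaller entry next to \<open>l = Suc i\<close> is at least \<open>i\<close>, so
  \<open>(r, c)\<close> contains \<open>i\<close> and \<open>(r0, c0)\<close> lies in row
  \<open>r\<close>. If there were a column between them, (S) would put a \<open>Suc i\<close> there,
  left of \<open>l\<close> and not smaller than it.\<close>

lemma range_E3: assumes "l = Suc i" "ct < c" "ct \<le> c0" "c0 < c" "c0 = ct \<Longrightarrow> hk" shows E3
proof -
  have no: "Suc i \<notin> ents L A (r', c0)" for r' using mid_col[OF assms(2-5), of "Suc i" r'] assms(1) by auto
  then have nM: "\<not> F.M" by blast
  have "\<not> Suc r \<le> r0"
  proof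
    assume H: "Suc r \<le> r0"
    show False
    proof (cases "(r0, c0) = (Suc r, ct)")
      case True
      then show False using hk_above[of i] F.inc assms by auto
    next
      case False
      then show False using after(2)[OF H assms(3) False F.inc] assms(1) by simp
    qed
  qed
  then have le: "r0 \<le> r" by simp
  obtain u where u: "u \<in> L (r, c)" "u < l" using leg by auto
  have "i \<le> u" using semistd_le[OF semistd le _ _ F.inc leg_ents[OF u(1)]] assms(4) by simp
  then have ui: "u = i" using u assms(1) by simp
  have r0: "r0 = r"
  proof (rule ccontr)
    assume "r0 \<noteq> r"
    then show False using semistd_less[OF semistd _ _ F.inc leg_ents[OF u(1)]] le assms(4) ui by simp
  qed
  have "Suc c0 = c"
  proof (rule ccontr)
    assume "Suc c0 \<noteq> c"
    then have c: "Suc c0 < c" using assms(4) by simp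
    have "L (r, Suc c0) \<noteq> {}" using semistd_shape[OF semistd ents_nonempty[OF semistd linE] le_refl, of "Suc c0"] c by simp
    then obtain w where w: "w \<in> L (r, Suc c0)" by auto
    have "i \<le> w" using semistd_row[OF semistd lessI _ leg_ents[OF w], of i] F.inc r0 by simp
    moreover have "w \<le> i" using semistd_row[OF semistd c leg_ents[OF w] leg_ents[OF u(1)]] ui by simp
    ultimately have "F.S" using w r0 by simp
    then have "Suc i \<in> L (r, Suc c0)" using F.S_data(6)[OF nM] r0 by simp
    then show False using low_col[OF assms(2) c le_refl leg_ents] assms(1) by blast
  qed
  then show E3 using nM u(1) ui r0 assms(1) by auto
qed

lemma colC: assumes nE1: "\<not> E1" and nE3: "\<not> E3" shows "first_max SL SA i c0"
proof (cases "ct = c")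
  case True
  then show ?thesis using F.fmx unfolding first_max_def peak_c[OF True] by simp
next
  case False
  then have ctc: "ct < c" using ct_le by simp
  \<comment> \<open>Other columns keep their peaks, so only \<open>ct\<close> to
    \<open>c - 1\<close> have to be compared with the old maximum.\<close>
  have goal: ?thesis if "peak SL SA i c0 = peak L A i c0"
    "\<And>y. ct \<le> y \<Longrightarrow> y < c \<Longrightarrow> peak SL SA i y \<le> peak L A i c0 \<and> (y < c0 \<longrightarrow> peak SL SA i y < peak L A i c0)"
  proof -
    have "peak SL SA i y \<le> peak L A i c0 \<and> (y < c0 \<longrightarrow> peak SL SA i y < peak L A i c0)" for y
    proof (cases "ct \<le> y \<and> y < c")
      case True
      then show ?thesis using that(2)[of y] by blast
    next
      case False
      then show ?thesis using peak_out[of y] fm(2,3)[of y] by auto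
    qed
    then show ?thesis using that(1) fm(1) by (simp add: first_max_def)
  qed
  have ubc: "col_base L A i ct \<le> peak L A i c0" using height_bound_col_base[OF first_max_height_bound[OF F.fmx]] .
  consider (i) "l = i" "Suc i \<in> ents L A (Suc r, ct)" | (ii) "l = i" "Suc i \<notin> ents L A (Suc r, ct)"
    | (s) "l = Suc i" | (o) "l \<noteq> i" "l \<noteq> Suc i" by blast
  then show ?thesis
  proof cases
    case i
    note p = peak_i_suc(1)[OF ctc i]
    show ?thesis
    proof (rule goal)
      show "peak SL SA i c0 = peak L A i c0"
      proof (cases "ct \<le> c0 \<and> c0 < c")
        case True
        then have c0: "c0 = ct" "\<not> hk" using mid_col[OF ctc, of c0 i r0] F.inc i(1) by auto
        then show ?thesis using peak_bump[OF ctc, of i c0] nhk_k_suc i by simp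
      next
        case False
        then show ?thesis using peak_out[of c0] by auto
      qed
      show "peak SL SA i y \<le> peak L A i c0 \<and> (y < c0 \<longrightarrow> peak SL SA i y < peak L A i c0)" if "ct \<le> y" "y < c" for y
        using p[OF that] ubc fm(3)[of ct] first_max_col_base[OF F.fmx, of ct] fm(2)[of ct] that
        by (cases hk) (auto simp: split: if_splits)
    qed
  next
    case ii
    note p = peak_i_nosuc(2)[OF ctc ii]
    \<comment> \<open>The peak of such a column could rise by one and still not exceed that of
      \<open>c\<close>, so it was not maximal.\<close>
    have n: "\<not> (ct \<le> c0 \<and> c0 < c)" using p[of c0] fm(3)[of c] arm_count_ge0[of A i c] by force
    \<comment> \<open>Without an arm entry \<open>i\<close> in \<open>(r, c)\<close> this would be
      \<open>E1\<close>; with one, the raised peaks stay strictly below that of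
      \<open>c\<close>.\<close>
    have a: "1 \<le> arm_count A i c" if "c0 = c"
    proof -
      have "r0 = r" using F.i_row[of r] linE ii(1) that by simp
      then have "i \<in># A (r, c)" using nE1 F.M_arm(1) ii(1) that by blast
      then have "0 < count (A (r, c)) i" by simp
      then show ?thesis using F.nAi that \<open>r0 = r\<close> by simp
    qed
    show ?thesis
    proof (rule goal)
      show "peak SL SA i c0 = peak L A i c0" using peak_out[of c0] n by auto
      show "peak SL SA i y \<le> peak L A i c0 \<and> (y < c0 \<longrightarrow> peak SL SA i y < peak L A i c0)" if "ct \<le> y" "y < c" for y
      proof -
        have q1: "peak SL SA i y \<le> peak L A i c"
          using conjunct2[OF p[OF that]] arm_count_ge0[of A i c] by linarith
        have q2: "peak SL SA i y < peak L A i c" if "c0 = c"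
          using conjunct2[OF p[OF \<open>ct \<le> y\<close> \<open>y < c\<close>]] a[OF that] by linarith
        show ?thesis
        proof (cases c c0 rule: linorder_cases)
          case less
          then show ?thesis using q1 fm(2)[of c] by simp
        next
          case equal
          then show ?thesis using q2 by simp
        next
          case greater
          then show ?thesis using q1 fm(3)[of c] n that by auto
        qed
      qed
    qed
  next
    case s
    have nr: "\<not> (ct \<le> c0 \<and> c0 < c) \<or> c0 = ct \<and> \<not> hk" using range_E3[OF s ctc] nE3 by blast
    have k: "k \<noteq> Suc i" if "\<not> hk" using nhk(3)[OF that] s by simp
    show ?thesis
    proof (rule goal)
      show "peak SL SA i c0 = peak L A i c0" using peak_bump[OF ctc, of i c0] nr k s ctc by auto
      show "peak SL SA i y \<le> peak L A i c0 \<and> (y < c0 \<longrightarrow> peak SL SA i y < peak L A i c0)" if "ct \<le> y" "y < c" for y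
        using peak_bump[OF ctc, of i y] fm(2,3)[of y] s k by (auto split: if_splits)
    qed
  next
    case o
    \<comment> \<open>When \<open>k = Suc i\<close> lowers the peak of \<open>ct\<close>, f_i does
      not act there: an \<open>i\<close> would be an arm entry of the target between
      \<open>l\<close> and \<open>k\<close>, or lie below the target and be less than
      \<open>l\<close>.\<close>
    have nct: "c0 \<noteq> ct" if "\<not> hk" "k = Suc i"
    proof
      assume c0: "c0 = ct"
      have li: "l < i" using nhk(3)[OF that(1)] that(2) o by simp
      have "r0 = Suc r \<or> Suc r = Suc r0"
        using semistd_suc_row[OF semistd F.inc, of "Suc r"] arm_ents[OF nhk(2)[OF that(1)]] that(2) c0 by auto
      then show False
      proof
        assume r0: "r0 = Suc r"
        then have "i \<in># A (Suc r, ct)" using F.inc c0 nhk(5)[OF that(1)] li by (auto simp: ents_def)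
        then show False using nhk(4)[OF that(1) _ li] that(2) by auto
      next
        assume "Suc r = Suc r0"
        then show False using low_col[OF ctc ctc, of r i] F.inc c0 li by auto
      qed
    qed
    show ?thesis
    proof (rule goal)
      show "peak SL SA i c0 = peak L A i c0" using peak_bump[OF ctc, of i c0] nct o by auto
      show "peak SL SA i y \<le> peak L A i c0 \<and> (y < c0 \<longrightarrow> peak SL SA i y < peak L A i c0)" if "ct \<le> y" "y < c" for y
        using peak_bump[OF ctc, of i y] fm(2,3)[of y] o by (auto split: if_splits)
    qed
  qed
qed

text \<open>(S) needs both \<open>i\<close> and \<open>Suc i\<close> in one extended leg, and rows
  above \<open>r\<close> have no proper legs.\<close>

lemma S_row: assumes "\<not> F.M" "F.S" shows "r0 \<le> r"
proof (rule ccontr)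
  assume "\<not> ?thesis"
  then have "r < r0" by simp
  then show False using top[OF _ assms(2) F.S_data(6)[OF assms]] by simp
qed

lemma S_leg: assumes "\<not> F.M" "F.S" "r0 = r" shows "Suc i < l \<or> Suc i = l \<and> Suc c0 \<le> c"
  using lmax[of i "Suc c0" "Suc i"] assms F.S_data(6)[OF assms(1,2)] by simp

text \<open>Outside the three situations the comparisons that determine \<open>c\<close>,
  \<open>l\<close> and \<open>ct\<close> have the same outcome after f_i.\<close>

lemma bump_gen: assumes n1: "\<not> E1" and n2: "\<not> E2" and n3: "\<not> E3" shows "bump F.L' F.A' r c l ct"
proof -
  consider (M) F.M | (S) "\<not> F.M" F.S | (Na) "\<not> F.M" "\<not> F.S" "i \<in># A (r0, c0)" | (Nl) "\<not> F.M" "\<not> F.S" "i \<notin># A (r0, c0)" by blast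
  then have "(\<forall>r' c' u v. r < r' \<longrightarrow> u \<in> F.L' (r', c') \<longrightarrow> v \<in> F.L' (r', c') \<longrightarrow> u = v) \<and>
    l \<in> F.L' (r, c) \<and> (\<exists>u\<in>F.L' (r, c). u < l) \<and>
    (\<forall>c' u v. u \<in> F.L' (r, c') \<longrightarrow> v \<in> F.L' (r, c') \<longrightarrow> u < v \<longrightarrow> v < l \<or> v = l \<and> c' \<le> c)"
    (is "?P F.L'")
  proof cases
    case M
    show ?thesis unfolding F.upd_M(1)[OF M] using top lin leg lmax by blast
  next
    case Na
    show ?thesis unfolding F.upd_Na(1)[OF Na] using top lin leg lmax by blast
  next
    case S
    note row = S_row[OF S]
    have li: "l \<noteq> i" if "r0 = r" using S_leg[OF S that] by auto
    have sl: "Suc i < l" if "r0 = r"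
    proof -
      \<comment> \<open>If it were \<open>l\<close>, its cell would not lie right of
        \<open>c\<close> by the choice of \<open>c\<close>, would not be \<open>c\<close> since
        \<open>E3\<close> fails, and further left the entries are less than
        \<open>l\<close>.\<close>
      have "Suc i \<noteq> l"
      proof
        assume l: "Suc i = l"
        then have "Suc c0 < c" using S_leg[OF S that] n3 S that by auto
        then show False using left[OF le_refl _ _ leg_ents[of "Suc i" "(r, Suc c0)"]] F.S_data(6)[OF S] that l by auto
      qed
      then show ?thesis using S_leg[OF S that] by simp
    qed
    show ?thesis unfolding F.upd_S(1)[OF S]
    proof (intro conjI allI impI)
      fix r' c' u v
      assume H: "r < r'" "u \<in> (L((r0, Suc c0) := L (r0, Suc c0) - {i}, (r0, c0) := insert (Suc i) (L (r0, c0)))) (r', c')"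
        "v \<in> (L((r0, Suc c0) := L (r0, Suc c0) - {i}, (r0, c0) := insert (Suc i) (L (r0, c0)))) (r', c')"
      then show "u = v" using top[OF H(1), of u c' v] row by auto
    next
      show "l \<in> (L((r0, Suc c0) := L (r0, Suc c0) - {i}, (r0, c0) := insert (Suc i) (L (r0, c0)))) (r, c)"
        using lin li by auto
      obtain u where u: "u \<in> L (r, c)" "u < l" using leg by auto
      show "\<exists>u\<in>(L((r0, Suc c0) := L (r0, Suc c0) - {i}, (r0, c0) := insert (Suc i) (L (r0, c0)))) (r, c). u < l"
      proof (cases "u = i \<and> r0 = r \<and> c = Suc c0")
        case True
        then show ?thesis using F.S_data(6)[OF S] sl by (intro bexI[of _ "Suc i"]) auto
      next
        case False
        then show ?thesis using u by (intro bexI[of _ u]) auto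
      qed
    next
      fix c' u v
      assume H: "u \<in> (L((r0, Suc c0) := L (r0, Suc c0) - {i}, (r0, c0) := insert (Suc i) (L (r0, c0)))) (r, c')"
        "v \<in> (L((r0, Suc c0) := L (r0, Suc c0) - {i}, (r0, c0) := insert (Suc i) (L (r0, c0)))) (r, c')" "u < v"
      show "v < l \<or> v = l \<and> c' \<le> c"
      proof (cases "r0 = r \<and> c' = c0 \<and> (u = Suc i \<or> v = Suc i)")
        case True
        have "w \<le> i" if "w \<in> L (r, c0)" for w using F.S_le[OF S, of w] leg_ents[OF that] True by simp
        then have "v \<le> Suc i" using H True by (auto intro: le_SucI)
        then show ?thesis using sl True by simp
      next
        case False
        then have "u \<in> L (r, c')" "v \<in> L (r, c')" using H by (auto split: if_splits)
        then show ?thesis using lmax H(3) by blast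
      qed
    qed
  next
    case Nl
    note u = F.upd_Nl(1)[OF Nl]
    have iL: "i \<in> L (r0, c0)" using F.leg_i[OF Nl(3)] .
    have ns: "Suc i \<notin> L (r', c0)" for r' using F.leg_no_suc[OF Nl(3)] .
    show ?thesis unfolding u
    proof (intro conjI allI impI)
      fix r' c' u v
      assume H: "r < r'" "u \<in> (L((r0, c0) := insert (Suc i) (L (r0, c0) - {i}))) (r', c')"
        "v \<in> (L((r0, c0) := insert (Suc i) (L (r0, c0) - {i}))) (r', c')"
      show "u = v"
      proof (cases "(r', c') = (r0, c0)")
        case True
        then have "w = i" if "w \<in> L (r0, c0)" for w using top[OF H(1), of w c' i] iL that by simp
        then have "L (r0, c0) = {i}" using iL by blast
        then show ?thesis using H True by auto
      next
        case False
        then show ?thesis using H(2,3) top[OF H(1), of u c' v] by (auto split: if_splits)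
      qed
    next
      have ll: "l \<noteq> i" if "(r0, c0) = (r, c)" using n1 Nl that by auto
      show "l \<in> (L((r0, c0) := insert (Suc i) (L (r0, c0) - {i}))) (r, c)" using lin ll by auto
      obtain u where u: "u \<in> L (r, c)" "u < l" using leg by auto
      show "\<exists>u\<in>(L((r0, c0) := insert (Suc i) (L (r0, c0) - {i}))) (r, c). u < l"
      proof (cases "(r0, c0) = (r, c) \<and> u = i")
        case True
        then have "Suc i \<noteq> l" using ns[of r] lin by auto
        then show ?thesis using u True by (intro bexI[of _ "Suc i"]) auto
      next
        case False
        then show ?thesis using u by (intro bexI[of _ u]) auto
      qed
    next
      fix c' u v
      assume H: "u \<in> (L((r0, c0) := insert (Suc i) (L (r0, c0) - {i}))) (r, c')"
        "v \<in> (L((r0, c0) := insert (Suc i) (L (r0, c0) - {i}))) (r, c')" "u < v"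
      show "v < l \<or> v = l \<and> c' \<le> c"
      proof (cases "r0 = r \<and> c' = c0")
        case F: True
        show ?thesis
        proof (cases "v = Suc i")
          case True
          then have u: "u \<in> L (r, c0)" "u < i" using H F by (auto simp: less_Suc_eq)
          then have "i < l \<or> i = l \<and> c0 \<le> c" using lmax[OF u(1) _ u(2)] iL F by simp
          moreover have "\<not> (i = l \<and> c0 \<le> c)"
            using left[OF le_refl, of c0 i] F.inc n1 Nl F by (cases "c0 = c") auto
          ultimately have il: "i < l" by blast
          \<comment> \<open>Right of \<open>c\<close> all entries of row \<open>r\<close> are at
            least \<open>l\<close>, but this cell contains \<open>i = l - 1\<close>.\<close>
          have "Suc i = l \<Longrightarrow> c0 \<le> c" using right[of c0 i] F.inc F by (cases "c0 \<le> c") auto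
          then show ?thesis using il True F by (cases "Suc i = l") auto
        next
          case False
          then have v: "v \<in> L (r, c0)" using H F by auto
          show ?thesis
          proof (cases "u = Suc i")
            case True
            then show ?thesis using lmax[of i c0 v] iL v F H(3) by simp
          next
            case F2: False
            then show ?thesis using lmax[of u c0 v] v F H by auto
          qed
        qed
      next
        case False
        then show ?thesis using H lmax[of u c' v] by (auto split: if_splits)
      qed
    qed
  qed
  \<comment> \<open>A new \<open>Suc i\<close> before the target exceeds \<open>l\<close> only if
    \<open>i = l\<close>, which is \<open>E2\<close>.\<close>
  moreover have "v \<le> l" if "c' < ct" "v \<in> ents F.L' F.A' (Suc r, c')" for c' v
  proof (cases "v \<in> ents L A (Suc r, c')")
    case True
    then show ?thesis using before(2)[OF that(1)] by blast
  next
    case False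
    then have v: "v = Suc i" "(Suc r, c') = (r0, c0)" "\<not> F.M"
      using F.ents_f[of "(Suc r, c')"] that(2) by (auto split: if_splits)
    have "i \<le> l" using before(2)[OF that(1), of i] F.inc v by simp
    moreover have "l \<noteq> i" using n2 v that by auto
    ultimately show ?thesis using v by simp
  qed
  moreover have "F.L' (Suc r, ct) = {} \<or> (\<exists>v\<in>ents F.L' F.A' (Suc r, ct). l < v)"
  proof (cases "L (Suc r, ct) = {}")
    case True
    then show ?thesis using F.L'_nonempty[of "(Suc r, ct)"] by simp
  next
    case False
    then obtain v where v: "v \<in> ents L A (Suc r, ct)" "l < v" using at_ct' by blast
    then show ?thesis using F.ents_f_rev[OF v(1)] by (auto intro: less_SucI)
  qed
  moreover have "F.L' (Suc r, c') \<noteq> {}" if "c' < ct" for c'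
    using before(1)[OF that] F.L'_nonempty by simp
  ultimately show ?thesis
    by (intro bump.intro filling.intro bump_axioms.intro) (use F.semistd_f in blast)+
qed

end

section \<open>Commutation with a bump: the generic case\<close>

lemma mset_swap1:
  assumes "k \<in># X" "i \<in># X" "k = i \<longrightarrow> 2 \<le> count X i"
  shows "add_mset l (X - {#k#}) - {#i#} = add_mset l (X - {#i#} - {#k#})"
proof (rule multiset_eqI)
  fix v
  have "0 < count X k" "0 < count X i" using assms by simp_all
  then show "count (add_mset l (X - {#k#}) - {#i#}) v = count (add_mset l (X - {#i#} - {#k#})) v"
    using assms(3) by (cases "v = k"; cases "v = i"; cases "v = l") auto
qed

lemma mset_swap2:
  assumes "k \<in># X"
  shows "add_mset s (add_mset l (X - {#k#})) = add_mset l (add_mset s X - {#k#})"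
proof (rule multiset_eqI)
  fix v
  have "0 < count X k" using assms by simp
  then show "count (add_mset s (add_mset l (X - {#k#}))) v = count (add_mset l (add_mset s X - {#k#})) v"
    by (cases "v = k"; cases "v = s"; cases "v = l") auto
qed

lemma mset_swap3:
  assumes "k \<in># X" "i \<in># X" "k = i \<longrightarrow> 2 \<le> count X i"
  shows "add_mset s (add_mset l (X - {#k#}) - {#i#}) = add_mset l (add_mset s (X - {#i#}) - {#k#})"
proof -
  have "k \<in># X - {#i#}" using assms by (auto simp: in_diff_count)
  then show ?thesis unfolding mset_swap1[OF assms] by (rule mset_swap2)
qed

context bump_f
begin

text \<open>Applying \<open>f\<close> may change the entry to be bumped and its target column, but not its row.\<close>

definition comm where
  "comm \<longleftrightarrow> (\<exists>c' l' ct' r1 c1. bump F.L' F.A' r c' l' ct' \<and> first_max SL SA i c1 \<and> i \<in> ents SL SA (r1, c1) \<and>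
     f_legs i SL SA r1 c1 = bump_legs F.L' F.A' r c' l' ct' \<and> f_arms i SL SA r1 c1 = bump_arms F.L' F.A' r c' l' ct')"

lemma commI: "bump F.L' F.A' r c' l' ct' \<Longrightarrow> first_max SL SA i c1 \<Longrightarrow> i \<in> ents SL SA (r1, c1) \<Longrightarrow>
     f_legs i SL SA r1 c1 = bump_legs F.L' F.A' r c' l' ct' \<Longrightarrow> f_arms i SL SA r1 c1 = bump_arms F.L' F.A' r c' l' ct' \<Longrightarrow> comm"
  unfolding comm_def by blast

text \<open>By \<open>peak_i_nosuc\<close> the peak of \<open>ct\<close> is then strictly below that
  of \<open>c\<close>, so f_i does not act in \<open>ct\<close>.\<close>

lemma no_X: "\<not> (l = i \<and> (r0, c0) = (Suc r, ct) \<and> Suc i \<notin> ents L A (Suc r, ct))"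
proof
  assume H: "l = i \<and> (r0, c0) = (Suc r, ct) \<and> Suc i \<notin> ents L A (Suc r, ct)"
  have "ct \<noteq> c" using F.i_row[of r] linE H by auto
  then have ctc: "ct < c" using ct_le by simp
  have "peak L A i ct + 1 \<le> peak L A i c - arm_count A i c"
    using peak_i_nosuc(2)[OF ctc, of i ct] H ctc by auto
  then have "peak L A i ct < peak L A i c" using arm_count_ge0[of A i c] by linarith
  then show False using fm(3)[of c] H by simp
qed

text \<open>Changes of arms do not affect the hook, and (S) does not reach row \<open>r + 1\<close>.
  A raised hook matters only if it equals \<open>l\<close>; this is the excluded case, treated in
  \<open>comm_hook\<close>.\<close>

lemma same_hk:
  assumes "\<not> (l = i \<and> \<not> hk \<and> (r0, c0) = (Suc r, ct) \<and> \<not> F.M \<and> \<not> F.S \<and> i \<notin># A (r0, c0))"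
  shows "hook_above F.L' r l ct \<longleftrightarrow> hk"
proof -
  consider (M) F.M | (S) "\<not> F.M" F.S | (Na) "\<not> F.M" "\<not> F.S" "i \<in># A (r0, c0)" | (Nl) "\<not> F.M" "\<not> F.S" "i \<notin># A (r0, c0)" by blast
  then show ?thesis
  proof cases
    case M show ?thesis unfolding F.upd_M(1)[OF M] ..
  next
    case Na show ?thesis unfolding F.upd_Na(1)[OF Na] ..
  next
    case S show ?thesis using S_row[OF S] unfolding F.upd_S(1)[OF S] by (auto simp: hook_above_def)
  next
    case Nl
    show ?thesis
    proof (cases "(r0, c0) = (Suc r, ct)")
      case True
      have iL: "i \<in> L (Suc r, ct)" using F.leg_i[OF Nl(3)] True by simp
      have "w = i" if "w \<in> L (Suc r, ct)" for w using top[OF lessI that iL] .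
      then have Li: "L (Suc r, ct) = {i}" using iL by blast
      then have "F.L' (Suc r, ct) = {Suc i}" unfolding F.upd_Nl(1)[OF Nl] using True by simp
      moreover have "l \<noteq> i \<or> hk" using assms Nl True by blast
      ultimately show ?thesis using Li by (auto simp: hook_above_def)
    next
      case False
      then have "F.L' (Suc r, ct) = L (Suc r, ct)" unfolding F.upd_Nl(1)[OF Nl] by auto
      then show ?thesis by (simp add: hook_above_def)
    qed
  qed
qed

text \<open>\<open>k\<close> could stop being the next greater entry by losing its last copy, which
  is the excluded case (in (M) a second copy exists), or by a new \<open>Suc i\<close> between
  \<open>l\<close> and \<open>k\<close>. The latter would need \<open>l = i\<close> with no
  \<open>Suc i\<close> in the target, against \<open>no_X\<close>.\<close>

lemma same_next_greater:
  assumes nh: "\<not> hk"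
    and n: "\<not> (\<not> F.M \<and> \<not> F.S \<and> (r0, c0) = (Suc r, ct) \<and> k = i \<and> count (A (r0, c0)) i = 1)"
  shows "next_greater l (F.A' (Suc r, ct)) = k"
proof (rule next_greater_eqI)
  note k = nhk(2-5)[OF nh]
  obtain h where h: "L (Suc r, ct) = {h}" "h \<le> l" using k(4) by auto
  show "l < k" by fact
  consider (M) F.M | (S) "\<not> F.M" F.S | (Na) "\<not> F.M" "\<not> F.S" "i \<in># A (r0, c0)" | (Nl) "\<not> F.M" "\<not> F.S" "i \<notin># A (r0, c0)" by blast
  then have "k \<in># F.A' (Suc r, ct) \<and> (\<forall>w. w \<in># F.A' (Suc r, ct) \<longrightarrow> l < w \<longrightarrow> k \<le> w)"
  proof cases
    case M
    have 1: "k \<in># A (Suc r, ct) - {#i#}" if "(r0, c0) = (Suc r, ct)"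
    proof (cases "k = i")
      case True
      then have "i \<notin> L (r0, c0)" using h k(2) that by auto
      then show ?thesis using F.M_arm(3)[OF M] True that by (simp add: in_diff_count)
    next
      case False
      then show ?thesis using k(1) by (simp add: in_diff_count)
    qed
    have 2: "Suc i \<le> l" if "(Suc r0, c0) = (Suc r, ct)"
      using F.M_arm(2)[OF M] h that by auto
    show ?thesis unfolding F.upd_M(2)[OF M] using 1 2 k(1,3) by (auto dest: in_diffD)
  next
    case S
    then show ?thesis unfolding F.upd_S(2)[OF S] using k by auto
  next
    case Nl
    then show ?thesis unfolding F.upd_Nl(2)[OF Nl] using k by auto
  next
    case Na
    show ?thesis
    proof (cases "(r0, c0) = (Suc r, ct)")
      case True
      have iA: "i \<in># A (Suc r, ct)" using Na True by simp
      have 1: "k \<in># A (Suc r, ct) - {#i#}"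
      proof (cases "k = i")
        case ki: True
        have "0 < count (A (Suc r, ct)) i" using iA by simp
        moreover have "count (A (Suc r, ct)) i \<noteq> 1" using n Na True ki by auto
        ultimately have "1 < count (A (Suc r, ct)) i" by linarith
        then show ?thesis using ki by (simp add: in_diff_count)
      qed (use k(1) in \<open>simp add: in_diff_count\<close>)
      have 2: "k \<le> Suc i" if "l < Suc i"
      proof (cases "l = i")
        case li: True
        have "Suc i \<in> ents L A (Suc r, ct)" using no_X li True by blast
        then have "Suc i \<in># A (Suc r, ct)" using h li by (auto simp: ents_def)
        then show ?thesis using k(3)[of "Suc i"] that by simp
      next
        case False
        then show ?thesis using k(3)[OF iA] that by simp
      qed
      show ?thesis unfolding F.upd_Na(2)[OF Na] using True 1 2 k(3) by (auto dest: in_diffD)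
    next
      case False
      then have "F.A' (Suc r, ct) = A (Suc r, ct)" unfolding F.upd_Na(2)[OF Na] by auto
      then show ?thesis using k by simp
    qed
  qed
  then show "k \<in># F.A' (Suc r, ct)" "\<And>w. w \<in># F.A' (Suc r, ct) \<Longrightarrow> l < w \<Longrightarrow> k \<le> w" by blast+
qed

context
  assumes hk': "hook_above F.L' r l ct \<longleftrightarrow> hk" and nxt': "\<not> hk \<longrightarrow> next_greater l (F.A' (Suc r, ct)) = k"
begin

lemma bump_legs_same: "bump_legs F.L' F.A' r c l ct = F.L'((r, c) := F.L' (r, c) - {l}, (Suc r, ct) := insert ins (F.L' (Suc r, ct)))"
  unfolding bump_legs_def hk' using nxt' by (simp add: ins_def)

lemma bump_arms_c: assumes "ct = c" shows "bump_arms F.L' F.A' r c l ct = F.A'((r, c) := filter_mset (\<lambda>z. z < l) (F.A' (r, c)),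
    (Suc r, c) := F.A' (Suc r, c) + filter_mset (\<lambda>z. l \<le> z) (F.A' (r, c)))"
  unfolding bump_arms_def hk' using ct_c_hk[OF assms] assms by simp

lemma bump_arms_h: assumes hk "ct \<noteq> c" shows "bump_arms F.L' F.A' r c l ct = F.A'"
  unfolding bump_arms_def hk' using assms by (simp only: if_True if_False)

lemma bump_arms_a: assumes "\<not> hk" shows "bump_arms F.L' F.A' r c l ct = F.A'((Suc r, ct) := add_mset l (F.A' (Suc r, ct) - {#k#}))"
  unfolding bump_arms_def hk' nxt'[rule_format, OF assms] using assms by (simp only: if_False)

lemma bump_arms_same_arms: assumes "F.A' = A" shows "bump_arms F.L' F.A' r c l ct = SA"
proof (cases "ct = c")
  case True
  show ?thesis unfolding bump_arms_c[OF True] unfolding SA_hk_c[OF True] assms ..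
next
  case ne: False
  show ?thesis
  proof (cases hk)
    case True
    show ?thesis unfolding bump_arms_h[OF True ne] unfolding SA_hk[OF True ne] assms ..
  next
    case False
    show ?thesis unfolding bump_arms_a[OF False] unfolding SA_nhk[OF False] assms ..
  qed
qed

end

text \<open>If the tests of f_i at \<open>(r0, c0)\<close> come out the same before and after the
  bump, both orders perform the same updates and only shared cells need care. The premises on the
  tests also exclude the exceptions of \<open>same_hk\<close> and
  \<open>same_next_greater\<close>.\<close>

lemma comm_generic:
  assumes fmS: "first_max SL SA i c0" and gi: "i \<in> ents SL SA (r0, c0)"
    and gM: "Suc i \<in> ents SL SA (Suc r0, c0) \<longleftrightarrow> F.M"
    and gS: "\<not> F.M \<Longrightarrow> i \<in> SL (r0, Suc c0) \<longleftrightarrow> F.S"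
    and gA: "\<not> F.M \<Longrightarrow> \<not> F.S \<Longrightarrow> i \<in># SA (r0, c0) \<longleftrightarrow> i \<in># A (r0, c0)"
    and E: "\<not> E1" "\<not> E2" "\<not> E3"
  shows comm
proof -
  have hk': "hook_above F.L' r l ct \<longleftrightarrow> hk"
  proof (rule same_hk, rule notI, elim conjE)
    assume H: "l = i" "\<not> hk" "(r0, c0) = (Suc r, ct)" "\<not> F.M" "\<not> F.S" "i \<notin># A (r0, c0)"
    have "i \<in># SA (r0, c0)" unfolding SA_nhk[OF H(2)] using H(1,3) by simp
    then show False using gA H by blast
  qed
  have nxt': "next_greater l (F.A' (Suc r, ct)) = k" if nh: "\<not> hk"
  proof (rule same_next_greater[OF nh], rule notI, elim conjE)
    assume H: "\<not> F.M" "\<not> F.S" "(r0, c0) = (Suc r, ct)" "k = i" "count (A (r0, c0)) i = 1"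
    have "i \<notin># A (r0, c0) - {#i#}" using H(5) by (simp add: in_diff_count)
    moreover have "l \<noteq> i" using nhk(3)[OF nh] H(4) by simp
    ultimately have "i \<notin># SA (r0, c0)" unfolding SA_nhk[OF nh] using H(3,4) by auto
    then have "i \<notin># A (r0, c0)" using gA[OF H(1,2)] by simp
    then show False using H(5) by (simp add: count_eq_zero_iff[symmetric])
  qed
  then have nxt': "\<not> hk \<longrightarrow> next_greater l (F.A' (Suc r, ct)) = k" by blast
  note same = bump_legs_same[OF hk' nxt'] bump_arms_c[OF hk' nxt'] bump_arms_h[OF hk' nxt'] bump_arms_a[OF hk' nxt']
  note bLs = bump_legs_same[OF hk' nxt'] and bAs = bump_arms_same_arms[OF hk' nxt']
  consider (M) F.M | (S) "\<not> F.M" F.S | (Na) "\<not> F.M" "\<not> F.S" "i \<in># A (r0, c0)" | (Nl) "\<not> F.M" "\<not> F.S" "i \<notin># A (r0, c0)" by blast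
  then have "f_legs i SL SA r0 c0 = bump_legs F.L' F.A' r c l ct \<and> f_arms i SL SA r0 c0 = bump_arms F.L' F.A' r c l ct"
  proof cases
    case M
    have c1: "Suc i \<in> ents SL SA (Suc r0, c0)" using gM M by blast
    have "f_legs i SL SA r0 c0 = SL" using c1 by (simp add: f_legs_def)
    also have "SL = bump_legs F.L' F.A' r c l ct" unfolding bLs unfolding F.upd_M(1)[OF M] SL_eq by simp
    finally have 1: "f_legs i SL SA r0 c0 = bump_legs F.L' F.A' r c l ct" by simp
    have iA: "0 < count (A (r0, c0)) i" using F.M_arm(1)[OF M] by simp
    have 2: "f_arms i SL SA r0 c0 = SA((r0, c0) := SA (r0, c0) - {#i#}, (Suc r0, c0) := add_mset (Suc i) (SA (Suc r0, c0)))"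
      using c1 by (simp add: f_arms_def)
    have "\<dots> = bump_arms F.L' F.A' r c l ct"
    proof (cases rule: bump_cases)
      case c
      \<comment> \<open>An \<open>i\<close> not less than \<open>l\<close> would have left
        \<open>(r, c)\<close> with the vertical bump, against \<open>gi\<close>.\<close>
      have il: "i < l" if "(r0, c0) = (r, c)"
      proof (rule ccontr)
        assume n: "\<not> i < l"
        then have "i \<notin> L (r, c) - {l}" using Lle[of i] by auto
        then have "i \<notin> ents SL SA (r, c)" using n unfolding SL_eq SA_hk_c[OF c(1)] by (simp add: ents_def)
        then show False using gi that by simp
      qed
      \<comment> \<open>The \<open>Suc i\<close> that (M) adds to the arm of \<open>(r, c)\<close>
        must not be carried along: the smaller leg entry \<open>u\<close> separates it from
        \<open>l\<close>.\<close>
      have sl: "Suc i < l" if e: "(Suc r0, c0) = (r, c)"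
      proof -
        obtain u where u: "u \<in> L (r, c)" "u < l" using leg by auto
        have "i < u" using semistd_col[OF semistd lessI F.inc leg_ents, of u] u e by simp
        then show ?thesis using u by simp
      qed
      show ?thesis unfolding same(2)[OF c(1)]
        unfolding SA_hk_c[OF c(1)] F.upd_M(2)[OF M]
      proof (rule ext, rule multiset_eqI)
        fix x v
        show "count (((A((r, c) := {#z \<in># A (r, c). z < l#}, (Suc r, c) := A (Suc r, c) + filter_mset ((\<le>) l) (A (r, c))))
          ((r0, c0) := (A((r, c) := {#z \<in># A (r, c). z < l#}, (Suc r, c) := A (Suc r, c) + filter_mset ((\<le>) l) (A (r, c)))) (r0, c0) - {#i#},
           (Suc r0, c0) := add_mset (Suc i) ((A((r, c) := {#z \<in># A (r, c). z < l#}, (Suc r, c) := A (Suc r, c) + filter_mset ((\<le>) l) (A (r, c)))) (Suc r0, c0)))) x) v =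
          count (((A((r0, c0) := A (r0, c0) - {#i#}, (Suc r0, c0) := add_mset (Suc i) (A (Suc r0, c0))))
           ((r, c) := {#z \<in># (A((r0, c0) := A (r0, c0) - {#i#}, (Suc r0, c0) := add_mset (Suc i) (A (Suc r0, c0)))) (r, c). z < l#},
           (Suc r, c) := (A((r0, c0) := A (r0, c0) - {#i#}, (Suc r0, c0) := add_mset (Suc i) (A (Suc r0, c0)))) (Suc r, c) +
            filter_mset ((\<le>) l) ((A((r0, c0) := A (r0, c0) - {#i#}, (Suc r0, c0) := add_mset (Suc i) (A (Suc r0, c0)))) (r, c)))) x) v"
          using iA il sl by (auto simp: Suc_diff_le)
      qed
    next
      case h
      then have n: "ct \<noteq> c" by simp
      show ?thesis unfolding same(3)[OF h(2) n] unfolding SA_hk[OF h(2) n] F.upd_M(2)[OF M] ..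
    next
      case a
      note k = nhk(2)[OF a(2)]
      show ?thesis unfolding same(4)[OF a(2)] unfolding SA_nhk[OF a(2)] F.upd_M(2)[OF M]
      proof (cases "(r0, c0) = (Suc r, ct)")
        case True
        have "k = i \<longrightarrow> 2 \<le> count (A (Suc r, ct)) i"
          using nhk(6)[OF a(2)] F.M_arm(3)[OF M] True by auto
        then have "add_mset l (A (Suc r, ct) - {#k#}) - {#i#} = add_mset l (A (Suc r, ct) - {#i#} - {#k#})"
          using k F.M_arm(1)[OF M] True by (intro mset_swap1) simp_all
        then show "(A((Suc r, ct) := add_mset l (A (Suc r, ct) - {#k#})))
          ((r0, c0) := (A((Suc r, ct) := add_mset l (A (Suc r, ct) - {#k#}))) (r0, c0) - {#i#},
           (Suc r0, c0) := add_mset (Suc i) ((A((Suc r, ct) := add_mset l (A (Suc r, ct) - {#k#}))) (Suc r0, c0))) =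
          (A((r0, c0) := A (r0, c0) - {#i#}, (Suc r0, c0) := add_mset (Suc i) (A (Suc r0, c0))))
          ((Suc r, ct) := add_mset l ((A((r0, c0) := A (r0, c0) - {#i#}, (Suc r0, c0) := add_mset (Suc i) (A (Suc r0, c0)))) (Suc r, ct) - {#k#}))"
          using True by (intro ext) auto
      next
        case False
        then show "(A((Suc r, ct) := add_mset l (A (Suc r, ct) - {#k#})))
          ((r0, c0) := (A((Suc r, ct) := add_mset l (A (Suc r, ct) - {#k#}))) (r0, c0) - {#i#},
           (Suc r0, c0) := add_mset (Suc i) ((A((Suc r, ct) := add_mset l (A (Suc r, ct) - {#k#}))) (Suc r0, c0))) =
          (A((r0, c0) := A (r0, c0) - {#i#}, (Suc r0, c0) := add_mset (Suc i) (A (Suc r0, c0))))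
          ((Suc r, ct) := add_mset l ((A((r0, c0) := A (r0, c0) - {#i#}, (Suc r0, c0) := add_mset (Suc i) (A (Suc r0, c0)))) (Suc r, ct) - {#k#}))"
          using mset_swap2[OF k, of "Suc i" l] by (intro ext) auto
      qed
    qed
    then show ?thesis using 1 2 by simp
  next
    case S
    have c1: "Suc i \<notin> ents SL SA (Suc r0, c0)" and c2: "i \<in> SL (r0, Suc c0)" using gM gS S by blast+
    have "f_arms i SL SA r0 c0 = SA" using c1 c2 by (simp add: f_arms_def)
    also have "\<dots> = bump_arms F.L' F.A' r c l ct" using bAs[OF F.upd_S(2)[OF S]] by simp
    finally have 1: "f_arms i SL SA r0 c0 = bump_arms F.L' F.A' r c l ct" .
    have "f_legs i SL SA r0 c0 = SL((r0, Suc c0) := SL (r0, Suc c0) - {i}, (r0, c0) := insert (Suc i) (SL (r0, c0)))"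
      using c1 c2 by (simp add: f_legs_def)
    also have "\<dots> = bump_legs F.L' F.A' r c l ct" unfolding bLs unfolding F.upd_S(1)[OF S] SL_eq
      using S_row[OF S] F.S_nosuc[OF S, of r] linE by (intro ext) auto
    finally show ?thesis using 1 by simp
  next
    case Na
    have c1: "Suc i \<notin> ents SL SA (Suc r0, c0)" and c2: "i \<notin> SL (r0, Suc c0)" and c3: "i \<in># SA (r0, c0)"
      using gM gS gA Na by blast+
    have "f_legs i SL SA r0 c0 = SL" using c1 c2 c3 by (simp add: f_legs_def)
    also have "SL = bump_legs F.L' F.A' r c l ct" unfolding bLs unfolding F.upd_Na(1)[OF Na] SL_eq by simp
    finally have 1: "f_legs i SL SA r0 c0 = bump_legs F.L' F.A' r c l ct" by simp
    have iA: "0 < count (A (r0, c0)) i" using Na(3) by simp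
    have 2: "f_arms i SL SA r0 c0 = SA((r0, c0) := add_mset (Suc i) (SA (r0, c0) - {#i#}))"
      using c1 c2 c3 by (simp add: f_arms_def)
    have "\<dots> = bump_arms F.L' F.A' r c l ct"
    proof (cases rule: bump_cases)
      case c
      \<comment> \<open>The raised entry must stay below \<open>l\<close>. If it were
        \<open>l\<close>, the bump would place a \<open>Suc i\<close> above and turn (N) into
        (M).\<close>
      have il: "Suc i < l" if "(r0, c0) = (r, c)"
      proof -
        have "i < l" using c3 that unfolding SA_hk_c[OF c(1)] by auto
        moreover have "l \<in> SL (Suc r, c)" unfolding SL_eq ins_hk[OF c(2)] using c(1) by simp
        then have "l \<noteq> Suc i" using c1 that by (auto simp: ents_def)
        ultimately show ?thesis by simp
      qed
      show ?thesis unfolding same(2)[OF c(1)] unfolding SA_hk_c[OF c(1)] F.upd_Na(2)[OF Na]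
        using iA il by (intro ext multiset_eqI) (auto simp: Suc_diff_le)
    next
      case h
      then have n: "ct \<noteq> c" by simp
      show ?thesis unfolding same(3)[OF h(2) n] unfolding SA_hk[OF h(2) n] F.upd_Na(2)[OF Na] ..
    next
      case a
      note k = nhk(2,3)[OF a(2)]
      have "2 \<le> count (A (Suc r, ct)) i" if "(r0, c0) = (Suc r, ct)" "k = i"
        using c3 that k(2) unfolding SA_nhk[OF a(2)] by (auto simp: in_diff_count)
      then have "add_mset (Suc i) (add_mset l (A (Suc r, ct) - {#k#}) - {#i#}) =
          add_mset l (add_mset (Suc i) (A (Suc r, ct) - {#i#}) - {#k#})" if "(r0, c0) = (Suc r, ct)"
        using k Na(3) that by (intro mset_swap3) auto
      then show ?thesis unfolding same(4)[OF a(2)] unfolding SA_nhk[OF a(2)] F.upd_Na(2)[OF Na]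
        by (cases "(r0, c0) = (Suc r, ct)"; intro ext) auto
    qed
    then show ?thesis using 1 2 by simp
  next
    case Nl
    have c1: "Suc i \<notin> ents SL SA (Suc r0, c0)" and c2: "i \<notin> SL (r0, Suc c0)" and c3: "i \<notin># SA (r0, c0)"
      using gM gS gA Nl by blast+
    have "f_arms i SL SA r0 c0 = SA" using c1 c2 c3 by (simp add: f_arms_def)
    also have "\<dots> = bump_arms F.L' F.A' r c l ct" using bAs[OF F.upd_Nl(2)[OF Nl]] by simp
    finally have 1: "f_arms i SL SA r0 c0 = bump_arms F.L' F.A' r c l ct" .
    \<comment> \<open>Replacing \<open>i\<close> in the target must not delete the entry that the
      bump inserts there.\<close>
    have ins: "ins \<noteq> i" if "(r0, c0) = (Suc r, ct)"
    proof (cases hk)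
      case True
      then show ?thesis using hk_above[OF True, of i] F.inc that by (auto simp: ins_def)
    next
      case False
      then show ?thesis using nhk(2)[OF False] Nl(3) that by (auto simp: ins_def)
    qed
    have "f_legs i SL SA r0 c0 = SL((r0, c0) := insert (Suc i) (SL (r0, c0) - {i}))"
      using c1 c2 c3 by (simp add: f_legs_def)
    also have "\<dots> = bump_legs F.L' F.A' r c l ct" unfolding bLs unfolding F.upd_Nl(1)[OF Nl] SL_eq
      using ins F.leg_no_suc[OF Nl(3), of r] lin by (intro ext) auto
    finally show ?thesis using 1 by simp
  qed
  then show comm using commI[OF bump_gen[OF E] fmS gi] by blast
qed

end

section \<open>Commutation with a bump: the interfering positions\<close>

lemma filter_mset_all: "(\<And>v. v \<in># X \<Longrightarrow> P v) \<Longrightarrow> filter_mset P X = X"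
  using filter_mset_cong[of X X P "\<lambda>_. True"] by simp

context bump
begin

lemma eSA: "v \<in># SA x \<Longrightarrow> v \<in> ents SL SA x" and eSL: "v \<in> SL x \<Longrightarrow> v \<in> ents SL SA x"
  by (auto simp: ents_def)

lemma ents_S_rev: assumes "v \<in> ents L A x"
  shows "v \<in> ents SL SA x \<or> x = (r, c) \<and> (v = l \<and> v \<notin># A (r, c) \<or> ct = c \<and> l \<le> v)"
proof (cases rule: bump_cases)
  case c
  show ?thesis using assms unfolding SL_eq SA_hk_c[OF c(1)] using c(1) by (auto simp: ents_def)
next
  case h
  then have ne: "ct \<noteq> c" by simp
  show ?thesis using assms unfolding SL_eq SA_hk[OF h(2) ne] by (auto simp: ents_def)
next
  case a
  show ?thesis using assms unfolding SL_eq SA_nhk[OF a(2)] ins_nhk[OF a(2)] using a(1)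
    by (auto simp: ents_def in_diff_count)
qed

lemma SA_sub: assumes "v \<in># SA x"
  shows "v \<in># A x \<or> x = (Suc r, ct) \<and> (\<not> hk \<and> v = l \<or> ct = c \<and> v \<in># A (r, c) \<and> l \<le> v)"
proof (cases rule: bump_cases)
  case c
  show ?thesis using assms unfolding SA_hk_c[OF c(1)] using c(1) by (auto split: if_splits)
next
  case h
  then have ne: "ct \<noteq> c" by simp
  show ?thesis using assms unfolding SA_hk[OF h(2) ne] by simp
next
  case a
  show ?thesis using assms a(2) unfolding SA_nhk[OF a(2)] by (auto split: if_splits dest: in_diffD)
qed

lemma SA_rev: assumes "v \<in># A x"
  shows "v \<in># SA x \<or> x = (r, c) \<and> ct = c \<and> l \<le> v \<or> x = (Suc r, ct) \<and> \<not> hk \<and> v = k \<and> count (A x) v = 1"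
proof (cases rule: bump_cases)
  case c
  show ?thesis using assms unfolding SA_hk_c[OF c(1)] using c(1) by auto
next
  case h
  then have ne: "ct \<noteq> c" by simp
  show ?thesis using assms unfolding SA_hk[OF h(2) ne] by simp
next
  case a
  have "0 < count (A x) v" using assms by simp
  then have "count (A x) v = 1 \<or> 1 < count (A x) v" by linarith
  then show ?thesis using assms a(2) unfolding SA_nhk[OF a(2)] by (auto simp: in_diff_count)
qed

lemma SL_sub: "v \<in> SL x \<Longrightarrow> v \<in> L x \<or> x = (Suc r, ct) \<and> v = ins"
  by (auto simp: SL_eq split: if_splits)

lemma ents_S_sub: assumes "v \<in> ents SL SA x"
  shows "v \<in> ents L A x \<or> x = (Suc r, ct) \<and> (v = l \<or> ct = c \<and> v \<in># A (r, c) \<and> l \<le> v)"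
proof -
  have "ins = l \<or> ins \<in># A (Suc r, ct)" using nhk(2) by (cases hk) (auto simp: ins_def)
  then show ?thesis using assms SA_sub[of v x] SL_sub[of v x] by (auto simp: ents_def)
qed

end

text \<open>The arm entry \<open>i\<close> is carried from \<open>(r, c)\<close> to
  \<open>(r + 1, c)\<close>. If f_i comes first, \<open>Suc i\<close> reaches the upper arm either
  through (M) or with the bump; if the bump comes first, f_i raises the entry in the upper arm by
  (N).\<close>

lemma comm_moved:
  assumes "bump_f L A r c l c i r c" "l \<le> i" "i \<in># A (r, c)"
  shows "bump_f.comm L A r c l c i r c"
proof -
  interpret bump_f L A r c l c i r c by fact
  have hk: hk using ct_c_hk by simp
  have nS: "\<not> F.S" if "\<not> F.M" using S_leg[OF that] assms(2) by force
  have E: "\<not> E1" "\<not> E2" "\<not> E3" using assms nS by auto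
  have hk': "hook_above F.L' r l c \<longleftrightarrow> hk" by (rule same_hk) (use hk in blast)
  have nxt': "\<not> hk \<longrightarrow> next_greater l (F.A' (Suc r, c)) = k" using hk by blast
  note SA = SA_hk_c[OF refl] and bump_legs = bump_legs_same[OF hk' nxt'] and bump_arms = bump_arms_c[OF hk' nxt' refl]
  have c1: "Suc i \<notin> ents SL SA (Suc (Suc r), c)"
    using semistd_suc_row[OF semistd F.inc, of "Suc (Suc r)"] unfolding SL_eq SA by (auto simp: ents_def)
  have c2: "i \<notin> SL (Suc r, Suc c)"
    using semistd_less[OF semistd lessI _ F.inc leg_ents, of "Suc c" i] unfolding SL_eq by auto
  have c3: "i \<in># SA (Suc r, c)" unfolding SA using assms by simp
  have "i \<in># filter_mset (\<lambda>z. l \<le> z) (A (r, c))" using assms by simp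
  note mv = diff_union_single_conv[OF this]
  have 1: "f_legs i SL SA (Suc r) c = SL" using c1 c2 c3 by (simp add: f_legs_def)
  have 2: "f_arms i SL SA (Suc r) c = SA((Suc r, c) := add_mset (Suc i) (SA (Suc r, c) - {#i#}))"
    using c1 c2 c3 by (simp add: f_arms_def)
  consider (M) F.M | (Na) "\<not> F.M" "\<not> F.S" "i \<in># A (r, c)" using nS assms by blast
  then have "SL = bump_legs F.L' F.A' r c l c \<and> SA((Suc r, c) := add_mset (Suc i) (SA (Suc r, c) - {#i#})) = bump_arms F.L' F.A' r c l c"
  proof cases
    case M
    show ?thesis unfolding bump_legs bump_arms unfolding F.upd_M[OF M] SL_eq SA ins_hk[OF hk]
      using assms(2) mv by (auto intro!: ext)
  next
    case Na
    show ?thesis unfolding bump_legs bump_arms unfolding F.upd_Na[OF Na] SL_eq SA ins_hk[OF hk]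
      using assms(2) mv by (auto intro!: ext)
  qed
  then show comm using 1 2 commI[OF bump_gen[OF E] colC[OF E(1,3)] eSA[OF c3]] by simp
qed

text \<open>\<open>k = i\<close> is the only \<open>i\<close> in the target's arm. If the bump comes
  first, \<open>i\<close> enters the leg and is raised there; if f_i comes first,
  \<open>Suc i\<close> is the next entry above \<open>l\<close> and enters the leg.\<close>

lemma comm_single:
  assumes "bump_f L A r c l ct i (Suc r) ct" "l < i" "\<not> hook_above L r l ct" "next_greater l (A (Suc r, ct)) = i"
    "count (A (Suc r, ct)) i = 1"
  shows "bump_f.comm L A r c l ct i (Suc r) ct"
proof -
  interpret bump_f L A r c l ct i "Suc r" ct by fact
  have nh: "\<not> hk" by fact
  have k: "k = i" using assms by (simp add: k_def)
  note n = nhk[OF nh]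
  have iL: "i \<notin> L (Suc r, ct)" using n(6) k by simp
  have iA: "i \<in># A (Suc r, ct)" using n(2) k by simp
  have no: "i \<notin># A (Suc r, ct) - {#i#}" using assms(5) by (simp add: in_diff_count)
  have nM: "\<not> F.M" using F.M_arm(3) iL assms(5) by auto
  have nS: "\<not> F.S" using S_row[OF nM] by auto
  have E: "\<not> E1" "\<not> E2" "\<not> E3" using assms(2) nS by auto
  note Na = nM nS iA
  have hk': "\<not> hook_above F.L' r l ct" using nh unfolding F.upd_Na(1)[OF Na] .
  have nxt': "next_greater l (F.A' (Suc r, ct)) = Suc i" unfolding F.upd_Na(2)[OF Na]
  proof (rule next_greater_eqI)
    show "Suc i \<le> w" if "w \<in># (A((Suc r, ct) := add_mset (Suc i) (A (Suc r, ct) - {#i#}))) (Suc r, ct)" "l < w" for w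
    proof (cases "w = Suc i")
      case False
      then have w: "w \<in># A (Suc r, ct) - {#i#}" using that by simp
      then have "w \<noteq> i" using no by auto
      then show ?thesis using n(4)[OF in_diffD[OF w] that(2)] k by simp
    qed simp
  qed (use assms(2) in simp_all)
  note SA = SA_nhk[OF nh]
  have c1: "Suc i \<notin> ents SL SA (Suc (Suc r), ct)" using nM unfolding SL_eq SA by (auto simp: ents_def)
  have c2: "i \<notin> SL (Suc r, Suc ct)" using nS unfolding SL_eq by auto
  have c3: "i \<notin># SA (Suc r, ct)" unfolding SA k using no assms(2) by simp
  have c4: "i \<in> SL (Suc r, ct)" unfolding SL_eq ins_nhk[OF nh] k by simp
  have "f_legs i SL SA (Suc r) ct = SL((Suc r, ct) := insert (Suc i) (SL (Suc r, ct) - {i}))"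
    using c1 c2 c3 by (simp add: f_legs_def)
  also have "\<dots> = bump_legs F.L' F.A' r c l ct"
    unfolding bump_legs_def nxt' using hk' iL unfolding F.upd_Na(1)[OF Na] SL_eq ins_nhk[OF nh] k by (auto intro!: ext)
  finally have 1: "f_legs i SL SA (Suc r) ct = bump_legs F.L' F.A' r c l ct" .
  have "f_arms i SL SA (Suc r) ct = SA" using c1 c2 c3 by (simp add: f_arms_def)
  also have "\<dots> = bump_arms F.L' F.A' r c l ct"
    unfolding bump_arms_def nxt' using hk' unfolding F.upd_Na[OF Na] SA k by (auto intro!: ext)
  finally show comm using 1 commI[OF bump_gen[OF E] colC[OF E(1,3)]] c4 by (auto simp: ents_def)
qed

text \<open>If f_i comes first, (S) takes \<open>i\<close> out of \<open>(r, Suc d)\<close> and adds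
  \<open>Suc i\<close> to \<open>(r, d)\<close>, from where the bump takes it. If the bump comes
  first, it takes \<open>Suc i\<close> from \<open>(r, Suc d)\<close>, and f_i turns the remaining
  \<open>i\<close> into \<open>Suc i\<close>.\<close>

lemma comm_shift:
  assumes "bump_f L A r (Suc d) (Suc i) ct i r d" "Suc i \<notin> ents L A (Suc r, d)" "i \<in> L (r, Suc d)"
  shows "bump_f.comm L A r (Suc d) (Suc i) ct i r d"
proof -
  interpret bump_f L A r "Suc d" "Suc i" ct i r d by fact
  have S: "\<not> F.M" F.S and E: E3 using assms by auto
  note e = E3_range[OF E]
  have ne: "ct \<noteq> Suc d" using e(1) by simp
  have SA_rc: "SA (r, Suc d) = A (r, Suc d)"
    by (cases hk) (simp_all add: SA_hk ne SA_nhk)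
  have SA_u: "SA (Suc r, Suc d) = A (Suc r, Suc d)"
    using ne by (cases hk) (simp_all add: SA_hk SA_nhk)
  have c1: "Suc i \<notin> ents SL SA (Suc r, Suc d)"
    using above[OF lessI le_refl, of "Suc i"] ne unfolding ents_def SA_u SL_eq by auto
  have c2: "i \<notin> SL (r, Suc (Suc d))" using right[OF lessI leg_ents, of i] unfolding SL_eq by auto
  have c3: "i \<notin># SA (r, Suc d)" unfolding SA_rc using F.S_data(7)[OF S] .
  have c4: "i \<in> SL (r, Suc d)" unfolding SL_eq using S(2) by simp
  note u = F.upd_S[OF S]
  have Ld: "v \<le> i" if "v \<in> ents L A (r, d)" for v using F.S_le[OF S that] .
  have ge: "i \<le> v" if "v \<in> L (r, Suc d)" for v using semistd_row[OF semistd lessI F.inc leg_ents[OF that]] .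
  have row: "F.L' (Suc r, x) = L (Suc r, x)" for x unfolding u by simp
  have rowe: "ents F.L' F.A' (Suc r, x) = ents L A (Suc r, x)" for x unfolding ents_def row unfolding u by simp
  have b: "bump F.L' F.A' r d (Suc i) ct"
  proof (intro bump.intro filling.intro bump_axioms.intro)
    show "semistd F.L' F.A'" by (rule F.semistd_f)
    show "x = y" if "r < r'" "x \<in> F.L' (r', c')" "y \<in> F.L' (r', c')" for r' c' x y
      using top[OF that(1), of x c' y] that unfolding u by auto
    show "Suc i \<in> F.L' (r, d)" unfolding u by simp
    obtain w where "w \<in> L (r, d)" "w \<le> i" using ents_L[OF semistd F.inc] by auto
    then show "\<exists>w\<in>F.L' (r, d). w < Suc i" unfolding u by (auto simp: less_Suc_eq_le)
    show "y < Suc i \<or> y = Suc i \<and> c' \<le> d" if H: "x \<in> F.L' (r, c')" "y \<in> F.L' (r, c')" "x < y" for c' x y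
    proof -
      consider "c' = Suc d" | "c' = d" | "c' \<noteq> d" "c' \<noteq> Suc d" by blast
      then show ?thesis
      proof cases
        case 1
        then have "x \<in> L (r, Suc d)" "x \<noteq> i" "y \<in> L (r, Suc d)" using H unfolding u by auto
        then show ?thesis using ge[of x] Lle[of y] H(3) by simp
      next
        case 2
        then have "y = Suc i \<or> y \<in> L (r, d)" using H unfolding u by auto
        then show ?thesis using Ld[OF leg_ents, of y] 2 by auto
      next
        case 3
        then have "x \<in> L (r, c')" "y \<in> L (r, c')" using H unfolding u by auto
        then show ?thesis using lmax[of x c' y] H(3) 3 by auto
      qed
    qed
    show "F.L' (Suc r, c') \<noteq> {}" if "c' < ct" for c' using before(1)[OF that] row by simp
    show "v \<le> Suc i" if "c' < ct" "v \<in> ents F.L' F.A' (Suc r, c')" for c' v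
      using before(2)[OF that(1), of v] that(2) unfolding rowe .
    show "F.L' (Suc r, ct) = {} \<or> (\<exists>v\<in>ents F.L' F.A' (Suc r, ct). Suc i < v)" using at_ct unfolding row rowe .
  qed
  have hk': "hook_above F.L' r (Suc i) ct \<longleftrightarrow> hk" unfolding hook_above_def row ..
  have nl: "Suc i \<notin> L (r, d)" using Ld[OF leg_ents, of "Suc i"] by auto
  have ni: "Suc i \<in> L (r, Suc d)" using lin .
  have "f_legs i SL SA r (Suc d) = SL((r, Suc d) := insert (Suc i) (SL (r, Suc d) - {i}))"
    using c1 c2 c3 by (simp add: f_legs_def)
  also have "\<dots> = bump_legs F.L' F.A' r d (Suc i) ct"
    unfolding bump_legs_def hk' unfolding u SL_eq ins_def k_def using nl ni by (intro ext) auto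
  finally have 1: "f_legs i SL SA r (Suc d) = bump_legs F.L' F.A' r d (Suc i) ct" .
  \<comment> \<open>The new bump is vertical if \<open>ct = d\<close>; no entry of
    \<open>(r, d)\<close> reaches \<open>Suc i\<close>, so nothing is carried along.\<close>
  have arms: "filter_mset (\<lambda>z. z < Suc i) (A (r, d)) = A (r, d)" "filter_mset (\<lambda>z. Suc i \<le> z) (A (r, d)) = {#}"
    using Ld[OF arm_ents] by (auto intro!: filter_mset_all simp: less_Suc_eq_le not_le)
  have "f_arms i SL SA r (Suc d) = SA" using c1 c2 c3 by (simp add: f_arms_def)
  also have "\<dots> = bump_arms F.L' F.A' r d (Suc i) ct"
  proof (cases hk)
    case True
    then show ?thesis unfolding bump_arms_def hk' unfolding u SA_hk[OF True ne] arms by (auto intro!: ext)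
  next
    case False
    then show ?thesis unfolding bump_arms_def hk' unfolding u SA_nhk[OF False] k_def by simp
  qed
  finally show comm using 1 commI[OF b colB[OF E]] c4 by (auto simp: ents_def)
qed

text \<open>If f_i comes first, it raises an arm \<open>i\<close> by (N) and the bump carries the
  \<open>Suc i\<close> up. If the bump comes first, its \<open>l = Suc i\<close> stands above, and
  (M) moves the arm entry instead.\<close>

lemma comm_up:
  assumes "bump_f L A r c (Suc i) c i r c"
  shows "bump_f.comm L A r c (Suc i) c i r c"
proof -
  interpret bump_f L A r c "Suc i" c i r c by fact
  have hk: hk using ct_c_hk by simp
  have nM: "\<not> F.M" using above[OF lessI le_refl, of "Suc i"] by auto
  have nS: "\<not> F.S" using F.S_nosuc[OF nM] linE by blast
  have iA: "i \<in># A (r, c)" using F.leg_no_suc lin by blast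
  note Na = nM nS iA
  have E: "\<not> E1" "\<not> E2" "\<not> E3" using nS by auto
  have hk': "hook_above F.L' r (Suc i) c \<longleftrightarrow> hk" by (rule same_hk) (use hk in blast)
  have nxt': "\<not> hk \<longrightarrow> next_greater (Suc i) (F.A' (Suc r, c)) = k" using hk by blast
  note SA = SA_hk_c[OF refl] and bump_legs = bump_legs_same[OF hk' nxt'] and bump_arms = bump_arms_c[OF hk' nxt' refl]
  have c1: "Suc i \<in> ents SL SA (Suc r, c)" unfolding SL_eq ins_hk[OF hk] by (simp add: ents_def)
  have c3: "i \<in># SA (r, c)" unfolding SA using iA by simp
  have "f_legs i SL SA r c = SL" using c1 by (simp add: f_legs_def)
  also have "\<dots> = bump_legs F.L' F.A' r c (Suc i) c" unfolding bump_legs unfolding F.upd_Na[OF Na] SL_eq by simp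
  finally have 1: "f_legs i SL SA r c = bump_legs F.L' F.A' r c (Suc i) c" .
  have "f_arms i SL SA r c = SA((r, c) := SA (r, c) - {#i#}, (Suc r, c) := add_mset (Suc i) (SA (Suc r, c)))"
    using c1 by (simp add: f_arms_def)
  also have "\<dots> = bump_arms F.L' F.A' r c (Suc i) c" unfolding bump_arms unfolding F.upd_Na[OF Na] SA by (intro ext) auto
  finally show comm using 1 commI[OF bump_gen[OF E] colC[OF E(1,3)] eSA[OF c3]] by simp
qed

text \<open>The bumped entry is the \<open>i\<close> to be raised: it is bumped as
  \<open>Suc i\<close>, or bumped as \<open>i\<close> and raised in the target. The target is the
  same because it contains no \<open>Suc i\<close>.\<close>

lemma comm_leg:
  assumes "bump_f L A r c i ct i r c" "Suc i \<notin> ents L A (Suc r, c)" "i \<notin># A (r, c)"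
  shows "bump_f.comm L A r c i ct i r c"
proof -
  interpret bump_f L A r c i ct i r c by fact
  have nM: "\<not> F.M" by fact
  have nS: "\<not> F.S" using S_leg[OF nM] by auto
  have E: E1 using assms by simp
  note ns = E1_nosuc[OF E] and Nl = nM nS assms(3)
  note u = F.upd_Nl[OF Nl]
  have row: "F.L' (Suc r, x) = L (Suc r, x)" for x unfolding u by simp
  have rowe: "ents F.L' F.A' (Suc r, x) = ents L A (Suc r, x)" for x unfolding ents_def row unfolding u by simp
  have b: "bump F.L' F.A' r c (Suc i) ct"
  proof (intro bump.intro filling.intro bump_axioms.intro)
    show "semistd F.L' F.A'" by (rule F.semistd_f)
    show "x = y" if "r < r'" "x \<in> F.L' (r', c')" "y \<in> F.L' (r', c')" for r' c' x y
      using top[OF that(1), of x c' y] that unfolding u by auto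
    show "Suc i \<in> F.L' (r, c)" unfolding u by simp
    show "\<exists>w\<in>F.L' (r, c). w < Suc i" using leg unfolding u by (auto intro: less_SucI)
    show "y < Suc i \<or> y = Suc i \<and> c' \<le> c" if H: "x \<in> F.L' (r, c')" "y \<in> F.L' (r, c')" "x < y" for c' x y
    proof (cases "c' = c")
      case True
      then have "y = Suc i \<or> y \<in> L (r, c)" using H unfolding u by auto
      then show ?thesis using Lle[of y] True by auto
    next
      case False
      then have "x \<in> L (r, c')" "y \<in> L (r, c')" using H unfolding u by auto
      then show ?thesis using lmax[of x c' y] H(3) by auto
    qed
    show "F.L' (Suc r, c') \<noteq> {}" if "c' < ct" for c' using before(1)[OF that] row by simp
    show "v \<le> Suc i" if "c' < ct" "v \<in> ents F.L' F.A' (Suc r, c')" for c' v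
      using before(2)[OF that(1), of v] that(2) unfolding rowe by simp
    have "Suc i < v" if "v \<in> ents L A (Suc r, ct)" "i < v" for v using that ns by (cases "v = Suc i") auto
    then show "F.L' (Suc r, ct) = {} \<or> (\<exists>v\<in>ents F.L' F.A' (Suc r, ct). Suc i < v)" using at_ct unfolding row rowe by blast
  qed
  have ne: "v \<noteq> Suc i" if "v \<in> L (Suc r, ct)" for v using that ns leg_ents by blast
  have hk': "hook_above F.L' r (Suc i) ct \<longleftrightarrow> hk"
    unfolding hook_above_def row by (rule ball_cong[OF refl]) (use ne in \<open>auto intro: Suc_lessI dest: Suc_lessD\<close>)
  have nl: "Suc i \<notin> L (r, c)" using Lle[of "Suc i"] by auto
  have SLo: "SL (Suc r, Suc ct) = L (Suc r, Suc ct)" unfolding SL_eq by simp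
  have c1: "Suc i \<notin> ents SL SA (Suc (Suc r), ct)"
  proof
    assume "Suc i \<in> ents SL SA (Suc (Suc r), ct)"
    then have H: "Suc i \<in> ents L A (Suc (Suc r), ct)" using ents_S_sub[of "Suc i" "(Suc (Suc r), ct)"] by simp
    obtain w where w: "w \<in> ents L A (Suc r, ct)" "i < w" "w \<le> Suc i" using after(1)[OF _ _ _ H] by auto
    have e: "w = Suc i" using w(2,3) by simp
    show False using w(1) ns unfolding e by simp
  qed
  have c2: "i \<notin> SL (Suc r, Suc ct)" using after(2)[OF le_refl _ _ leg_ents, of "Suc ct" i] unfolding SLo by auto
  show comm
  proof (cases hk)
    case True
    have iL: "i \<notin> L (Suc r, ct)" using True by (auto simp: hook_above_def)
    have iA: "i \<notin># A (Suc r, ct)" using hk_above[OF True arm_ents, of i] by auto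
    \<comment> \<open>The arm of \<open>(r, c)\<close> has no \<open>i\<close>, so the thresholds
      \<open>i\<close> and \<open>Suc i\<close> split it in the same way.\<close>
    have arms: "filter_mset (\<lambda>z. z < Suc i) (A (r, c)) = filter_mset (\<lambda>z. z < i) (A (r, c))"
        "filter_mset (\<lambda>z. Suc i \<le> z) (A (r, c)) = filter_mset (\<lambda>z. i \<le> z) (A (r, c))"
      using assms(3) by (auto intro!: filter_mset_cong simp: less_Suc_eq Suc_le_eq le_less)
    have c3: "i \<notin># SA (Suc r, ct)"
    proof (cases "ct = c")
      case t: True
      show ?thesis using iA assms(3) t unfolding SA_hk_c[OF t] by simp
    next
      case False
      show ?thesis using iA unfolding SA_hk[OF True False] .
    qed
    have c4: "i \<in> SL (Suc r, ct)" unfolding SL_eq ins_hk[OF True] by simp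
    have "f_legs i SL SA (Suc r) ct = SL((Suc r, ct) := insert (Suc i) (SL (Suc r, ct) - {i}))"
      using c1 c2 c3 by (simp add: f_legs_def)
    also have "\<dots> = bump_legs F.L' F.A' r c (Suc i) ct"
      unfolding bump_legs_def hk' using True iL nl unfolding u SL_eq ins_hk[OF True] by (intro ext) auto
    finally have 1: "f_legs i SL SA (Suc r) ct = bump_legs F.L' F.A' r c (Suc i) ct" .
    have "f_arms i SL SA (Suc r) ct = SA" using c1 c2 c3 by (simp add: f_arms_def)
    also have "\<dots> = bump_arms F.L' F.A' r c (Suc i) ct"
      unfolding bump_arms_def hk' unfolding u SA_def bump_arms_def arms using True by simp
    finally show comm using 1 commI[OF b colA[OF E]] c4 by (auto simp: ents_def)
  next
    case False
    note n = nhk[OF False]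
    have "k \<noteq> Suc i" using arm_ents[OF n(2)] ns by auto
    then have nx: "next_greater (Suc i) (A (Suc r, ct)) = k"
      using n(2,3) n(4) by (intro next_greater_eqI) (auto intro: Suc_lessD)
    note SA = SA_nhk[OF False]
    have c3: "i \<in># SA (Suc r, ct)" unfolding SA by simp
    have "f_legs i SL SA (Suc r) ct = SL" using c1 c2 c3 by (simp add: f_legs_def)
    also have "\<dots> = bump_legs F.L' F.A' r c (Suc i) ct"
      unfolding bump_legs_def hk' using False nl unfolding u SL_eq ins_nhk[OF False] nx by (intro ext) auto
    finally have 1: "f_legs i SL SA (Suc r) ct = bump_legs F.L' F.A' r c (Suc i) ct" .
    have "f_arms i SL SA (Suc r) ct = SA((Suc r, ct) := add_mset (Suc i) (SA (Suc r, ct) - {#i#}))"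
      using c1 c2 c3 by (simp add: f_arms_def)
    also have "\<dots> = bump_arms F.L' F.A' r c (Suc i) ct"
      unfolding bump_arms_def hk' using False unfolding u SA nx by simp
    finally show comm using 1 commI[OF b colA[OF E] eSA[OF c3]] by simp
  qed
qed

context bump_f
begin

text \<open>A cell strictly between \<open>c0\<close> and the target would have entries at least
  \<open>i\<close> and at most \<open>l = i\<close>. Next to \<open>(r0, c0)\<close> this would
  trigger (S), which \<open>S_row\<close> excludes; likewise \<open>i\<close> is not the hook of the
  target.\<close>

lemma E2_next: assumes E2 shows "ct = Suc c0" "i \<notin> L (Suc r, ct)" hk
proof -
  have nM: "\<not> F.M" and r0: "r0 = Suc r" using assms by auto
  have nS: "\<not> F.S" using S_row[OF nM] r0 by auto
  have ge: "i \<le> w" if "w \<in> L (Suc r, x)" "c0 < x" for w x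
    using semistd_row[OF semistd that(2) _ leg_ents[OF that(1)], of i] F.inc r0 by simp
  show ct: "ct = Suc c0"
  proof (rule ccontr)
    assume "ct \<noteq> Suc c0"
    then have lt: "Suc c0 < ct" using assms by simp
    then obtain w where w: "w \<in> L (Suc r, Suc c0)" using before(1)[of "Suc c0"] by auto
    have "w = i" using ge[OF w] before(2)[OF lt leg_ents[OF w]] assms by simp
    then show False using w nS r0 by simp
  qed
  then show iL: "i \<notin> L (Suc r, ct)" using nS r0 by simp
  show hk unfolding hook_above_def
  proof
    fix v assume v: "v \<in> L (Suc r, ct)"
    then show "l < v" using ge[OF v] iL assms ct by (cases "v = i") auto
  qed
qed

text \<open>Column \<open>c0\<close> has no \<open>Suc i\<close>, so column \<open>ct\<close> starts
  at the maximal height. The \<open>i\<close> in the leg of column \<open>c\<close> must not exceed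
  it, which forces a \<open>Suc i\<close> before it; this can only be in the extended leg of the
  target.\<close>

lemma E2_facts: assumes E2 shows "Suc i \<in> L (Suc r, ct)" "ct = c \<Longrightarrow> i \<notin># A (r, c)"
proof -
  note n = E2_next[OF assms]
  have nM: "\<not> F.M" and li: "l = i" and r0: "r0 = Suc r" and c0: "c0 < ct" using assms by auto
  have "Suc i \<notin> ents L A (r', c0)" for r'
    using F.nM_suc[OF nM, of r'] before(2)[OF c0, of "Suc i"] r0 li by auto
  then have "arm_count A (Suc i) c0 = 0" by (rule arm_count_ents_0)
  then have b: "col_base L A i ct = peak L A i c0" using n(1) by (simp add: col_base_Suc)
  have "Suc i \<in> L (Suc r, ct) \<and> (ct = c \<longrightarrow> i \<notin># A (r, c))"
  proof (cases "ct = c")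
    case True
    have iE: "i \<in> ents L A (r, c)" using linE li by simp
    have d: "leg_count L i c = 1" "arm_count A i c = int (count (A (r, c)) i)"
      using leg_count_pos[OF semistd lin] arm_count_loc[OF semistd iE] li by simp_all
    have "peak L A i c \<le> col_base L A i c" using fm(3)[of c] b True by simp
    then have p: "1 + arm_count A i c \<le> leg_count L (Suc i) c" using d(1) by (simp add: peak_def)
    then have a: "arm_count A i c = 0" "leg_count L (Suc i) c = 1"
      using leg_count_le1[OF semistd, of "Suc i" c] arm_count_ge0[of A i c] by linarith+
    then have "leg_count L (Suc i) c \<noteq> 0" by simp
    then obtain r' where r': "Suc i \<in> L (r', c)" by (rule leg_count_nonzeroE)
    then have "r' = r \<or> r' = Suc r" using semistd_suc_row[OF semistd iE leg_ents] by blast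
    then have "Suc i \<in> L (Suc r, c)" using Lle[of "Suc i"] r' li by auto
    then show ?thesis using a d True by (simp add: count_eq_zero_iff)
  next
    case False
    then have ctc: "ct < c" using ct_le by simp
    have "Suc i \<in> ents L A (Suc r, ct)"
    proof (rule ccontr)
      assume H: "Suc i \<notin> ents L A (Suc r, ct)"
      have no: "i \<notin> ents L A (r', ct)" for r' using mid_col[OF ctc le_refl ctc, of i r'] n(3) li by auto
      have nos: "Suc i \<notin> ents L A (r', ct)" for r' using mid_col_suc[OF ctc le_refl ctc, of r'] H li by auto
      have "peak L A i ct = col_base L A i ct"
        using no_i_col_net(1)[of i L A ct, OF no] leg_count_ents_0[of "Suc i" L A ct, OF nos] by simp
      moreover have "peak L A i ct + 1 \<le> peak L A i c - arm_count A i c"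
        using peak_i_nosuc(2)[OF ctc li H le_refl ctc] by simp
      ultimately show False using b fm(3)[of c] arm_count_ge0[of A i c] by linarith
    qed
    then obtain w where w: "w \<in> L (Suc r, ct)" "w \<le> Suc i" using ents_L[OF semistd] by blast
    then have "w = Suc i" using hk_above[OF n(3) leg_ents[OF w(1)]] li by simp
    then show ?thesis using w False by simp
  qed
  then show "Suc i \<in> L (Suc r, ct)" "ct = c \<Longrightarrow> i \<notin># A (r, c)" by blast+
qed

end

text \<open>If f_i comes first, the cell \<open>(r + 1, d)\<close> contains \<open>Suc i\<close> and
  stops the bump. If the bump comes first, it stops one cell further right, and its \<open>i\<close>
  there makes f_i use (S), which brings the \<open>Suc i\<close> back to column
  \<open>d\<close>.\<close>

lemma comm_next:
  assumes "bump_f L A r c i (Suc d) i (Suc r) d" "Suc i \<notin> ents L A (Suc (Suc r), d)"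
  shows "bump_f.comm L A r c i (Suc d) i (Suc r) d"
proof -
  interpret bump_f L A r c i "Suc d" i "Suc r" d by fact
  have nM: "\<not> F.M" by fact
  have nS: "\<not> F.S" using S_row[OF nM] by auto
  have E: E2 using assms by simp
  note n = E2_next[OF E] and f = E2_facts[OF E]
  have nE: "\<not> E1" "\<not> E3" by auto
  have dc: "d < c" using ct_le by simp
  have inc: "i \<in> ents L A (Suc r, d)" using F.inc .
  have le: "v \<le> i" if "v \<in> ents L A (Suc r, d)" for v using before(2)[OF lessI that] .
  \<comment> \<open>Even a vertical bump carries no arm entry here: \<open>Suc i\<close> stands
    above, and the arm contains no \<open>i\<close>.\<close>
  have SA: "SA = A"
  proof (cases "Suc d = c")
    case True
    have "v < i" if v: "v \<in># A (r, c)" for v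
    proof -
      have "v < Suc i" using semistd_col[OF semistd lessI arm_ents[OF v] leg_ents] f(1) True by simp
      moreover have "v \<noteq> i" using f(2)[OF True] v by auto
      ultimately show ?thesis by simp
    qed
    then have "filter_mset (\<lambda>z. z < i) (A (r, c)) = A (r, c)" "filter_mset (\<lambda>z. i \<le> z) (A (r, c)) = {#}"
      by (auto intro!: filter_mset_all simp: not_le)
    then show ?thesis unfolding SA_hk_c[OF True] by (intro ext) auto
  next
    case False
    then show ?thesis using SA_hk[OF n(3)] by simp
  qed
  have c1: "Suc i \<notin> ents SL SA (Suc (Suc r), d)" using nM unfolding SA SL_eq by (auto simp: ents_def)
  have c2: "i \<in> SL (Suc r, Suc d)" unfolding SL_eq ins_hk[OF n(3)] by simp
  have c3: "i \<in> ents SL SA (Suc r, d)" using inc unfolding SA SL_eq by (auto simp: ents_def)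
  have f_legs: "f_legs i SL SA (Suc r) d = SL((Suc r, Suc d) := SL (Suc r, Suc d) - {i}, (Suc r, d) := insert (Suc i) (SL (Suc r, d)))"
    using c1 c2 by (simp add: f_legs_def)
  have f_arms: "f_arms i SL SA (Suc r) d = A" using c1 c2 SA by (simp add: f_arms_def)
  have sE: "Suc i \<in> ents F.L' F.A' (Suc r, d)"
  proof (cases "i \<in># A (Suc r, d)")
    case True
    show ?thesis unfolding F.upd_Na[OF nM nS True] by (simp add: ents_def)
  next
    case False
    show ?thesis unfolding F.upd_Nl[OF nM nS False] by (simp add: ents_def)
  qed
  have oth: "F.L' x = L x \<and> F.A' x = A x" if "x \<noteq> (Suc r, d)" for x
  proof (cases "i \<in># A (Suc r, d)")
    case True
    show ?thesis unfolding F.upd_Na[OF nM nS True] using that by simp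
  next
    case False
    show ?thesis unfolding F.upd_Nl[OF nM nS False] using that by simp
  qed
  have rowr: "F.L' (r, x) = L (r, x)" for x using oth[of "(r, x)"] by simp
  have sing: "L (Suc r, d) = {w}" if "w \<in> L (Suc r, d)" for w using top[OF lessI _ that] that by blast
  have tp: "x = y" if "r < r'" "x \<in> F.L' (r', c')" "y \<in> F.L' (r', c')" for r' c' x y
  proof (cases "(r', c') = (Suc r, d)")
    case False
    then show ?thesis using top[OF that(1), of x c' y] that oth[of "(r', c')"] by simp
  next
    case True
    show ?thesis
    proof (cases "i \<in># A (Suc r, d)")
      case iA: True
      show ?thesis using that top[OF that(1), of x c' y] unfolding F.upd_Na[OF nM nS iA] by simp
    next
      case iA: False
      have "L (Suc r, d) = {i}" using sing F.leg_i[OF iA] by blast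
      then show ?thesis using that True unfolding F.upd_Nl[OF nM nS iA] by simp
    qed
  qed
  have b: "bump F.L' F.A' r c i d"
  proof (intro bump.intro filling.intro bump_axioms.intro)
    show "semistd F.L' F.A'" by (rule F.semistd_f)
    show "x = y" if "r < r'" "x \<in> F.L' (r', c')" "y \<in> F.L' (r', c')" for r' c' x y using tp[OF that] .
    show "i \<in> F.L' (r, c)" unfolding rowr by (rule lin)
    show "\<exists>u\<in>F.L' (r, c). u < i" unfolding rowr by (rule leg)
    show "v < i \<or> v = i \<and> c' \<le> c" if "u \<in> F.L' (r, c')" "v \<in> F.L' (r, c')" "u < v" for c' u v
      using that unfolding rowr by (rule lmax)
    show "F.L' (Suc r, c') \<noteq> {}" if "c' < d" for c' using before(1)[of c'] oth[of "(Suc r, c')"] that by simp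
    show "v \<le> i" if "c' < d" "v \<in> ents F.L' F.A' (Suc r, c')" for c' v
      using before(2)[of c' v] oth[of "(Suc r, c')"] that by (simp add: ents_def)
    show "F.L' (Suc r, d) = {} \<or> (\<exists>v\<in>ents F.L' F.A' (Suc r, d). i < v)" using sE by blast
  qed
  have "f_legs i SL SA (Suc r) d = bump_legs F.L' F.A' r c i d \<and> A = bump_arms F.L' F.A' r c i d"
  proof (cases "i \<in># A (Suc r, d)")
    case True
    note u = F.upd_Na[OF nM nS True]
    obtain w where "w \<in> L (Suc r, d)" "w \<le> i" using ents_L[OF semistd inc] by auto
    then have nh: "\<not> hook_above F.L' r i d" unfolding u hook_above_def by (auto simp: not_less)
    have nx: "next_greater i (F.A' (Suc r, d)) = Suc i" unfolding u by (intro next_greater_eqI) simp_all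
    have "f_legs i SL SA (Suc r) d = bump_legs F.L' F.A' r c i d"
      unfolding f_legs bump_legs_def nx using nh n(2) unfolding u SL_eq ins_hk[OF n(3)] by (intro ext) auto
    moreover have "A = bump_arms F.L' F.A' r c i d"
      unfolding bump_arms_def nx using nh True unfolding u by (intro ext) auto
    ultimately show ?thesis by blast
  next
    case False
    note u = F.upd_Nl[OF nM nS False]
    have Li: "L (Suc r, d) = {i}" using sing F.leg_i[OF False] by blast
    have h: "hook_above F.L' r i d" unfolding u hook_above_def using Li by simp
    have "f_legs i SL SA (Suc r) d = bump_legs F.L' F.A' r c i d"
      unfolding f_legs bump_legs_def using h n(2) Li unfolding u SL_eq ins_hk[OF n(3)] by (intro ext) auto
    moreover have "A = bump_arms F.L' F.A' r c i d"
      unfolding bump_arms_def using h dc unfolding u by simp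
    ultimately show ?thesis by blast
  qed
  then show comm using f_arms commI[OF b colC[OF nE] c3] by simp
qed

text \<open>Both orders give the target the extended leg \<open>{i, Suc i}\<close> and its original
  arm. If the bump comes first, \<open>i\<close> replaces the arm entry \<open>k = Suc i\<close> and
  is then raised; if f_i comes first, the hook becomes \<open>Suc i\<close> and the bumped
  \<open>i\<close> takes its place.\<close>

lemma comm_hook:
  assumes "bump_f L A r c i ct i (Suc r) ct" "\<not> hook_above L r i ct" "Suc i \<notin> ents L A (Suc (Suc r), ct)"
    "i \<notin># A (Suc r, ct)"
  shows "bump_f.comm L A r c i ct i (Suc r) ct"
proof -
  interpret bump_f L A r c i ct i "Suc r" ct by fact
  have nh: "\<not> hk" and nM: "\<not> F.M" by fact+
  have nS: "\<not> F.S" using S_row[OF nM] by auto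
  note u = F.upd_Nl[OF nM nS assms(4)] and SA = SA_nhk[OF nh]
  have E: "\<not> E1" "\<not> E2" "\<not> E3" by auto
  have "Suc i \<in> ents L A (Suc r, ct)" using no_X by blast
  then have k: "k = Suc i" using nhk_k_suc[OF nh] by blast
  have iL: "i \<in> L (Suc r, ct)" using F.leg_i assms(4) by blast
  have Li: "L (Suc r, ct) = {i}" using top[OF lessI _ iL] iL by blast
  have ne: "ct \<noteq> c" using nhk(1)[OF nh] by simp
  have c1: "Suc i \<notin> ents SL SA (Suc (Suc r), ct)" using nM unfolding SL_eq SA by (auto simp: ents_def)
  have c2: "i \<notin> SL (Suc r, Suc ct)" using nS unfolding SL_eq by auto
  have c3: "i \<in># SA (Suc r, ct)" unfolding SA by simp
  have h: "hook_above F.L' r i ct" unfolding u hook_above_def using Li by simp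
  have "f_legs i SL SA (Suc r) ct = SL" using c1 c2 c3 by (simp add: f_legs_def)
  also have "\<dots> = bump_legs F.L' F.A' r c i ct"
    unfolding bump_legs_def using h Li unfolding u SL_eq ins_nhk[OF nh] k by (intro ext) auto
  finally have 1: "f_legs i SL SA (Suc r) ct = bump_legs F.L' F.A' r c i ct" .
  have "f_arms i SL SA (Suc r) ct = SA((Suc r, ct) := add_mset (Suc i) (SA (Suc r, ct) - {#i#}))"
    using c1 c2 c3 by (simp add: f_arms_def)
  also have "\<dots> = A" using nhk(2)[OF nh] unfolding SA k by (intro ext) auto
  also have "\<dots> = bump_arms F.L' F.A' r c i ct" unfolding bump_arms_def using h ne unfolding u by simp
  finally show comm using 1 commI[OF bump_gen[OF E] colC[OF E(1,3)] eSA[OF c3]] by simp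
qed

section \<open>Commutation with a bump: the case distinction\<close>

context bump_f
begin

text \<open>Once the special positions are split off, the bump does not change the outcome of any
  test of f_i at \<open>(r0, c0)\<close>.\<close>

theorem comm: comm
proof -
  show ?thesis
  proof (cases E1)
    case True
    then have e: "l = i" "r0 = r" "c0 = c" by auto
    have ax: "bump_f L A r c i ct i r c" using bump_f_axioms unfolding e .
            show ?thesis unfolding e by (rule comm_leg[OF ax]) (use True e in auto)
  next
    case nE1: False
    show ?thesis
    proof (cases E3)
      case True
      then have e: "l = Suc i" "r0 = r" "c = Suc c0" by auto
      have ax: "bump_f L A r (Suc c0) (Suc i) ct i r c0" using bump_f_axioms unfolding e .
            show ?thesis unfolding e by (rule comm_shift[OF ax]) (use True e in auto)
    next
      case nE3: False
      show ?thesis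
      proof (cases E2)
        case True
        then have e: "l = i" "r0 = Suc r" "ct = Suc c0" using E2_next(1)[OF True] by auto
        have ax: "bump_f L A r c i (Suc c0) i (Suc r) c0" using bump_f_axioms unfolding e .
            show ?thesis unfolding e by (rule comm_next[OF ax]) (use True e in auto)
      next
        case nE2: False
        show ?thesis
        proof (cases "ct = c \<and> r0 = r \<and> c0 = c \<and> l \<le> i \<and> i \<in># A (r, c)")
          case True
          then have e: "ct = c" "r0 = r" "c0 = c" by auto
          have ax: "bump_f L A r c l c i r c" using bump_f_axioms unfolding e .
            show ?thesis unfolding e by (rule comm_moved[OF ax]) (use True e in auto)
        next
          case n1: False
          show ?thesis
          proof (cases "\<not> hk \<and> l < i \<and> k = i \<and> r0 = Suc r \<and> c0 = ct \<and> count (A (r0, c0)) i = 1")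
            case True
            then have e: "r0 = Suc r" "c0 = ct" by auto
            have ax: "bump_f L A r c l ct i (Suc r) ct" using bump_f_axioms unfolding e .
            show ?thesis unfolding e by (rule comm_single[OF ax]) (use True e in \<open>auto simp: k_def\<close>)
          next
            case n2: False
            show ?thesis
            proof (cases "l = Suc i \<and> ct = c \<and> r0 = r \<and> c0 = c")
              case True
              then have e: "l = Suc i" "ct = c" "r0 = r" "c0 = c" by auto
              have ax: "bump_f L A r c (Suc i) c i r c" using bump_f_axioms unfolding e .
            show ?thesis unfolding e by (rule comm_up[OF ax])
            next
              case n3: False
              show ?thesis
              proof (cases "l = i \<and> \<not> hk \<and> r0 = Suc r \<and> c0 = ct \<and> \<not> F.M \<and> i \<notin># A (r0, c0)")
                case True
                then have e: "l = i" "r0 = Suc r" "c0 = ct" by auto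
                have ax: "bump_f L A r c i ct i (Suc r) ct" using bump_f_axioms unfolding e .
            show ?thesis unfolding e by (rule comm_hook[OF ax]) (use True e in auto)
              next
                case n4: False
                have at_rc: "i \<in># A (r, c) \<or> l = i" if "r0 = r" "c0 = c" "l \<le> i"
                  using F.inc Lle[of i] that by (auto simp: ents_def)
                have no_rc: "\<not> (r0 = r \<and> c0 = c \<and> ct = c \<and> l \<le> i)"
                proof
                  assume H: "r0 = r \<and> c0 = c \<and> ct = c \<and> l \<le> i"
                  then have "i \<notin># A (r, c)" "l = i" using n1 at_rc by auto
                  then show False using nE1 H F.M_arm(1) by blast
                qed
                show ?thesis
                proof (rule comm_generic[OF colC[OF nE1 nE3]])
                  show "i \<in> ents SL SA (r0, c0)"
                    using ents_S_rev[OF F.inc] no_rc nE1 F.M_arm(1) by auto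
                  show "Suc i \<in> ents SL SA (Suc r0, c0) \<longleftrightarrow> F.M"
                  proof
                    assume "Suc i \<in> ents SL SA (Suc r0, c0)"
                    then consider F.M | "r0 = r" "c0 = ct" "Suc i = l" | "r0 = r" "c0 = ct" "ct = c" "l \<le> Suc i" "l \<noteq> Suc i"
                      using ents_S_sub[of "Suc i" "(Suc r0, c0)"] by auto
                    then show F.M
                    proof cases
                      \<comment> \<open>The bump puts \<open>l = Suc i\<close> right above
                        \<open>(r0, c0)\<close>. As \<open>E3\<close> fails, the hook there is at
                        most \<open>l\<close>, and being greater than \<open>i\<close> it was
                        \<open>Suc i\<close> before.\<close>
                      case 2
                      then have ctc: "ct < c" using n3 ct_le by (cases "ct = c") auto
                      have nh: "\<not> hk" using range_E3[OF _ ctc] 2 ctc nE3 by auto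
                      then obtain h where h: "h \<in> L (Suc r, ct)" "h \<le> l" using nhk(5) by blast
                      have "i < h" using semistd_col[OF semistd lessI F.inc, of h] leg_ents[OF h(1)] 2 by simp
                      then have "h = Suc i" using h 2 by simp
                      then show ?thesis using h leg_ents 2 by auto
                    next
                      case 3
                      then show ?thesis using no_rc by simp
                    qed
                  next
                    assume M: F.M
                    have "\<not> ((Suc r0, c0) = (r, c) \<and> l \<le> Suc i)"
                    proof
                      assume H: "(Suc r0, c0) = (r, c) \<and> l \<le> Suc i"
                      obtain u where u: "u \<in> L (r, c)" "u < l" using leg by auto
                      have "i < u" using semistd_col[OF semistd lessI F.inc, of u] leg_ents[OF u(1)] H by simp
                      then show False using u H by simp
                    qed
                    then show "Suc i \<in> ents SL SA (Suc r0, c0)" using ents_S_rev[OF M] by auto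
                  qed
                  show "i \<in> SL (r0, Suc c0) \<longleftrightarrow> F.S" if nM: "\<not> F.M"
                  proof
                    assume "i \<in> SL (r0, Suc c0)"
                    then consider F.S | "r0 = Suc r" "Suc c0 = ct" "i = ins" using SL_sub[of i "(r0, Suc c0)"] by auto
                    then show F.S
                    proof cases
                      \<comment> \<open>An \<open>i\<close> inserted into the target next to
                        \<open>(r0, c0)\<close> is \<open>l\<close>, which is \<open>E2\<close>, or
                        it is \<open>k > l\<close>, although \<open>i\<close> cannot exceed
                        \<open>l\<close> before the target.\<close>
                      case 2
                      then have le: "i \<le> l" using before(2)[of c0 i] F.inc by auto
                      show ?thesis
                      proof (cases hk)
                        case True
                        then show ?thesis using 2 nE2 nM by (auto simp: ins_def)
                      next
                        case False
                        then show ?thesis using 2 le nhk(3)[OF False] by (auto simp: ins_def)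
                      qed
                    qed
                  next
                    assume S: F.S
                    have "\<not> ((r0, Suc c0) = (r, c) \<and> i = l)" using left[OF le_refl, of c0 i] F.inc by auto
                    then show "i \<in> SL (r0, Suc c0)" using S by (auto simp: SL_eq)
                  qed
                  show "i \<in># SA (r0, c0) \<longleftrightarrow> i \<in># A (r0, c0)" if nM: "\<not> F.M" and nS: "\<not> F.S"
                  proof
                    assume "i \<in># SA (r0, c0)"
                    then show "i \<in># A (r0, c0)" using SA_sub[of i "(r0, c0)"] n4 nM F.i_row[OF arm_ents, of r] by auto
                  next
                    assume iA: "i \<in># A (r0, c0)"
                    have "l < i" if "\<not> hk" "i = k" using nhk(3)[OF that(1)] that(2) by simp
                    then show "i \<in># SA (r0, c0)" using SA_rev[OF iA] no_rc n2 by auto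
                  qed
                qed (fact nE1 nE2 nE3)+
              qed
            qed
          qed
        qed
      qed
    qed
  qed
qed

end

section \<open>Reading words\<close>

definition leg_map :: "hvt \<Rightarrow> legs" where
  "leg_map T x = (if in_shape T (fst x) (snd x) then set (hLplus (cell T (fst x) (snd x))) else {})"

definition arm_map :: "hvt \<Rightarrow> arms" where
  "arm_map T x = (if in_shape T (fst x) (snd x) then mset (harm (cell T (fst x) (snd x))) else {#})"

text \<open>The conditions on a list representation that the two maps do not see: together with the
  maps they determine the tableau.\<close>

definition wf_hvt :: "hvt \<Rightarrow> bool" where
  "wf_hvt T \<longleftrightarrow> (\<forall>row\<in>set T. row \<noteq> []) \<and>
     (\<forall>r c. in_shape T r c \<longrightarrow> sorted_wrt (<) (hLplus (cell T r c)) \<and> sorted (harm (cell T r c)))"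

lemma leg_map_nonempty: "leg_map T (r, c) \<noteq> {} \<longleftrightarrow> in_shape T r c"
  by (simp add: leg_map_def hLplus_def)

lemma leg_map_in: "in_shape T r c \<Longrightarrow> leg_map T (r, c) = set (hLplus (cell T r c))"
  and arm_map_in: "in_shape T r c \<Longrightarrow> arm_map T (r, c) = mset (harm (cell T r c))"
  by (simp_all add: leg_map_def arm_map_def)

lemma ents_eq: "ents (leg_map T) (arm_map T) (r, c) = (if in_shape T r c then set (hentries (cell T r c)) else {})"
  by (auto simp: ents_def leg_map_def arm_map_def hentries_def hLplus_def)

lemma valid_wf: assumes "hvt_valid T" shows "wf_hvt T"
  using assms by (auto simp: hvt_valid_def wf_hvt_def hook_valid_def)

lemma valid_semistd: assumes v: "hvt_valid T" shows "semistd (leg_map T) (arm_map T)"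
proof (rule hvI)
  have hvd: "hook_valid (cell T r c)" if "in_shape T r c" for r c using v that by (simp add: hvt_valid_def)
  show "finite (leg_map T x)" for x by (simp add: leg_map_def)
  show "0 \<notin> leg_map T x" for x
  proof
    assume "0 \<in> leg_map T x"
    then have "in_shape T (fst x) (snd x)" "0 \<in> set (hLplus (cell T (fst x) (snd x)))"
      by (auto simp: leg_map_def split: if_splits)
    then show False using hvd[of "fst x" "snd x"] by (auto simp: hook_valid_def hLplus_def)
  qed
  show "\<exists>u\<in>leg_map T x. u \<le> w" if "w \<in># arm_map T x" for x w
  proof -
    have "in_shape T (fst x) (snd x)" "w \<in> set (harm (cell T (fst x) (snd x)))"
      using that by (auto simp: arm_map_def split: if_splits)
    then show ?thesis using hvd[of "fst x" "snd x"] by (auto simp: hook_valid_def leg_map_def hLplus_def)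
  qed
  show "leg_map T (r', c') \<noteq> {}" if "leg_map T (r, c) \<noteq> {}" "r' \<le> r" "c' \<le> c" for r c r' c'
  proof -
    have s: "r < length T" "c < length (T ! r)" using that by (auto simp: leg_map_nonempty in_shape_def)
    have "length (T ! r) \<le> length (T ! r')"
    proof (cases "r' = r")
      case False
      then have "r' < r" using that by simp
      moreover have "sorted_wrt (\<lambda>a b. b \<le> a) (map length T)" using v by (simp add: hvt_valid_def)
      ultimately show ?thesis using s sorted_wrt_nth_less[of "\<lambda>a b. b \<le> a" "map length T" r' r] by simp
    qed simp
    then show ?thesis using s that by (auto simp: leg_map_nonempty in_shape_def)
  qed
  have mm: "hmin (cell T r c) \<le> u \<and> u \<le> hmax (cell T r c)" if "u \<in> ents (leg_map T) (arm_map T) (r, c)" for r c u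
    using that by (auto simp: ents_eq hmin_def hmax_def split: if_splits)
  have sh: "in_shape T r c" if "u \<in> ents (leg_map T) (arm_map T) (r, c)" for r c u
    using that by (auto simp: ents_eq split: if_splits)
  show "u \<le> w" if "c < c'" "u \<in> ents (leg_map T) (arm_map T) (r, c)" "w \<in> ents (leg_map T) (arm_map T) (r, c')" for r c c' u w
  proof -
    have "hmax (cell T r c) \<le> hmin (cell T r c')" using v sh[OF that(3)] that(1) by (simp add: hvt_valid_def)
    then show ?thesis using mm[OF that(2)] mm[OF that(3)] by simp
  qed
  show "u < w" if "r < r'" "u \<in> ents (leg_map T) (arm_map T) (r, c)" "w \<in> ents (leg_map T) (arm_map T) (r', c)" for r r' c u w
  proof -
    have "hmax (cell T r c) < hmin (cell T r' c)" using v sh[OF that(3)] that(1) by (simp add: hvt_valid_def)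
    then show ?thesis using mm[OF that(2)] mm[OF that(3)] by simp
  qed
qed

lemma hmax_mem: "hmax h \<in> set (hentries h)" and hmin_mem: "hmin h \<in> set (hentries h)"
  unfolding hmax_def hmin_def by (rule Max_in Min_in; simp add: hentries_def)+

lemma semistd_valid: assumes w: "wf_hvt T" and h: "semistd (leg_map T) (arm_map T)" shows "hvt_valid T"
  unfolding hvt_valid_def
proof (intro conjI allI impI)
  show "\<forall>row\<in>set T. row \<noteq> []" using w by (simp add: wf_hvt_def)
  show "sorted_wrt (\<lambda>a b. b \<le> a) (map length T)"
    unfolding sorted_wrt_iff_nth_less
  proof (intro allI impI)
    fix i j assume ij: "i < j" "j < length (map length T)"
    show "map length T ! j \<le> map length T ! i"
    proof (rule ccontr)
      assume n: "\<not> ?thesis"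
      \<comment> \<open>A longer upper row has a cell above the empty place just after the end of
        row \<open>i\<close>.\<close>
      then have "in_shape T j (length (T ! i))" using ij by (simp add: in_shape_def)
      then have "leg_map T (i, length (T ! i)) \<noteq> {}"
        using semistd_shape[OF h, of j "length (T ! i)" i "length (T ! i)"] ij by (simp add: leg_map_nonempty)
      then show False by (simp add: leg_map_nonempty in_shape_def)
    qed
  qed
  fix r c assume s: "in_shape T r c"
  let ?h = "cell T r c"
  have L: "leg_map T (r, c) = set (hLplus ?h)" "arm_map T (r, c) = mset (harm ?h)" using s by (simp_all add: leg_map_in arm_map_in)
  have so: "sorted_wrt (<) (hLplus ?h)" "sorted (harm ?h)" using w s by (auto simp: wf_hvt_def)
  have "hx ?h \<noteq> 0" using semistd_pos[OF h, of "(r, c)"] L by (auto simp: hLplus_def)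
  moreover have "hx ?h \<le> v" if vA: "v \<in> set (harm ?h)" for v
  proof -
    obtain u where "u \<in> leg_map T (r, c)" "u \<le> v" using semistd_arm[OF h, of v "(r, c)"] vA by (auto simp: L)
    then show ?thesis using so(1) L by (auto simp: hLplus_def)
  qed
  ultimately show "hook_valid ?h" using so by (auto simp: hook_valid_def)
next
  fix r c c' assume s: "in_shape T r c' \<and> c < c'"
  then have s': "in_shape T r c" by (auto simp: in_shape_def)
  have "hmax (cell T r c) \<in> ents (leg_map T) (arm_map T) (r, c)" "hmin (cell T r c') \<in> ents (leg_map T) (arm_map T) (r, c')"
    using s s' hmax_mem hmin_mem by (simp_all add: ents_eq)
  then show "hmax (cell T r c) \<le> hmin (cell T r c')" using semistd_row[OF h] s by blast
next
  fix r r' c assume s: "in_shape T r' c \<and> r < r'"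
  then have "leg_map T (r, c) \<noteq> {}" using semistd_shape[OF h, of r' c r c] by (simp add: leg_map_nonempty)
  then have s': "in_shape T r c" by (simp add: leg_map_nonempty)
  have "hmax (cell T r c) \<in> ents (leg_map T) (arm_map T) (r, c)" "hmin (cell T r' c) \<in> ents (leg_map T) (arm_map T) (r', c)"
    using s s' hmax_mem hmin_mem by (simp_all add: ents_eq)
  then show "hmax (cell T r c) < hmin (cell T r' c)" using semistd_col[OF h] s by blast
qed

text \<open>Rows are nonempty, so the leg map recovers the list of row lengths; sorted lists are
  recovered from their set or multiset.\<close>

lemma leg_arm_map_inj: assumes w: "wf_hvt T" "wf_hvt T'" and L: "leg_map T = leg_map T'" and A: "arm_map T = arm_map T'" shows "T = T'"
proof -
  have sh: "in_shape T r c \<longleftrightarrow> in_shape T' r c" for r c using L leg_map_nonempty by metis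
  have ne: "length (T ! r) \<noteq> 0" if "r < length T" for r using w(1) that by (auto simp: wf_hvt_def)
  have ne': "length (T' ! r) \<noteq> 0" if "r < length T'" for r using w(2) that by (auto simp: wf_hvt_def)
  have "r < length T \<longleftrightarrow> in_shape T r 0" "r < length T' \<longleftrightarrow> in_shape T' r 0" for r
    using ne ne' by (auto simp: in_shape_def)
  then have "r < length T \<longleftrightarrow> r < length T'" for r using sh by simp
  then have len: "length T = length T'" by (metis linorder_neqE_nat order_less_irrefl)
  show ?thesis
  proof (rule nth_equalityI[OF len])
    fix r assume r: "r < length T"
    then have "c < length (T ! r) \<longleftrightarrow> c < length (T' ! r)" for c using sh[of r c] len by (simp add: in_shape_def)
    then have lr: "length (T ! r) = length (T' ! r)" by (metis linorder_neqE_nat order_less_irrefl)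
    show "T ! r = T' ! r"
    proof (rule nth_equalityI[OF lr])
      fix c assume c: "c < length (T ! r)"
      then have s: "in_shape T r c" "in_shape T' r c" using r len lr by (auto simp: in_shape_def)
      have "set (hLplus (cell T r c)) = set (hLplus (cell T' r c))"
        using fun_cong[OF L, of "(r, c)"] s by (simp add: leg_map_in)
      moreover have "sorted_wrt (<) (hLplus (cell T r c))" "sorted_wrt (<) (hLplus (cell T' r c))"
        using w s by (auto simp: wf_hvt_def)
      ultimately have 1: "hLplus (cell T r c) = hLplus (cell T' r c)"
        using strict_sorted_equal by blast
      have "mset (harm (cell T r c)) = mset (harm (cell T' r c))"
        using fun_cong[OF A, of "(r, c)"] s by (simp add: arm_map_in)
      moreover have "sorted (harm (cell T r c))" "sorted (harm (cell T' r c))"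
        using w s by (auto simp: wf_hvt_def)
      ultimately have "harm (cell T r c) = harm (cell T' r c)"
        by (metis properties_for_sort sorted_sort_id)
      then show "T ! r ! c = T' ! r ! c" using 1
        by (simp add: cell_def hLplus_def hx_def hleg_def harm_def prod_eq_iff)
    qed
  qed
qed

section \<open>Bracketing and heights of prefixes\<close>

definition letter_count :: "nat \<Rightarrow> letter list \<Rightarrow> nat" where
  "letter_count v w = length (filter (\<lambda>x. fst x = v) w)"

definition height :: "nat \<Rightarrow> letter list \<Rightarrow> int" where
  "height i w = int (letter_count i w) - int (letter_count (Suc i) w)"

lemma letter_count_simps [simp]: "letter_count v [] = 0" "letter_count v (x # w) = (if fst x = v then Suc (letter_count v w) else letter_count v w)"
  "letter_count v (u @ w) = letter_count v u + letter_count v w"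
  by (simp_all add: letter_count_def)

lemma height_simps [simp]: "height i [] = 0" "height i (u @ w) = height i u + height i w"
  by (simp_all add: height_def)

text \<open>The output on \<open>u\<close> is the state after \<open>u\<close>, with the stack
  reversed, so the bracketing can be resumed from it.\<close>

lemma brk_append: "brk (u @ v) ps ms = brk v (rev (snd (brk u ps ms))) (fst (brk u ps ms))"
  by (induction u ps ms rule: brk.induct) (auto split: list.splits)

lemma signs_snoc: "signs i (w @ [x]) = signs i w @
    (if fst x = i \<or> fst x = Suc i then [(length w, fst x = Suc i)] else [])"
proof -
  have 1: "concat (map (\<lambda>j. if fst ((w @ [x]) ! j) = i \<or> fst ((w @ [x]) ! j) = Suc i
           then [(j, fst ((w @ [x]) ! j) = Suc i)] else []) [0..<length w]) =
        concat (map (\<lambda>j. if fst (w ! j) = i \<or> fst (w ! j) = Suc i then [(j, fst (w ! j) = Suc i)] else []) [0..<length w])"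
    by (intro arg_cong[of _ _ concat] map_cong) (simp_all add: nth_append)
  show ?thesis unfolding signs_def by (simp only: length_append list.size upt_Suc_append add_0_right
     map_append concat_append 1 add_Suc_right le0 plus_nat.add_0) (simp add: nth_append)
qed

definition bracketing :: "nat \<Rightarrow> letter list \<Rightarrow> nat list \<times> nat list" where
  "bracketing i w = brk (signs i w) [] []"

lemma bracketing_Nil: "bracketing i [] = ([], [])" by (simp add: bracketing_def signs_def)

lemma bracketing_snoc: "bracketing i (w @ [x]) =
   (if fst x = Suc i then (fst (bracketing i w), snd (bracketing i w) @ [length w])
    else if fst x = i then
      (if snd (bracketing i w) = [] then (fst (bracketing i w) @ [length w], []) else (fst (bracketing i w), butlast (snd (bracketing i w))))
    else bracketing i w)"
proof -
  have "rev (tl (rev q)) = butlast q" for q :: "nat list" by (metis butlast_rev rev_rev_ident)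
  then show ?thesis
    unfolding bracketing_def signs_snoc
    by (auto simp: brk_append split: list.splits)
qed

text \<open>The number of unpaired signs - is the maximal height of a prefix. The last unpaired - is
  the letter that reaches this maximum for the first time, the first unpaired + the letter that
  leaves it for the last time.\<close>

lemma bracketing_inv:
  fixes w :: "letter list" and i :: nat
  defines "ms \<equiv> fst (bracketing i w)" and "qs \<equiv> snd (bracketing i w)"
  shows "(\<forall>j\<le>length w. height i (take j w) \<le> int (length ms)) \<and>
    height i w = int (length ms) - int (length qs) \<and>
    (ms \<noteq> [] \<longrightarrow> last ms < length w \<and> fst (w ! last ms) = i \<and> height i (take (Suc (last ms)) w) = int (length ms) \<and>
       (\<forall>j\<le>last ms. height i (take j w) < int (length ms))) \<and>
    (qs \<noteq> [] \<longrightarrow> hd qs < length w \<and> fst (w ! hd qs) = Suc i \<and> height i (take (hd qs) w) = int (length ms) \<and>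
       (\<forall>j. hd qs < j \<longrightarrow> j \<le> length w \<longrightarrow> height i (take j w) < int (length ms)))"
  unfolding ms_def qs_def
proof (induction w rule: rev_induct)
  case Nil
  then show ?case by (simp add: bracketing_Nil)
next
  case (snoc x w)
  define ms where "ms = fst (bracketing i w)"
  define qs where "qs = snd (bracketing i w)"
  note IH = snoc[folded ms_def qs_def]
  have a: "height i (take j w) \<le> int (length ms)" if "j \<le> length w" for j using IH that by blast
  have b: "height i w = int (length ms) - int (length qs)" using IH by blast
  have c: "last ms < length w" "fst (w ! last ms) = i" "height i (take (Suc (last ms)) w) = int (length ms)" if "ms \<noteq> []"
    using IH that by blast+
  have c': "height i (take j w) < int (length ms)" if "ms \<noteq> []" "j \<le> last ms" for j using IH that by blast
  have d: "hd qs < length w" "fst (w ! hd qs) = Suc i" "height i (take (hd qs) w) = int (length ms)" if "qs \<noteq> []"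
    using IH that by blast+
  have d': "height i (take j w) < int (length ms)" if "qs \<noteq> []" "hd qs < j" "j \<le> length w" for j using IH that by blast
  have hj: "height i (take j (w @ [x])) = (if j \<le> length w then height i (take j w) else height i (w @ [x]))" for j by simp
  have nth: "(w @ [x]) ! j = w ! j" if "j < length w" for j using that by (simp add: nth_append)
  have len: "length (w @ [x]) = Suc (length w)" by simp
  have keep: "last ms < Suc (length w) \<and> fst ((w @ [x]) ! last ms) = i \<and>
      height i (take (Suc (last ms)) (w @ [x])) = int (length ms) \<and>
      (\<forall>j\<le>last ms. height i (take j (w @ [x])) < int (length ms))" if "ms \<noteq> []"
    using c[OF that] c'[OF that] by (simp add: hj nth del: height_simps take_append)
  consider (p) "fst x = Suc i" | (m) "fst x = i" "qs = []" | (m') "fst x = i" "qs \<noteq> []" | (o) "fst x \<noteq> i" "fst x \<noteq> Suc i"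
    by blast
  then show ?case
  proof cases
    case p
    have s: "bracketing i (w @ [x]) = (ms, qs @ [length w])" using p by (simp add: bracketing_snoc ms_def qs_def)
    have h: "height i (w @ [x]) = height i w - 1" using p by (simp add: height_def)
    have q: "hd (qs @ [length w]) < Suc (length w) \<and> fst ((w @ [x]) ! hd (qs @ [length w])) = Suc i \<and>
        height i (take (hd (qs @ [length w])) (w @ [x])) = int (length ms) \<and>
        (\<forall>j. hd (qs @ [length w]) < j \<longrightarrow> j \<le> Suc (length w) \<longrightarrow> height i (take j (w @ [x])) < int (length ms))"
    proof (cases "qs = []")
      case True
      then show ?thesis using p b h by (simp add: hj del: height_simps take_append)
    next
      case False
      then show ?thesis using d[OF False] d'[OF False] b h by (auto simp: hj nth simp del: height_simps take_append)
    qed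
    show ?thesis unfolding s fst_conv snd_conv len
      using keep q a b h by (auto simp: hj simp del: height_simps take_append)
  next
    case m
    have s: "bracketing i (w @ [x]) = (ms @ [length w], [])" using m by (simp add: bracketing_snoc ms_def qs_def)
    have h: "height i (w @ [x]) = height i w + 1" using m by (simp add: height_def)
    have hw: "height i w = int (length ms)" using b m by simp
    have a': "height i (take j w) \<le> 1 + int (length ms)" "height i (take j w) < 1 + int (length ms)" if "j \<le> length w" for j
      using a[OF that] by linarith+
    show ?thesis unfolding s fst_conv snd_conv len
      using a' h hw m(1) by (auto simp: hj simp del: height_simps take_append intro: less_imp_le)
  next
    case m'
    have s: "bracketing i (w @ [x]) = (ms, butlast qs)" using m' by (simp add: bracketing_snoc ms_def qs_def)
    have h: "height i (w @ [x]) = height i w + 1" using m' by (simp add: height_def)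
    have "0 < length qs" using m' by simp
    then have lq: "Suc 0 \<le> length qs" by linarith
    have q: "hd (butlast qs) < Suc (length w) \<and> fst ((w @ [x]) ! hd (butlast qs)) = Suc i \<and>
        height i (take (hd (butlast qs)) (w @ [x])) = int (length ms) \<and>
        (\<forall>j. hd (butlast qs) < j \<longrightarrow> j \<le> Suc (length w) \<longrightarrow> height i (take j (w @ [x])) < int (length ms))"
      if ne: "butlast qs \<noteq> []"
    proof -
      \<comment> \<open>A new - is paired with the most recent +, so the first unpaired + survives
        while another one is left.\<close>
      have hd: "hd (butlast qs) = hd qs" using ne by (cases qs) (auto split: if_splits)
      have "0 < length (butlast qs)" using ne by blast
      then have "2 \<le> length qs" by simp
      then show ?thesis unfolding hd using d[OF m'(2)] d'[OF m'(2)] b h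
        by (auto simp: hj nth simp del: height_simps take_append)
    qed
    show ?thesis unfolding s fst_conv snd_conv len
      using keep q a b h lq by (auto simp: hj of_nat_diff simp del: height_simps take_append)
  next
    case o
    have s: "bracketing i (w @ [x]) = (ms, qs)" using o by (simp add: bracketing_snoc ms_def qs_def)
    have h: "height i (w @ [x]) = height i w" using o by (simp add: height_def)
    have q: "hd qs < Suc (length w) \<and> fst ((w @ [x]) ! hd qs) = Suc i \<and>
        height i (take (hd qs) (w @ [x])) = int (length ms) \<and>
        (\<forall>j. hd qs < j \<longrightarrow> j \<le> Suc (length w) \<longrightarrow> height i (take j (w @ [x])) < int (length ms))"
      if ne: "qs \<noteq> []"
    proof -
      have "0 < length qs" using ne by blast
      then show ?thesis using d[OF ne] d'[OF ne] b h by (auto simp: hj nth simp del: height_simps take_append)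
    qed
    show ?thesis unfolding s fst_conv snd_conv len
      using keep q a b h by (auto simp: hj simp del: height_simps take_append)
  qed
qed

section \<open>Column words and the letters on which the operators act\<close>

definition leg_word :: "hvt \<Rightarrow> nat \<Rightarrow> letter list" where
  "leg_word T c = concat (map (\<lambda>r. lplus_letters T r c) (col_rows T c))"

definition arm_word :: "hvt \<Rightarrow> nat \<Rightarrow> letter list" where
  "arm_word T c = sort_key fst (concat (map (\<lambda>r. arm_letters T r c) (col_rows T c)))"

lemma col_word_eq: "col_word T c = leg_word T c @ arm_word T c"
  by (simp add: col_word_def leg_word_def arm_word_def)

lemma set_col_rows: "set (col_rows T c) = {r. in_shape T r c}" and distinct_col_rows: "distinct (col_rows T c)"
  by (auto simp: col_rows_def in_shape_def)

lemma sorted_col_rows: "sorted_wrt (>) (col_rows T c)"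
  unfolding col_rows_def by (intro sorted_wrt_filter) (simp add: sorted_wrt_rev)

lemma letter_count_map: "letter_count v w = count (mset (map fst w)) v"
  by (induction w) auto

lemma map_fst_lplus: "map fst (lplus_letters T r c) = rev (hLplus (cell T r c))"
proof -
  have "map ((!) (hLplus (cell T r c))) [0..<length (hLplus (cell T r c))] = hLplus (cell T r c)" by (rule map_nth)
  then show ?thesis by (simp add: lplus_letters_def Let_def o_def flip: rev_map)
qed

lemma map_fst_arm: "map fst (arm_letters T r c) = harm (cell T r c)"
  using map_nth[of "harm (cell T r c)"] by (simp add: arm_letters_def Let_def o_def)

lemma letter_count_concat: assumes "distinct rs" shows "letter_count v (concat (map g rs)) = (\<Sum>r\<in>set rs. letter_count v (g r))"
  using assms by (induction rs) auto

lemma letter_count_leg_word: assumes w: "wf_hvt T" shows "int (letter_count v (leg_word T c)) = leg_count (leg_map T) v c"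
proof -
  have 1: "letter_count v (lplus_letters T r c) = of_bool (v \<in> leg_map T (r, c))" if "in_shape T r c" for r
  proof -
    have "sorted_wrt (<) (hLplus (cell T r c))" using w that by (simp add: wf_hvt_def)
    then have "distinct (hLplus (cell T r c))" using strict_sorted_iff by blast
    then show ?thesis using that by (simp add: letter_count_map map_fst_lplus leg_map_in distinct_count_atmost_1)
  qed
  have "letter_count v (leg_word T c) = (\<Sum>r\<in>{r. in_shape T r c}. letter_count v (lplus_letters T r c))"
    unfolding leg_word_def letter_count_concat[OF distinct_col_rows] set_col_rows ..
  also have "\<dots> = (\<Sum>r\<in>{r. in_shape T r c}. of_bool (v \<in> leg_map T (r, c)))" using 1 by (intro sum.cong) auto
  also have "\<dots> = card ({r. in_shape T r c} \<inter> {r. v \<in> leg_map T (r, c)})"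
  proof -
    have "finite {r. in_shape T r c}" by (simp add: in_shape_def)
    then show ?thesis by (simp add: of_bool_def sum.If_cases)
  qed
  also have "{r. in_shape T r c} \<inter> {r. v \<in> leg_map T (r, c)} = {r. v \<in> leg_map T (r, c)}" by (auto simp: leg_map_def split: if_splits)
  finally show ?thesis by (simp add: leg_count_def)
qed

lemma letter_count_arm_word: "int (letter_count v (arm_word T c)) = arm_count (arm_map T) v c"
proof -
  have 1: "letter_count v (arm_letters T r c) = count (arm_map T (r, c)) v" if "in_shape T r c" for r
    using that by (simp add: letter_count_map map_fst_arm arm_map_in)
  have fin: "finite {r. in_shape T r c}" by (simp add: in_shape_def)
  have "letter_count v (arm_word T c) = letter_count v (concat (map (\<lambda>r. arm_letters T r c) (col_rows T c)))"
    unfolding letter_count_map arm_word_def mset_map mset_sort ..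
  also have "\<dots> = (\<Sum>r\<in>{r. in_shape T r c}. letter_count v (arm_letters T r c))"
    unfolding letter_count_concat[OF distinct_col_rows] set_col_rows ..
  also have "\<dots> = (\<Sum>r\<in>{r. in_shape T r c}. count (arm_map T (r, c)) v)" using 1 by (intro sum.cong) auto
  also have "\<dots> = (\<Sum>r | v \<in># arm_map T (r, c). count (arm_map T (r, c)) v)"
    using fin by (intro sum.mono_neutral_right) (auto simp: arm_map_def not_in_iff split: if_splits)
  finally show ?thesis by (simp add: arm_count_def)
qed

text \<open>Cells are read from top to bottom, each extended leg downwards, and columns increase
  strictly: a column contributes one strictly decreasing word.\<close>

lemma leg_word_sorted:
  assumes w: "wf_hvt T" and h: "semistd (leg_map T) (arm_map T)" shows "sorted_wrt (>) (map fst (leg_word T c))"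
proof -
  have "sorted_wrt (>) (map fst (concat (map (\<lambda>r. lplus_letters T r c) rs)))"
    if "sorted_wrt (>) rs" "set rs \<subseteq> {r. in_shape T r c}" for rs
    using that
  proof (induction rs)
    case (Cons r rs)
    have so: "sorted_wrt (<) (hLplus (cell T r c))" using w Cons.prems by (simp add: wf_hvt_def)
    have lt: "y < x" if "x \<in> set (hLplus (cell T r c))" "r' \<in> set rs" "y \<in> set (hLplus (cell T r' c))" for x y r'
    proof -
      have s: "in_shape T r c" "in_shape T r' c" "r' < r" using Cons.prems that by auto
      have "x \<in> ents (leg_map T) (arm_map T) (r, c)" "y \<in> ents (leg_map T) (arm_map T) (r', c)"
        using s that by (auto simp: ents_def leg_map_in)
      then show ?thesis using semistd_col[OF h s(3)] by blast
    qed
    have "set (map fst (concat (map (\<lambda>r. lplus_letters T r c) rs))) = (\<Union>r'\<in>set rs. set (hLplus (cell T r' c)))"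
      by (simp add: map_concat o_def map_fst_lplus del: set_map) auto
    then show ?case using so lt Cons by (auto simp: sorted_wrt_append map_fst_lplus sorted_wrt_rev)
  qed simp
  then show ?thesis unfolding leg_word_def using sorted_col_rows set_col_rows by blast
qed

lemma arm_word_sorted: "sorted (map fst (arm_word T c))"
  by (simp add: arm_word_def)

lemma leg_word_letter: assumes "x \<in> set (leg_word T c)"
  shows "\<exists>r k. x = (hLplus (cell T r c) ! k, (r, c), Some k) \<and> in_shape T r c \<and> k < length (hLplus (cell T r c))"
  using assms by (auto simp: leg_word_def set_col_rows lplus_letters_def Let_def)

lemma arm_word_letter: assumes "x \<in> set (arm_word T c)"
  shows "\<exists>r v. x = (v, (r, c), None) \<and> in_shape T r c \<and> v \<in> set (harm (cell T r c))"
  using assms by (auto simp: arm_word_def set_col_rows arm_letters_def Let_def)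

definition word_upto :: "hvt \<Rightarrow> nat \<Rightarrow> letter list" where
  "word_upto T c = concat (map (col_word T) [0..<c])"

lemma word_upto_Suc: "word_upto T (Suc c) = word_upto T c @ col_word T c"
  by (simp add: word_upto_def)

lemma height_upto: assumes "wf_hvt T" shows "height i (word_upto T c) = col_base (leg_map T) (arm_map T) i c"
proof (induction c)
  case (Suc c)
  then show ?case
    using letter_count_leg_word[OF assms, of i c] letter_count_leg_word[OF assms, of "Suc i" c] letter_count_arm_word[of i T c] letter_count_arm_word[of "Suc i" T c]
    by (simp add: word_upto_Suc col_word_eq col_base_Suc peak_def height_def)
qed (simp add: word_upto_def)

lemma word_split: assumes "c < ncols T" shows "\<exists>w2. reading_word T = word_upto T c @ col_word T c @ w2"
proof -
  have "[0..<ncols T] = [0..<c] @ c # [Suc c..<ncols T]"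
    using assms upt_add_eq_append[of 0 c "ncols T - c"] upt_conv_Cons[of c "ncols T"] by simp
  then show ?thesis by (simp add: reading_word_def word_upto_def)
qed

lemma reading_word_upto: "reading_word T = word_upto T (ncols T)"
  by (simp add: reading_word_def word_upto_def)

lemma ncols_bound: "in_shape T r c \<Longrightarrow> c < ncols T"
proof -
  have "n \<in> set ns \<Longrightarrow> n \<le> foldr max ns 0" for n and ns :: "nat list"
    by (induction ns) auto
  then have "r < length T \<Longrightarrow> length (T ! r) \<le> ncols T" unfolding ncols_def by simp
  then show "in_shape T r c \<Longrightarrow> c < ncols T" by (auto simp: in_shape_def)
qed

lemma col_empty: assumes "ncols T \<le> c" shows "col_word T c = []"
proof -
  have "set (col_rows T c) = {}" using ncols_bound[of T _ c] assms by (auto simp: set_col_rows)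
  then have "col_rows T c = []" by simp
  then show ?thesis by (simp add: col_word_def)
qed

lemma word_upto_big: assumes "ncols T \<le> c" shows "word_upto T c = reading_word T"
  using assms
proof (induction c rule: dec_induct)
  case base
  show ?case by (simp add: reading_word_upto)
next
  case (step n)
  then show ?case by (simp add: word_upto_Suc col_empty)
qed

text \<open>The prefix of the reading word that ends with the last entry \<open>i\<close> of column \<open>c\<close> has height \<open>peak\<close>.\<close>

definition peak_pos :: "hvt \<Rightarrow> nat \<Rightarrow> nat \<Rightarrow> nat" where
  "peak_pos T i c = length (word_upto T c @ leg_word T c @ takeWhile (\<lambda>x. fst x \<le> i) (arm_word T c))"

lemma word_upto_prefix: "\<exists>w2. reading_word T = word_upto T c @ w2"
  using word_split[of c T] word_upto_big[of T c] by (cases "c < ncols T") force+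

lemma word_prefix2: "\<exists>w2. reading_word T = word_upto T c @ leg_word T c @ arm_word T c @ w2"
  using word_upto_prefix[of T "Suc c"] by (auto simp: word_upto_Suc col_word_eq)

text \<open>Arms are sorted, so the initial part with entries at most \<open>i\<close> has all arm
  entries \<open>i\<close> and no \<open>Suc i\<close>.\<close>

lemma peak_pos_take: assumes w: "wf_hvt T"
  shows "peak_pos T i c \<le> length (reading_word T)" "height i (take (peak_pos T i c) (reading_word T)) = peak (leg_map T) (arm_map T) i c"
proof -
  obtain w2 where w2: "reading_word T = word_upto T c @ leg_word T c @ arm_word T c @ w2" using word_prefix2 by blast
  define u where "u = takeWhile (\<lambda>x. fst x \<le> i) (arm_word T c)"
  define d where "d = dropWhile (\<lambda>x. fst x \<le> i) (arm_word T c)"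
  have ud: "arm_word T c = u @ d" by (simp add: u_def d_def)
  have "\<forall>x\<in>set d. \<not> fst x \<le> i"
  proof (cases d)
    case (Cons y ys)
    then have "\<not> fst y \<le> i" unfolding d_def by (metis hd_dropWhile list.distinct(1) list.sel(1))
    moreover have "sorted (map fst d)" using arm_word_sorted[of T c] by (simp add: ud sorted_append)
    ultimately show ?thesis using Cons by auto
  qed simp
  then have "letter_count i d = 0" by (auto simp: letter_count_def filter_empty_conv)
  then have ci: "letter_count i u = letter_count i (arm_word T c)" by (simp add: ud)
  have "\<forall>x\<in>set u. fst x \<le> i" unfolding u_def by (meson set_takeWhileD)
  then have cs: "letter_count (Suc i) u = 0" by (force simp: letter_count_def filter_empty_conv)
  have rw: "reading_word T = (word_upto T c @ leg_word T c @ u) @ d @ w2" using w2 ud by simp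
  have p: "peak_pos T i c = length (word_upto T c @ leg_word T c @ u)" by (simp add: peak_pos_def u_def)
  then show "peak_pos T i c \<le> length (reading_word T)" using rw by simp
  have "take (peak_pos T i c) (reading_word T) = word_upto T c @ leg_word T c @ u" unfolding p rw by simp
  then have "height i (take (peak_pos T i c) (reading_word T)) = col_base (leg_map T) (arm_map T) i c + height i (leg_word T c) + height i u"
    using height_upto[OF w] by simp
  then show "height i (take (peak_pos T i c) (reading_word T)) = peak (leg_map T) (arm_map T) i c"
    using letter_count_leg_word[OF w, of i c] letter_count_leg_word[OF w, of "Suc i" c] letter_count_arm_word[of i T c] ci cs
    by (simp add: peak_def height_def)
qed

lemma word_pos:
  assumes "j < length (reading_word T)"
  shows "\<exists>c k. c < ncols T \<and> j = length (word_upto T c) + k \<and> k < length (col_word T c) \<and>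
    reading_word T ! j = col_word T c ! k \<and>
    (\<forall>m\<le>length (col_word T c). take (length (word_upto T c) + m) (reading_word T) = word_upto T c @ take m (col_word T c))"
proof -
  have "\<exists>c<n. length (word_upto T c) \<le> j \<and> j < length (word_upto T (Suc c))" if "j < length (word_upto T n)" for n
    using that
  proof (induction n)
    case (Suc n)
    show ?case
    proof (cases "j < length (word_upto T n)")
      case True
      then show ?thesis using Suc.IH by (meson less_SucI)
    next
      case False
      then show ?thesis using Suc.prems by (intro exI[of _ n]) simp
    qed
  qed (simp add: word_upto_def)
  then obtain c where c: "c < ncols T" "length (word_upto T c) \<le> j" "j < length (word_upto T (Suc c))"
    using assms reading_word_upto by metis
  obtain w2 where w2: "reading_word T = word_upto T c @ col_word T c @ w2" using word_split[OF c(1)] by blast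
  show ?thesis
    using c w2 by (intro exI[of _ c] exI[of _ "j - length (word_upto T c)"])
      (auto simp: word_upto_Suc nth_append)
qed

lemma upto_len_mono: "c \<le> d \<Longrightarrow> length (word_upto T c) \<le> length (word_upto T d)"
  by (induction d rule: dec_induct) (auto simp: word_upto_Suc)

lemma peak_pos_bounds: "length (word_upto T c) + length (leg_word T c) \<le> peak_pos T i c" "peak_pos T i c \<le> length (word_upto T (Suc c))"
  by (auto simp: peak_pos_def word_upto_Suc col_word_eq length_takeWhile_le)

lemma f_word_none:
  assumes w: "wf_hvt T" and s: "fst (bracketing i (reading_word T)) = []"
  shows "height_bound (leg_map T) (arm_map T) i 0"
  using bracketing_inv[of "reading_word T" i] peak_pos_take[OF w, of i] s by (force simp: height_bound_def)

lemma f_word_some: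
  assumes w: "wf_hvt T" and h: "semistd (leg_map T) (arm_map T)" and s: "fst (bracketing i (reading_word T)) \<noteq> []"
  shows "\<exists>r c src. reading_word T ! last (fst (bracketing i (reading_word T))) = (i, (r, c), src) \<and> in_shape T r c \<and>
    first_max (leg_map T) (arm_map T) i c \<and>
    (case src of None \<Rightarrow> i \<in># arm_map T (r, c)
     | Some k \<Rightarrow> k < length (hLplus (cell T r c)) \<and> hLplus (cell T r c) ! k = i \<and> i \<notin># arm_map T (r, c))"
proof -
  let ?w = "reading_word T"
  define ms where "ms = fst (bracketing i ?w)"
  define j where "j = last ms"
  define M where "M = int (length ms)"
  note inv = bracketing_inv[of ?w i, folded ms_def]
  have height_bound: "height i (take m ?w) \<le> M" if "m \<le> length ?w" for m using inv that unfolding M_def by blast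
  have j: "j < length ?w" "fst (?w ! j) = i" "height i (take (Suc j) ?w) = M"
    and before: "\<And>m. m \<le> j \<Longrightarrow> height i (take m ?w) < M"
    using inv s unfolding M_def j_def ms_def by blast+
  obtain c k where c: "c < ncols T" "j = length (word_upto T c) + k" "k < length (col_word T c)"
    "?w ! j = col_word T c ! k"
    and tk: "\<And>m. m \<le> length (col_word T c) \<Longrightarrow> take (length (word_upto T c) + m) ?w = word_upto T c @ take m (col_word T c)"
    using word_pos[OF j(1)] by blast
  have Mh: "M = col_base (leg_map T) (arm_map T) i c + height i (take (Suc k) (col_word T c))"
    using j(3) tk[of "Suc k"] c(2,3) height_upto[OF w, of i c] by simp
  have pub: "peak (leg_map T) (arm_map T) i x \<le> M" for x using height_bound peak_pos_take[OF w, of i x] by metis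
  have cl: "leg_count (leg_map T) v c = int (letter_count v (leg_word T c))" "arm_count (arm_map T) v c = int (letter_count v (arm_word T c))" for v
    using letter_count_leg_word[OF w] letter_count_arm_word by simp_all
  have p: "peak (leg_map T) (arm_map T) i c = M \<and> (\<exists>r src. ?w ! j = (i, (r, c), src) \<and> in_shape T r c \<and>
      (case src of None \<Rightarrow> i \<in># arm_map T (r, c)
       | Some k \<Rightarrow> k < length (hLplus (cell T r c)) \<and> hLplus (cell T r c) ! k = i \<and> i \<notin># arm_map T (r, c)))"
  proof (cases "k < length (leg_word T c)")
    case True
    then have x: "?w ! j = leg_word T c ! k" using c by (simp add: col_word_eq nth_append)
    have so: "sorted_wrt (>) (map fst (leg_word T c))" using leg_word_sorted[OF w h] .
    have d: "fst y < i" if "y \<in> set (drop (Suc k) (leg_word T c))" for y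
    proof -
      obtain n where n: "n < length (leg_word T c) - Suc k" "y = leg_word T c ! (Suc k + n)"
        using \<open>y \<in> set (drop (Suc k) (leg_word T c))\<close> by (auto simp: in_set_conv_nth)
      then show ?thesis using sorted_wrt_nth_less[OF so, of k "Suc k + n"] j(2) x by simp
    qed
    have "letter_count i (drop (Suc k) (leg_word T c)) = 0" "letter_count (Suc i) (drop (Suc k) (leg_word T c)) = 0"
      using d by (fastforce simp: letter_count_def filter_empty_conv)+
    then have "height i (take (Suc k) (leg_word T c)) = height i (leg_word T c)"
      using height_simps(2)[of i "take (Suc k) (leg_word T c)" "drop (Suc k) (leg_word T c)"] by (simp add: height_def)
    \<comment> \<open>After a leg \<open>i\<close> only smaller leg entries follow, so the maximum
      is the height at the end of the legs. An arm \<open>i\<close> of this column would raise it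
      further, hence there is none.\<close>
    then have "M = col_base (leg_map T) (arm_map T) i c + height i (leg_word T c)" using Mh True by (simp add: col_word_eq)
    then have pk: "peak (leg_map T) (arm_map T) i c = M + int (letter_count i (arm_word T c))" by (simp add: peak_def cl height_def)
    then have z: "arm_count (arm_map T) i c = 0" "peak (leg_map T) (arm_map T) i c = M" using pub[of c] by (simp_all add: cl)
    obtain r n where rn: "leg_word T c ! k = (hLplus (cell T r c) ! n, (r, c), Some n)" "in_shape T r c" "n < length (hLplus (cell T r c))"
      using leg_word_letter[OF nth_mem[OF True]] by blast
    have "i \<notin># arm_map T (r, c)"
    proof
      assume iA: "i \<in># arm_map T (r, c)"
      then have "arm_count (arm_map T) i c = int (count (arm_map T (r, c)) i)" using arm_count_loc[OF h] by (simp add: ents_def)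
      then show False using z iA by (simp add: count_eq_zero_iff)
    qed
    then show ?thesis using z rn x j(2) by auto
  next
    case False
    define n where "n = k - length (leg_word T c)"
    have n: "n < length (arm_word T c)" "k = length (leg_word T c) + n" using False c(3) by (auto simp: n_def col_word_eq)
    have x: "?w ! j = arm_word T c ! n" using c n by (simp add: col_word_eq nth_append)
    have "fst y \<le> i" if "y \<in> set (take (Suc n) (arm_word T c))" for y
    proof -
      obtain q where q: "q \<le> n" "y = arm_word T c ! q"
        using \<open>y \<in> set (take (Suc n) (arm_word T c))\<close> n(1) by (auto simp: in_set_conv_nth less_Suc_eq_le)
      then show ?thesis using sorted_nth_mono[OF arm_word_sorted[of T c], of q n] n(1) j(2) x by simp
    qed
    then have z: "letter_count (Suc i) (take (Suc n) (arm_word T c)) = 0" by (fastforce simp: letter_count_def filter_empty_conv)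
    have "M = col_base (leg_map T) (arm_map T) i c + height i (leg_word T c) + int (letter_count i (take (Suc n) (arm_word T c)))"
      using Mh z unfolding n(2) by (simp add: col_word_eq height_def)
    moreover have "letter_count i (take (Suc n) (arm_word T c)) \<le> letter_count i (arm_word T c)"
      using letter_count_simps(3)[of i "take (Suc n) (arm_word T c)" "drop (Suc n) (arm_word T c)"] by simp
    ultimately have "M \<le> peak (leg_map T) (arm_map T) i c" by (simp add: peak_def cl height_def)
    then have pk: "peak (leg_map T) (arm_map T) i c = M" using pub[of c] by simp
    obtain r v where rv: "arm_word T c ! n = (v, (r, c), None)" "in_shape T r c" "v \<in> set (harm (cell T r c))"
      using arm_word_letter[OF nth_mem[OF n(1)]] by blast
    then show ?thesis using pk x j(2) by (auto simp: arm_map_in)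
  qed
  \<comment> \<open>The peak of an earlier column is the height of a prefix that does not yet
    contain letter \<open>j\<close>.\<close>
  have "peak (leg_map T) (arm_map T) i x < M" if "x < c" for x
  proof -
    have "peak_pos T i x \<le> j" using peak_pos_bounds(2)[of T i x] upto_len_mono[of "Suc x" c T] that c(2) by simp
    then show ?thesis using before peak_pos_take(2)[OF w, of i x] by metis
  qed
  moreover have "0 < M" using before[of 0] by simp
  ultimately have "first_max (leg_map T) (arm_map T) i c" using p pub by (simp add: first_max_def)
  then show ?thesis using p unfolding j_def ms_def by blast
qed

text \<open>The height of the whole word appears as the base of all sufficiently large columns,
  which avoids mentioning the number of columns on the level of the maps.\<close>

lemma e_word_none:
  assumes w: "wf_hvt T" and s: "snd (bracketing i (reading_word T)) = []"
  shows "\<exists>N0. \<forall>N\<ge>N0. height_bound (leg_map T) (arm_map T) i (col_base (leg_map T) (arm_map T) i N)"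
proof (intro exI[of _ "ncols T"] allI impI)
  fix N assume N: "ncols T \<le> N"
  note inv = bracketing_inv[of "reading_word T" i]
  have b: "col_base (leg_map T) (arm_map T) i N = height i (reading_word T)"
    using height_upto[OF w, of i N] word_upto_big[OF N] by simp
  have M: "height i (reading_word T) = int (length (fst (bracketing i (reading_word T))))" using inv s by simp
  have "peak (leg_map T) (arm_map T) i c \<le> height i (reading_word T)" for c
    using conjunct1[OF inv] peak_pos_take[OF w, of i c] M by metis
  then show "height_bound (leg_map T) (arm_map T) i (col_base (leg_map T) (arm_map T) i N)" unfolding b using M by (simp add: height_bound_def)
qed

lemma e_word_some:
  assumes w: "wf_hvt T" and h: "semistd (leg_map T) (arm_map T)" and s: "snd (bracketing i (reading_word T)) \<noteq> []"
  shows "\<exists>r c src. reading_word T ! hd (snd (bracketing i (reading_word T))) = (Suc i, (r, c), src) \<and> in_shape T r c \<and>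
    last_max (leg_map T) (arm_map T) i (src = None) c \<and>
    (case src of None \<Rightarrow> Suc i \<in># arm_map T (r, c)
     | Some k \<Rightarrow> k < length (hLplus (cell T r c)) \<and> hLplus (cell T r c) ! k = Suc i)"
proof -
  let ?w = "reading_word T"
  define qs where "qs = snd (bracketing i ?w)"
  define j where "j = hd qs"
  define M where "M = int (length (fst (bracketing i ?w)))"
  note inv = bracketing_inv[of ?w i, folded qs_def]
  have height_bound: "height i (take m ?w) \<le> M" if "m \<le> length ?w" for m using inv that unfolding M_def by blast
  have j: "j < length ?w" "fst (?w ! j) = Suc i" "height i (take j ?w) = M"
    and after: "\<And>m. j < m \<Longrightarrow> m \<le> length ?w \<Longrightarrow> height i (take m ?w) < M"
    using inv s unfolding M_def j_def qs_def by blast+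
  obtain c k where c: "c < ncols T" "j = length (word_upto T c) + k" "k < length (col_word T c)"
    "?w ! j = col_word T c ! k"
    and tk: "\<And>m. m \<le> length (col_word T c) \<Longrightarrow> take (length (word_upto T c) + m) ?w = word_upto T c @ take m (col_word T c)"
    using word_pos[OF j(1)] by blast
  have Mh: "M = col_base (leg_map T) (arm_map T) i c + height i (take k (col_word T c))"
    using j(3) tk[of k] c(2,3) height_upto[OF w, of i c] by simp
  have pub: "peak (leg_map T) (arm_map T) i x \<le> M" for x using height_bound peak_pos_take[OF w, of i x] by metis
  have M0: "0 \<le> M" by (simp add: M_def)
  have cl: "leg_count (leg_map T) v c = int (letter_count v (leg_word T c))" "arm_count (arm_map T) v c = int (letter_count v (arm_word T c))" for v
    using letter_count_leg_word[OF w] letter_count_arm_word by simp_all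
  have late: "peak (leg_map T) (arm_map T) i x < M" if "j < peak_pos T i x" for x
    using after[OF that] peak_pos_take[OF w, of i x] by metis
  have later: "peak (leg_map T) (arm_map T) i x < M" if "c < x" for x
  proof (rule late)
    have "j < length (word_upto T (Suc c))" using c by (simp add: word_upto_Suc)
    also have "\<dots> \<le> length (word_upto T x)" using that by (intro upto_len_mono) simp
    also have "\<dots> \<le> peak_pos T i x" using peak_pos_bounds(1)[of T x i] by simp
    finally show "j < peak_pos T i x" .
  qed
  have p: "\<exists>r src. ?w ! j = (Suc i, (r, c), src) \<and> in_shape T r c \<and> last_max (leg_map T) (arm_map T) i (src = None) c \<and>
      (case src of None \<Rightarrow> Suc i \<in># arm_map T (r, c)
       | Some k \<Rightarrow> k < length (hLplus (cell T r c)) \<and> hLplus (cell T r c) ! k = Suc i)"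
  proof (cases "k < length (leg_word T c)")
    case True
    then have x: "?w ! j = leg_word T c ! k" using c by (simp add: col_word_eq nth_append)
    have so: "sorted_wrt (>) (map fst (leg_word T c))" using leg_word_sorted[OF w h] .
    have d: "Suc i < fst y" if "y \<in> set (take k (leg_word T c))" for y
    proof -
      obtain n where n: "n < k" "y = leg_word T c ! n"
        using \<open>y \<in> set (take k (leg_word T c))\<close> by (auto simp: in_set_conv_nth)
      then show ?thesis using sorted_wrt_nth_less[OF so, of n k] j(2) x True by simp
    qed
    have "letter_count i (take k (leg_word T c)) = 0" "letter_count (Suc i) (take k (leg_word T c)) = 0"
      using d by (fastforce simp: letter_count_def filter_empty_conv)+
    \<comment> \<open>Before a leg \<open>Suc i\<close> only larger leg entries of the column are
      read, so the height is still the base.\<close>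
    then have Mb: "M = col_base (leg_map T) (arm_map T) i c" using Mh True by (simp add: col_word_eq height_def)
    have "peak (leg_map T) (arm_map T) i x < M" if "c \<le> x" for x
    proof (cases "x = c")
      case xc: True
      have "j < peak_pos T i c" using peak_pos_bounds(1)[of T c i] c(2) True by simp
      then show ?thesis using late xc by blast
    qed (use later that in auto)
    then have e: "last_max (leg_map T) (arm_map T) i False c" using pub M0 Mb by (simp add: last_max_def)
    obtain r n where "leg_word T c ! k = (hLplus (cell T r c) ! n, (r, c), Some n)" "in_shape T r c" "n < length (hLplus (cell T r c))"
      using leg_word_letter[OF nth_mem[OF True]] by blast
    then show ?thesis using x j(2) e by auto
  next
    case False
    define n where "n = k - length (leg_word T c)"
    have n: "n < length (arm_word T c)" "k = length (leg_word T c) + n" using False c(3) by (auto simp: n_def col_word_eq)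
    have x: "?w ! j = arm_word T c ! n" using c n by (simp add: col_word_eq nth_append)
    have "height i (take n (arm_word T c)) \<le> int (letter_count i (arm_word T c))"
      using letter_count_simps(3)[of i "take n (arm_word T c)" "drop n (arm_word T c)"] by (simp add: height_def)
    then have "M \<le> peak (leg_map T) (arm_map T) i c"
      using Mh unfolding n(2) by (simp add: col_word_eq peak_def cl height_def)
    then have pk: "peak (leg_map T) (arm_map T) i c = M" using pub[of c] by simp
    obtain r v where rv: "arm_word T c ! n = (v, (r, c), None)" "in_shape T r c" "v \<in> set (harm (cell T r c))"
      using arm_word_letter[OF nth_mem[OF n(1)]] by blast
    then have sA: "Suc i \<in># arm_map T (r, c)" using x j(2) by (simp add: arm_map_in)
    then have "arm_count (arm_map T) (Suc i) c = int (count (arm_map T (r, c)) (Suc i))" using arm_count_loc[OF h] by (simp add: ents_def)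
    moreover have "0 < count (arm_map T (r, c)) (Suc i)" using sA by simp
    ultimately have "1 \<le> arm_count (arm_map T) (Suc i) c" by linarith
    then have "last_max (leg_map T) (arm_map T) i True c" using pub later pk M0 by (simp add: last_max_def)
    then show ?thesis using rv x j(2) sA by auto
  qed
  then show ?thesis unfolding j_def qs_def by blast
qed

section \<open>Crystal operators on tableaux\<close>

lemma in_shape_upd [simp]: "in_shape (upd_cell T r c g) r' c' \<longleftrightarrow> in_shape T r' c'"
  by (cases "r < length T") (auto simp: in_shape_def upd_cell_def nth_list_update)

lemma shape_upd [simp]: "shape (upd_cell T r c g) = shape T"
  by (cases "r < length T") (auto simp: shape_def upd_cell_def map_update list_update_same_conv list_update_beyond)

lemma cell_upd: "in_shape T r c \<Longrightarrow> in_shape T r' c' \<Longrightarrow>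
    cell (upd_cell T r c g) r' c' = (if (r', c') = (r, c) then g (cell T r c) else cell T r' c')"
  by (auto simp: in_shape_def cell_def upd_cell_def nth_list_update)

lemma leg_map_upd: assumes "in_shape T r c"
  shows "leg_map (upd_cell T r c g) = (leg_map T)((r, c) := set (hLplus (g (cell T r c))))"
proof
  fix x
  show "leg_map (upd_cell T r c g) x = ((leg_map T)((r, c) := set (hLplus (g (cell T r c))))) x"
    using assms by (cases x; cases "in_shape T (fst x) (snd x)") (auto simp: leg_map_def cell_upd[OF assms])
qed

lemma arm_map_upd: assumes "in_shape T r c"
  shows "arm_map (upd_cell T r c g) = (arm_map T)((r, c) := mset (harm (g (cell T r c))))"
proof
  fix x
  show "arm_map (upd_cell T r c g) x = ((arm_map T)((r, c) := mset (harm (g (cell T r c))))) x"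
    using assms by (cases x; cases "in_shape T (fst x) (snd x)") (auto simp: arm_map_def cell_upd[OF assms])
qed

lemma wf_hvt_upd: assumes w: "wf_hvt T" and s: "in_shape T r c"
    and g: "sorted_wrt (<) (hLplus (g (cell T r c)))" "sorted (harm (g (cell T r c)))"
  shows "wf_hvt (upd_cell T r c g)"
  unfolding wf_hvt_def
proof (intro conjI allI impI ballI)
  fix row assume "row \<in> set (upd_cell T r c g)"
  then obtain n where n: "n < length T" "row = upd_cell T r c g ! n"
    by (auto simp: in_set_conv_nth upd_cell_def)
  then have "length row = length (T ! n)" by (cases "n = r") (simp_all add: upd_cell_def)
  moreover have "T ! n \<noteq> []" using w n by (auto simp: wf_hvt_def)
  ultimately show "row \<noteq> []" by auto
qed (use w g s in \<open>auto simp: wf_hvt_def cell_upd[OF s]\<close>)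

lemma wf_hvt_cell: assumes "wf_hvt T" "in_shape T r c"
  shows "sorted_wrt (<) (hLplus (cell T r c))" "sorted (harm (cell T r c))" "distinct (hLplus (cell T r c))"
    "sorted_wrt (<) (hleg (cell T r c))" "distinct (hleg (cell T r c))"
proof -
  show 1: "sorted_wrt (<) (hLplus (cell T r c))" "sorted (harm (cell T r c))" using assms by (auto simp: wf_hvt_def)
  then show "distinct (hLplus (cell T r c))" using strict_sorted_iff by blast
  show 2: "sorted_wrt (<) (hleg (cell T r c))" using 1 by (simp add: hLplus_def)
  then show "distinct (hleg (cell T r c))" using strict_sorted_iff by blast
qed

lemma hook_set_simps [simp]:
  "hLplus (set_arm h X) = hLplus h" "harm (set_arm h X) = X"
  "hLplus (set_leg h Y) = hx h # Y" "harm (set_leg h Y) = harm h"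
  "harm (set_Lplus h Z) = harm h" "Z \<noteq> [] \<Longrightarrow> hLplus (set_Lplus h Z) = Z"
  by (simp_all add: set_arm_def set_leg_def set_Lplus_def hLplus_def hx_def hleg_def harm_def)

lemma hook_tuple_simps [simp]: "hLplus (x, Y, X) = x # Y" "harm (x, Y, X) = X" "hleg (x, Y, X) = Y" "hx (x, Y, X) = x"
  by (simp_all add: hLplus_def hx_def hleg_def harm_def)

lemma strict_sorted_update:
  assumes s: "sorted_wrt (<) (xs :: nat list)" and k: "k < length xs"
    and lo: "\<And>x. x \<in> set xs \<Longrightarrow> x < xs ! k \<Longrightarrow> x < v" and hi: "\<And>x. x \<in> set xs \<Longrightarrow> xs ! k < x \<Longrightarrow> v < x"
  shows "sorted_wrt (<) (xs[k := v])" "set (xs[k := v]) = insert v (set xs - {xs ! k})"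
proof -
  note n = sorted_wrt_nth_less[OF s]
  show "sorted_wrt (<) (xs[k := v])"
    unfolding sorted_wrt_iff_nth_less
    using n lo hi k by (auto simp: nth_list_update)
  have d: "distinct xs" using s strict_sorted_iff by blast
  show "set (xs[k := v]) = insert v (set xs - {xs ! k})"
    using set_update_distinct[OF d k] .
qed

lemma strict_sorted_remove1: "sorted_wrt (<) (xs :: nat list) \<Longrightarrow> sorted_wrt (<) (remove1 v xs)"
  by (simp add: strict_sorted_iff sorted_remove1)

lemma strict_sorted_insort: "sorted_wrt (<) (xs :: nat list) \<Longrightarrow> v \<notin> set xs \<Longrightarrow> sorted_wrt (<) (insort v xs)"
  by (simp add: strict_sorted_iff sorted_insort distinct_insort)

lemma sorted_insort_remove1: "sorted (xs :: nat list) \<Longrightarrow> sorted (insort v (remove1 u xs))"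
  by (simp add: sorted_insort sorted_remove1)

lemma f_op_None:
  assumes "wf_hvt T" "f_op i T = None" shows "height_bound (leg_map T) (arm_map T) i 0"
  using assms f_word_none[OF assms(1), of i] by (auto simp: f_op_def Let_def bracketing_def split: if_splits prod.splits)

lemma f_op_Some:
  assumes v: "hvt_valid T" and f: "f_op i T = Some T'"
  shows "\<exists>r c. f_site (leg_map T) (arm_map T) i r c \<and> wf_hvt T' \<and> shape T' = shape T \<and>
    leg_map T' = f_legs i (leg_map T) (arm_map T) r c \<and> arm_map T' = f_arms i (leg_map T) (arm_map T) r c"
proof -
  note w = valid_wf[OF v] and h = valid_semistd[OF v]
  have ms: "fst (bracketing i (reading_word T)) \<noteq> []" using f by (auto simp: f_op_def Let_def bracketing_def)
  obtain r c src where x: "reading_word T ! last (fst (bracketing i (reading_word T))) = (i, (r, c), src)"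
    and s: "in_shape T r c" and fm: "first_max (leg_map T) (arm_map T) i c"
    and src: "case src of None \<Rightarrow> i \<in># arm_map T (r, c)
     | Some k \<Rightarrow> k < length (hLplus (cell T r c)) \<and> hLplus (cell T r c) ! k = i \<and> i \<notin># arm_map T (r, c)"
    using f_word_some[OF w h ms] by blast
  have inc: "i \<in> ents (leg_map T) (arm_map T) (r, c)"
    using src s by (auto simp: ents_def leg_map_in split: option.splits)
  interpret F: f_site "leg_map T" "arm_map T" i r c by unfold_locales (fact h fm inc)+
  have M: "F.M \<longleftrightarrow> in_shape T (Suc r) c \<and> Suc i \<in> set (hentries (cell T (Suc r) c))" by (simp add: ents_eq)
  have S: "F.S \<longleftrightarrow> in_shape T r (Suc c) \<and> i \<in> set (hLplus (cell T r (Suc c)))" by (simp add: leg_map_def)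
  have op: "Some T' = (if F.M then Some (upd_cell (upd_cell T r c (\<lambda>h. set_arm h (remove1 i (harm h))))
                  (Suc r) c (\<lambda>h. set_arm h (insort (Suc i) (harm h))))
        else if F.S then
          Some (upd_cell (upd_cell T r (Suc c) (\<lambda>h. set_Lplus h (remove1 i (hLplus h))))
                  r c (\<lambda>h. set_leg h (insort (Suc i) (hleg h))))
        else
          Some (upd_cell T r c (\<lambda>h. case src of
                   Some k \<Rightarrow> set_Lplus h ((hLplus h)[k := Suc i])
                 | None \<Rightarrow> set_arm h (insort (Suc i) (remove1 i (harm h))))))"
    unfolding M S using f ms x by (simp add: f_op_def Let_def bracketing_def)
  note wc = wf_hvt_cell[OF w]
  have "wf_hvt T' \<and> shape T' = shape T \<and> leg_map T' = F.L' \<and> arm_map T' = F.A'"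
  proof (cases F.M)
    case True
    then have s2: "in_shape T (Suc r) c" using M by blast
    let ?T1 = "upd_cell T r c (\<lambda>h. set_arm h (remove1 i (harm h)))"
    have T': "T' = upd_cell ?T1 (Suc r) c (\<lambda>h. set_arm h (insort (Suc i) (harm h)))" using op True by simp
    have c1: "cell ?T1 (Suc r) c = cell T (Suc r) c" using cell_upd[OF s s2] by simp
    have s2': "in_shape ?T1 (Suc r) c" using s2 by simp
    have "wf_hvt ?T1" using wc[OF s] by (intro wf_hvt_upd[OF w s]) (simp_all add: sorted_remove1)
    then have "wf_hvt T'" unfolding T' using wc[OF s2] by (intro wf_hvt_upd[OF _ s2']) (simp_all add: c1 sorted_insort)
    moreover have "leg_map T' = F.L'" unfolding F.upd_M(1)[OF True] T' leg_map_upd[OF s2'] leg_map_upd[OF s] c1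
      using s s2 by (intro ext) (auto simp: leg_map_in)
    moreover have "arm_map T' = F.A'" unfolding F.upd_M(2)[OF True] T' arm_map_upd[OF s2'] arm_map_upd[OF s] c1
      using s s2 by (intro ext) (auto simp: arm_map_in)
    ultimately show ?thesis unfolding T' by simp
  next
    case nM: False
    show ?thesis
    proof (cases F.S)
      case True
      then have s2: "in_shape T r (Suc c)" using S by blast
      let ?T1 = "upd_cell T r (Suc c) (\<lambda>h. set_Lplus h (remove1 i (hLplus h)))"
      have T': "T' = upd_cell ?T1 r c (\<lambda>h. set_leg h (insort (Suc i) (hleg h)))" using op nM True by simp
      have c1: "cell ?T1 r c = cell T r c" using cell_upd[OF s2 s] by simp
      have s': "in_shape ?T1 r c" using s by simp
      have set1: "set (remove1 i (hLplus (cell T r (Suc c)))) = leg_map T (r, Suc c) - {i}"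
        using wc(3)[OF s2] s2 by (simp add: set_remove1_eq leg_map_in)
      \<comment> \<open>\<open>set_Lplus\<close> splits a list into head and tail, so the list must
        not become empty: \<open>Suc i\<close> remains in it.\<close>
      have ne: "remove1 i (hLplus (cell T r (Suc c))) \<noteq> []"
      proof
        assume "remove1 i (hLplus (cell T r (Suc c))) = []"
        then have "leg_map T (r, Suc c) - {i} = {}" using set1 by simp
        then show False using F.S_data(6)[OF nM True] by auto
      qed
      have "Suc i \<notin> leg_map T (r, c)" using F.S_nosuc[OF nM True, of r] by (auto simp: ents_def)
      then have nsi: "Suc i \<notin> set (hleg (cell T r c))" using s by (auto simp: leg_map_in hLplus_def)
      have "hx (cell T r c) \<in> ents (leg_map T) (arm_map T) (r, c)" using s by (auto simp: ents_def leg_map_in hLplus_def)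
      then have hx: "hx (cell T r c) \<le> i" using F.S_le[OF nM True] by blast
      have lp: "sorted_wrt (<) (hx (cell T r c) # insort (Suc i) (hleg (cell T r c)))"
        using wc(1,4)[OF s] nsi hx by (auto simp: strict_sorted_insort set_insort_key hLplus_def)
      have ls: "set (hx (cell T r c) # insort (Suc i) (hleg (cell T r c))) = insert (Suc i) (leg_map T (r, c))"
        using s by (auto simp: leg_map_in set_insort_key hLplus_def)
      have "wf_hvt ?T1" using wc[OF s2] ne by (intro wf_hvt_upd[OF w s2]) (simp_all add: strict_sorted_remove1)
      then have "wf_hvt T'" unfolding T' using wc(2)[OF s] lp
        by (intro wf_hvt_upd[OF _ s']) (simp_all add: c1)
      moreover have "leg_map T' = F.L'" unfolding F.upd_S(1)[OF nM True] T' leg_map_upd[OF s'] leg_map_upd[OF s2] c1 hook_set_simps ls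
        using ne set1 by (intro ext) simp
      moreover have "arm_map T' = F.A'" unfolding F.upd_S(2)[OF nM True] T' arm_map_upd[OF s'] arm_map_upd[OF s2] c1
        using s s2 by (intro ext) (auto simp: arm_map_in)
      ultimately show ?thesis unfolding T' by simp
    next
      case nS: False
      show ?thesis
      proof (cases src)
        case None
        then have iA: "i \<in># arm_map T (r, c)" using src by simp
        have T': "T' = upd_cell T r c (\<lambda>h. set_arm h (insort (Suc i) (remove1 i (harm h))))" using op nM nS None by simp
        have "wf_hvt T'" unfolding T' using wc[OF s] by (intro wf_hvt_upd[OF w s]) (simp_all add: sorted_insort_remove1)
        moreover have "leg_map T' = F.L'" unfolding F.upd_Na(1)[OF nM nS iA] T' leg_map_upd[OF s]
          using s by (intro ext) (auto simp: leg_map_in)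
        moreover have "arm_map T' = F.A'" unfolding F.upd_Na(2)[OF nM nS iA] T' arm_map_upd[OF s]
          using s by (intro ext) (auto simp: arm_map_in)
        ultimately show ?thesis unfolding T' by simp
      next
        case (Some k)
        let ?xs = "hLplus (cell T r c)"
        have k: "k < length ?xs" "?xs ! k = i" and iA: "i \<notin># arm_map T (r, c)" using src Some by auto
        have T': "T' = upd_cell T r c (\<lambda>h. set_Lplus h ((hLplus h)[k := Suc i]))" using op nM nS Some by simp
        have ns: "Suc i \<notin> set ?xs" using F.leg_no_suc[OF iA, of r] s by (simp add: leg_map_in)
        have "Suc i < x" if "x \<in> set ?xs" "i < x" for x using that ns by (cases "x = Suc i") auto
        then have u: "sorted_wrt (<) (?xs[k := Suc i])" "set (?xs[k := Suc i]) = insert (Suc i) (set ?xs - {i})"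
          using strict_sorted_update[OF wc(1)[OF s] k(1), of "Suc i"] k(2) by auto
        have ne: "?xs[k := Suc i] \<noteq> []" using k by auto
        have "wf_hvt T'" unfolding T' using wc[OF s] u ne by (intro wf_hvt_upd[OF w s]) simp_all
        moreover have "leg_map T' = F.L'" unfolding F.upd_Nl(1)[OF nM nS iA] T' leg_map_upd[OF s]
          using s u ne by (intro ext) (simp add: leg_map_in)
        moreover have "arm_map T' = F.A'" unfolding F.upd_Nl(2)[OF nM nS iA] T' arm_map_upd[OF s]
          using s by (intro ext) (auto simp: arm_map_in)
        ultimately show ?thesis unfolding T' by simp
      qed
    qed
  qed
  then show ?thesis using F.f_site_axioms by blast
qed

lemma e_op_None:
  assumes "wf_hvt T" "e_op i T = None" shows "\<exists>N0. \<forall>N\<ge>N0. height_bound (leg_map T) (arm_map T) i (col_base (leg_map T) (arm_map T) i N)"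
  using assms e_word_none[OF assms(1), of i] by (auto simp: e_op_def Let_def bracketing_def split: if_splits prod.splits)

lemma e_op_Some:
  assumes v: "hvt_valid T" and i: "1 \<le> i" and f: "e_op i T = Some T'"
  shows "\<exists>r c arm. e_site (leg_map T) (arm_map T) i r c arm \<and> wf_hvt T' \<and> shape T' = shape T \<and>
    leg_map T' = e_legs i arm (leg_map T) (arm_map T) r c \<and> arm_map T' = e_arms i arm (leg_map T) (arm_map T) r c"
proof -
  note w = valid_wf[OF v] and h = valid_semistd[OF v]
  have ms: "snd (bracketing i (reading_word T)) \<noteq> []" using f by (auto simp: e_op_def Let_def bracketing_def)
  obtain r c src where x: "reading_word T ! hd (snd (bracketing i (reading_word T))) = (Suc i, (r, c), src)"
    and s: "in_shape T r c" and fm: "last_max (leg_map T) (arm_map T) i (src = None) c"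
    and src: "case src of None \<Rightarrow> Suc i \<in># arm_map T (r, c)
     | Some k \<Rightarrow> k < length (hLplus (cell T r c)) \<and> hLplus (cell T r c) ! k = Suc i"
    using e_word_some[OF w h ms] by blast
  have inc: "if src = None then Suc i \<in># arm_map T (r, c) else Suc i \<in> leg_map T (r, c)"
    using src s by (auto simp: leg_map_in split: option.splits) (metis nth_mem)
  interpret E: e_site "leg_map T" "arm_map T" i r c "src = None" by unfold_locales (fact h i fm inc)+
  have M: "E.M \<longleftrightarrow> 0 < r \<and> in_shape T (r - 1) c \<and> i \<in> set (hentries (cell T (r - 1) c))" by (simp add: ents_eq)
  \<comment> \<open>The hook is the first entry of a strictly sorted list, so having a smaller entry
    in it means lying in the proper leg.\<close>
  have S: "E.S \<longleftrightarrow> 0 < c \<and> in_shape T r (c - 1) \<and> Suc i \<in> set (hleg (cell T r (c - 1)))"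
  proof (cases "0 < c \<and> in_shape T r (c - 1)")
    case True
    let ?h = "cell T r (c - 1)"
    have "leg_map T (r, c - 1) = insert (hx ?h) (set (hleg ?h))" using True by (simp add: leg_map_in hLplus_def)
    moreover have "\<forall>u\<in>set (hleg ?h). hx ?h < u" using wf_hvt_cell(1)[OF w, of r "c - 1"] True by (simp add: hLplus_def)
    ultimately have "Suc i \<in> leg_map T (r, c - 1) \<and> (\<exists>u\<in>leg_map T (r, c - 1). u < Suc i) \<longleftrightarrow> Suc i \<in> set (hleg ?h)"
      by auto
    then show ?thesis using True by blast
  next
    case False
    then show ?thesis using leg_map_nonempty[of T r "c - 1"] by auto
  qed
  have op: "Some T' = (if E.M then Some (upd_cell (upd_cell T r c (\<lambda>h. set_arm h (remove1 (Suc i) (harm h))))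
                  (r - 1) c (\<lambda>h. set_arm h (insort i (harm h))))
        else if E.S then
          Some (upd_cell (upd_cell T r (c - 1) (\<lambda>h. set_leg h (remove1 (Suc i) (hleg h))))
                  r c (\<lambda>h. set_Lplus h (insort i (hLplus h))))
        else
          Some (upd_cell T r c (\<lambda>h. case src of
                   Some k \<Rightarrow> set_Lplus h ((hLplus h)[k := i])
                 | None \<Rightarrow> set_arm h (insort i (remove1 (Suc i) (harm h))))))"
    unfolding M S using f ms x by (simp add: e_op_def Let_def bracketing_def)
  note wc = wf_hvt_cell[OF w]
  have "wf_hvt T' \<and> shape T' = shape T \<and> leg_map T' = E.L' \<and> arm_map T' = E.A'"
  proof (cases E.M)
    case True
    then obtain q where q: "r = Suc q" by (cases r) auto
    then have s2: "in_shape T q c" using M True by simp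
    let ?T1 = "upd_cell T r c (\<lambda>h. set_arm h (remove1 (Suc i) (harm h)))"
    have T': "T' = upd_cell ?T1 q c (\<lambda>h. set_arm h (insort i (harm h)))"
      using op unfolding if_P[OF True] by (simp add: q)
    have c1: "cell ?T1 q c = cell T q c" using cell_upd[OF s s2] q by simp
    have s2': "in_shape ?T1 q c" using s2 by simp
    have u: "E.L' = leg_map T" "E.A' = (arm_map T)((r, c) := arm_map T (r, c) - {#Suc i#}, (q, c) := add_mset i (arm_map T (q, c)))"
      using E.upd_M[OF True] q by auto
    have "wf_hvt ?T1" using wc[OF s] by (intro wf_hvt_upd[OF w s]) (simp_all add: sorted_remove1)
    then have "wf_hvt T'" unfolding T' using wc[OF s2] by (intro wf_hvt_upd[OF _ s2']) (simp_all add: c1 sorted_insort)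
    moreover have "leg_map T' = E.L'" unfolding u T' leg_map_upd[OF s2'] leg_map_upd[OF s] c1
      using s s2 by (intro ext) (auto simp: leg_map_in)
    moreover have "arm_map T' = E.A'" unfolding u T' arm_map_upd[OF s2'] arm_map_upd[OF s] c1
      using s s2 by (intro ext) (auto simp: arm_map_in)
    ultimately show ?thesis unfolding T' by simp
  next
    case nM: False
    show ?thesis
    proof (cases E.S)
      case True
      then obtain d where d: "c = Suc d" by (cases c) auto
      then have s2: "in_shape T r d" and sl: "Suc i \<in> set (hleg (cell T r d))" using S True by auto
      let ?T1 = "upd_cell T r d (\<lambda>h. set_leg h (remove1 (Suc i) (hleg h)))"
      have T': "T' = upd_cell ?T1 r c (\<lambda>h. set_Lplus h (insort i (hLplus h)))"
        using op unfolding if_not_P[OF nM] if_P[OF True] by (simp add: d)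
      have c1: "cell ?T1 r c = cell T r c" using cell_upd[OF s2 s] d by simp
      have s': "in_shape ?T1 r c" using s by simp
      have na: "src \<noteq> None" using E.arm_nS nM True by blast
      have ni: "i \<notin> set (hLplus (cell T r c))" using E.leg_no_i[OF na, of r] s by (auto simp: ents_def leg_map_in)
      have ne: "insort i (hLplus (cell T r c)) \<noteq> []" by (metis length_insort list.size(3) nat.distinct(1))
      have u: "E.L' = (leg_map T)((r, d) := leg_map T (r, d) - {Suc i}, (r, c) := insert i (leg_map T (r, c)))" "E.A' = arm_map T"
        using E.upd_S[OF nM True] d by auto
      have "hx (cell T r d) < Suc i" using wc(1)[OF s2] sl by (simp add: hLplus_def)
      then have set1: "insert (hx (cell T r d)) (set (remove1 (Suc i) (hleg (cell T r d)))) = leg_map T (r, d) - {Suc i}"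
        using wc(5)[OF s2] s2 by (auto simp: set_remove1_eq leg_map_in hLplus_def)
      have "sorted_wrt (<) (hx (cell T r d) # remove1 (Suc i) (hleg (cell T r d)))"
        using wc(1,4)[OF s2] by (auto simp: hLplus_def strict_sorted_remove1 dest: notin_set_remove1 set_remove1_subset[THEN subsetD])
      then have "wf_hvt ?T1" using wc[OF s2] by (intro wf_hvt_upd[OF w s2]) simp_all
      then have "wf_hvt T'" unfolding T' using wc[OF s] ni ne
        by (intro wf_hvt_upd[OF _ s']) (simp_all add: c1 strict_sorted_insort)
      moreover have "leg_map T' = E.L'" unfolding u T' leg_map_upd[OF s'] leg_map_upd[OF s2] c1
        using s ne set1 by (intro ext) (auto simp: leg_map_in set_insort_key)
      moreover have "arm_map T' = E.A'" unfolding u T' arm_map_upd[OF s'] arm_map_upd[OF s2] c1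
        using s s2 by (intro ext) (auto simp: arm_map_in)
      ultimately show ?thesis unfolding T' by simp
    next
      case nS: False
      show ?thesis
      proof (cases src)
        case None
        have T': "T' = upd_cell T r c (\<lambda>h. set_arm h (insort i (remove1 (Suc i) (harm h))))" using op unfolding if_not_P[OF nM] if_not_P[OF nS] by (simp add: None)
        have "wf_hvt T'" unfolding T' using wc[OF s] by (intro wf_hvt_upd[OF w s]) (simp_all add: sorted_insort_remove1)
        moreover have "leg_map T' = E.L'" unfolding E.upd_Na(1)[OF nM None] T' leg_map_upd[OF s]
          using s by (intro ext) (auto simp: leg_map_in)
        moreover have "arm_map T' = E.A'" unfolding E.upd_Na(2)[OF nM None] T' arm_map_upd[OF s]
          using s by (intro ext) (auto simp: arm_map_in)
        ultimately show ?thesis unfolding T' by simp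
      next
        case (Some k)
        then have na: "src \<noteq> None" by simp
        let ?xs = "hLplus (cell T r c)"
        have k: "k < length ?xs" "?xs ! k = Suc i" using src Some by auto
        have T': "T' = upd_cell T r c (\<lambda>h. set_Lplus h ((hLplus h)[k := i]))" using op unfolding if_not_P[OF nM] if_not_P[OF nS] by (simp add: Some)
        have ns: "i \<notin> set ?xs" using E.leg_no_i[OF na, of r] s by (auto simp: ents_def leg_map_in)
        have "x < i" if "x \<in> set ?xs" "x < Suc i" for x using that ns by (cases "x = i") auto
        then have u: "sorted_wrt (<) (?xs[k := i])" "set (?xs[k := i]) = insert i (set ?xs - {Suc i})"
          using strict_sorted_update[OF wc(1)[OF s] k(1), of i] k(2) by auto
        have ne: "?xs[k := i] \<noteq> []" using k by auto
        have "wf_hvt T'" unfolding T' using wc[OF s] u ne by (intro wf_hvt_upd[OF w s]) simp_all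
        moreover have "leg_map T' = E.L'" unfolding E.upd_Nl(1)[OF nM nS na] T' leg_map_upd[OF s]
          using s u ne by (intro ext) (simp add: leg_map_in)
        moreover have "arm_map T' = E.A'" unfolding E.upd_Nl(2)[OF nM nS na] T' arm_map_upd[OF s]
          using s by (intro ext) (auto simp: arm_map_in)
        ultimately show ?thesis unfolding T' by simp
      qed
    qed
  qed
  then show ?thesis using E.e_site_axioms unfolding E.L'_def E.A'_def by blast
qed

section \<open>The operators are determined by their site and inverse to each other\<close>

lemma f_op_eq:
  assumes v: "hvt_valid T" and c: "first_max (leg_map T) (arm_map T) i c" "i \<in> ents (leg_map T) (arm_map T) (r, c)"
    and T': "wf_hvt T'" "leg_map T' = f_legs i (leg_map T) (arm_map T) r c" "arm_map T' = f_arms i (leg_map T) (arm_map T) r c"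
  shows "f_op i T = Some T'"
proof (cases "f_op i T")
  case None
  then show ?thesis using f_op_None[OF valid_wf[OF v] None] c(1) unfolding height_bound_def first_max_def by (meson leD)
next
  case (Some U)
  obtain r' c' where F: "f_site (leg_map T) (arm_map T) i r' c'" and U: "wf_hvt U" "leg_map U = f_legs i (leg_map T) (arm_map T) r' c'" "arm_map U = f_arms i (leg_map T) (arm_map T) r' c'"
    using f_op_Some[OF v Some] by blast
  interpret F: f_site "leg_map T" "arm_map T" i r' c' by fact
  have c': "c' = c" using first_max_unique[OF F.fmx c(1)] .
  moreover have "r' = r" using semistd_same_row[OF F.semistd c(2)] F.inc c' by simp
  ultimately show ?thesis using leg_arm_map_inj[OF U(1) T'(1)] U T' Some by simp
qed

lemma e_op_eq:
  assumes v: "hvt_valid T" and i: "1 \<le> i" and c: "last_max (leg_map T) (arm_map T) i arm c"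
    "if arm then Suc i \<in># arm_map T (r, c) else Suc i \<in> leg_map T (r, c)"
    and T': "wf_hvt T'" "leg_map T' = e_legs i arm (leg_map T) (arm_map T) r c" "arm_map T' = e_arms i arm (leg_map T) (arm_map T) r c"
  shows "e_op i T = Some T'"
proof (cases "e_op i T")
  case None
  obtain N0 where N0: "\<forall>N\<ge>N0. height_bound (leg_map T) (arm_map T) i (col_base (leg_map T) (arm_map T) i N)"
    using e_op_None[OF valid_wf[OF v] None] by blast
  obtain M where M: "\<forall>B. height_bound (leg_map T) (arm_map T) i B \<longrightarrow> M \<le> B" "\<forall>N>c. col_base (leg_map T) (arm_map T) i N < M"
    using last_max_top[OF c(1)] by blast
  \<comment> \<open>Beyond both thresholds the base would have to be at least \<open>M\<close> and
    below \<open>M\<close>.\<close>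
  define N where "N = max N0 (Suc c)"
  have "N0 \<le> N" "c < N" by (auto simp: N_def)
  then have "M \<le> col_base (leg_map T) (arm_map T) i N" "col_base (leg_map T) (arm_map T) i N < M" using N0 M by blast+
  then show ?thesis by simp
next
  case (Some U)
  obtain r' c' arm' where E: "e_site (leg_map T) (arm_map T) i r' c' arm'" and U: "wf_hvt U"
    "leg_map U = e_legs i arm' (leg_map T) (arm_map T) r' c'" "arm_map U = e_arms i arm' (leg_map T) (arm_map T) r' c'"
    using e_op_Some[OF v i Some] by blast
  interpret E: e_site "leg_map T" "arm_map T" i r' c' arm' by fact
  have a: "arm' = arm" "c' = c" using last_max_unique[OF E.emx c(1)] by auto
  have "Suc i \<in> ents (leg_map T) (arm_map T) (r, c)" using c(2) by (auto simp: ents_def split: if_splits)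
  then have "r' = r" using semistd_same_row[OF E.semistd, of "Suc i" r c r'] E.sinc a by simp
  then show ?thesis using leg_arm_map_inj[OF U(1) T'(1)] U T' Some a by simp
qed

lemma f_op_inverse:
  assumes v: "hvt_valid T" and i: "1 \<le> i" and f: "f_op i T = Some T'"
  shows "hvt_valid T'" "e_op i T' = Some T"
proof -
  obtain r c where F: "f_site (leg_map T) (arm_map T) i r c" and T': "wf_hvt T'"
    "leg_map T' = f_legs i (leg_map T) (arm_map T) r c" "arm_map T' = f_arms i (leg_map T) (arm_map T) r c"
    using f_op_Some[OF v f] by blast
  interpret F: f_site "leg_map T" "arm_map T" i r c by fact
  show v': "hvt_valid T'" using semistd_valid[OF T'(1)] F.semistd_f T' by simp
  obtain arm r' c' where e: "last_max F.L' F.A' i arm c'" "if arm then Suc i \<in># F.A' (r', c') else Suc i \<in> F.L' (r', c')"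
    "e_legs i arm F.L' F.A' r' c' = leg_map T" "e_arms i arm F.L' F.A' r' c' = arm_map T"
    using F.f_inverse by blast
  show "e_op i T' = Some T"
    by (rule e_op_eq[OF v' i _ _ valid_wf[OF v], of arm c' r']) (use e T' in simp_all)
qed

lemma e_op_inverse:
  assumes v: "hvt_valid T" and i: "1 \<le> i" and f: "e_op i T = Some T'"
  shows "hvt_valid T'" "f_op i T' = Some T"
proof -
  obtain r c arm where E: "e_site (leg_map T) (arm_map T) i r c arm" and T': "wf_hvt T'"
    "leg_map T' = e_legs i arm (leg_map T) (arm_map T) r c" "arm_map T' = e_arms i arm (leg_map T) (arm_map T) r c"
    using e_op_Some[OF v i f] by blast
  interpret E: e_site "leg_map T" "arm_map T" i r c arm by fact
  have T'': "leg_map T' = E.L'" "arm_map T' = E.A'" unfolding T' E.L'_def E.A'_def by simp_all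
  show v': "hvt_valid T'" using semistd_valid[OF T'(1)] E.semistd_e T'' by simp
  obtain r' c' where e: "first_max E.L' E.A' i c'" "i \<in> ents E.L' E.A' (r', c')"
    "f_legs i E.L' E.A' r' c' = leg_map T" "f_arms i E.L' E.A' r' c' = arm_map T"
    using E.e_inverse by blast
  show "f_op i T' = Some T"
    by (rule f_op_eq[OF v' _ _ valid_wf[OF v], of i c' r']) (use e T'' in simp_all)
qed

section \<open>Uncrowding\<close>

lemma leg_excess_0: "leg_excess T = 0 \<longleftrightarrow> (\<forall>r c. in_shape T r c \<longrightarrow> hleg (cell T r c) = [])"
proof
  assume e: "leg_excess T = 0"
  show "\<forall>r c. in_shape T r c \<longrightarrow> hleg (cell T r c) = []"
  proof (intro allI impI)
    fix r c assume "in_shape T r c"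
    then have "T ! r \<in> set T" "T ! r ! c \<in> set (T ! r)" by (auto simp: in_shape_def)
    then show "hleg (cell T r c) = []" using e by (fastforce simp: leg_excess_def cell_def)
  qed
next
  assume e: "\<forall>r c. in_shape T r c \<longrightarrow> hleg (cell T r c) = []"
  have "hleg h = []" if "row \<in> set T" "h \<in> set row" for row h
  proof -
    obtain r where r: "r < length T" "row = T ! r" using \<open>row \<in> set T\<close> by (auto simp: in_set_conv_nth)
    obtain c where c: "c < length row" "h = row ! c" using \<open>h \<in> set row\<close> unfolding in_set_conv_nth by blast
    show ?thesis using e r c by (simp add: in_shape_def cell_def)
  qed
  then show "leg_excess T = 0" unfolding leg_excess_def by simp
qed

lemma Vb_no_leg: "leg_excess T = 0 \<Longrightarrow> Vb T = T"
  by (simp add: Vb_def)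

context
  fixes T assumes w: "wf_hvt T"
begin

lemma hleg_leg_map: assumes "in_shape T r c"
  shows "v \<in> set (hleg (cell T r c)) \<longleftrightarrow> v \<in> leg_map T (r, c) \<and> (\<exists>u\<in>leg_map T (r, c). u < v)"
  using wf_hvt_cell(1)[OF w assms] assms by (auto simp: leg_map_in hLplus_def)

lemma hleg_ne: assumes "in_shape T r c"
  shows "hleg (cell T r c) \<noteq> [] \<longleftrightarrow> (\<exists>u v. u \<in> leg_map T (r, c) \<and> v \<in> leg_map T (r, c) \<and> u < v)"
  using hleg_leg_map[OF assms] by (metis list.set_intros(1) list.exhaust empty_iff empty_set)

lemma leg_row: "(\<exists>c. in_shape T r c \<and> hleg (cell T r c) \<noteq> []) \<longleftrightarrow> (\<exists>c u v. u \<in> leg_map T (r, c) \<and> v \<in> leg_map T (r, c) \<and> u < v)"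
  using hleg_ne leg_map_nonempty[of T r] by blast

end

lemma find_skip: "(\<And>x. x \<in> set xs \<Longrightarrow> \<not> P x) \<Longrightarrow> find P (xs @ ys) = find P ys"
  by (induction xs) auto

lemma find_none: "(\<And>x. x \<in> set xs \<Longrightarrow> \<not> P x) \<Longrightarrow> find P xs = None"
  by (simp add: find_None_iff)

lemma in_shape_add: assumes "r \<le> length T"
  shows "in_shape (add_cell T r h) r' c' \<longleftrightarrow> in_shape T r' c' \<or> r' = r \<and> c' = (if r < length T then length (T ! r) else 0)"
proof (cases "r < length T")
  case True
  then show ?thesis by (cases "r' = r") (auto simp: in_shape_def add_cell_def)
next
  case False
  then have r: "r = length T" using assms by simp
  show ?thesis unfolding r by (auto simp: in_shape_def add_cell_def nth_append less_Suc_eq)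
qed

lemma cell_add: assumes "r \<le> length T" "in_shape (add_cell T r h) r' c'"
  shows "cell (add_cell T r h) r' c' = (if in_shape T r' c' then cell T r' c' else h)"
proof (cases "r < length T")
  case True
  then show ?thesis using assms(2) by (cases "r' = r") (auto simp: in_shape_def cell_def add_cell_def nth_append less_Suc_eq)
next
  case False
  then have r: "r = length T" using assms by simp
  show ?thesis using assms(2) unfolding r by (cases "r' < length T") (auto simp: in_shape_def cell_def add_cell_def nth_append less_Suc_eq)
qed

lemma leg_map_add: assumes "r \<le> length T" "n = (if r < length T then length (T ! r) else 0)"
  shows "leg_map (add_cell T r h) = (leg_map T)((r, n) := set (hLplus h))"
proof
  fix x
  have "\<not> in_shape T r n" using assms by (auto simp: in_shape_def)
  then show "leg_map (add_cell T r h) x = ((leg_map T)((r, n) := set (hLplus h))) x"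
    using in_shape_add[OF assms(1), of h "fst x" "snd x"] cell_add[OF assms(1), of h "fst x" "snd x"] assms(2)
    by (cases x) (auto simp: leg_map_def)
qed

lemma arm_map_add: assumes "r \<le> length T" "n = (if r < length T then length (T ! r) else 0)"
  shows "arm_map (add_cell T r h) = (arm_map T)((r, n) := mset (harm h))"
proof
  fix x
  have "\<not> in_shape T r n" using assms by (auto simp: in_shape_def)
  then show "arm_map (add_cell T r h) x = ((arm_map T)((r, n) := mset (harm h))) x"
    using in_shape_add[OF assms(1), of h "fst x" "snd x"] cell_add[OF assms(1), of h "fst x" "snd x"] assms(2)
    by (cases x) (auto simp: arm_map_def)
qed

lemma wf_hvt_add: assumes "wf_hvt T" "r \<le> length T" "sorted_wrt (<) (hLplus h)" "sorted (harm h)"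
  shows "wf_hvt (add_cell T r h)"
  unfolding wf_hvt_def
proof (intro conjI allI impI ballI)
  fix row assume "row \<in> set (add_cell T r h)"
  then show "row \<noteq> []" using assms(1) set_update_subset_insert[of T r "T ! r @ [h]"]
    by (auto simp: add_cell_def wf_hvt_def split: if_splits)
next
  fix r' c' assume "in_shape (add_cell T r h) r' c'"
  note c = cell_add[OF assms(2) this]
  show "sorted_wrt (<) (hLplus (cell (add_cell T r h) r' c'))" "sorted (harm (cell (add_cell T r h) r' c'))"
    unfolding c using assms by (auto simp: wf_hvt_def)
qed

definition row_above :: "hvt \<Rightarrow> nat \<Rightarrow> hook list" where
  "row_above T r = (if Suc r < length T then T ! Suc r else [])"

text \<open>The numbers of a cell in the order in which the bump searches them. Leg entries do not
  occur, since the searched row lies above the topmost row with legs.\<close>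

definition hook_nums :: "hook \<Rightarrow> nat \<Rightarrow> (nat \<times> nat option \<times> nat) list" where
  "hook_nums h c = (c, None, hx h) # map (\<lambda>j. (c, Some j, harm h ! j)) [0..<length (harm h)]"

lemma uprow_shape: "in_shape T (Suc r) c \<longleftrightarrow> c < length (row_above T r)"
  by (simp add: row_above_def in_shape_def)

lemma uprow_cell: "c < length (row_above T r) \<Longrightarrow> row_above T r ! c = cell T (Suc r) c"
  by (auto simp: row_above_def cell_def split: if_splits)

section \<open>A bump of a tableau\<close>

locale bump_hvt = bump "leg_map T" "arm_map T" r c l ct for T r c l ct +
  assumes w: "wf_hvt T"
begin

lemma s: "in_shape T r c" using lin leg_map_nonempty[of T r c] by auto

lemma rT: "r < length T" using s by (simp add: in_shape_def)

lemma lleg: "l \<in> set (hleg (cell T r c))" using hleg_leg_map[OF w s] lin leg by blast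

lemma ex0: "leg_excess T \<noteq> 0" using leg_excess_0 s lleg by fastforce

lemma top_row: "top_leg_row T = r"
  unfolding top_leg_row_def
proof (rule Greatest_equality)
  show "\<exists>c. in_shape T r c \<and> hleg (cell T r c) \<noteq> []" using s lleg by fastforce
  fix y assume "\<exists>c. in_shape T y c \<and> hleg (cell T y c) \<noteq> []"
  then obtain c' u v where "u \<in> leg_map T (y, c')" "v \<in> leg_map T (y, c')" "u < v" using leg_row[OF w] by blast
  then show "y \<le> r" using top[of y u c' v] by (cases "y \<le> r") auto
qed

lemma leg_le: assumes "in_shape T r c'" "v \<in> set (hleg (cell T r c'))" shows "v < l \<or> v = l \<and> c' \<le> c"
  using assms hleg_leg_map[OF w assms(1), of v] lmax by blast

lemma max_leg: "Max (\<Union>c'\<in>{c'. c' < length (T ! r)}. set (hleg (cell T r c'))) = l"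
proof (rule Max_eqI)
  fix y assume "y \<in> (\<Union>c'\<in>{c'. c' < length (T ! r)}. set (hleg (cell T r c')))"
  then obtain c' where "c' < length (T ! r)" "y \<in> set (hleg (cell T r c'))" by blast
  then show "y \<le> l" using leg_le[of c' y] rT by (auto simp: in_shape_def)
next
  show "l \<in> (\<Union>c'\<in>{c'. c' < length (T ! r)}. set (hleg (cell T r c')))" using lleg s by (auto simp: in_shape_def)
qed simp

lemma col_eq: "(GREATEST c'. c' < length (T ! r) \<and> l \<in> set (hleg (cell T r c'))) = c"
proof (rule Greatest_equality)
  show "c < length (T ! r) \<and> l \<in> set (hleg (cell T r c))" using lleg s by (simp add: in_shape_def)
  fix y assume "y < length (T ! r) \<and> l \<in> set (hleg (cell T r y))"
  then show "y \<le> c" using leg_le[of y l] rT by (simp add: in_shape_def)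
qed

lemma max_cell: "Max (set (hleg (cell T r c))) = l"
proof -
  have "v \<le> l" if "v \<in> set (hleg (cell T r c))" for v using leg_le[OF s that] by auto
  then show ?thesis using lleg by (intro Max_eqI) auto
qed

definition "moved = filter (\<lambda>z. l \<le> z) (harm (cell T r c))"

lemma le_last: assumes "z \<in> set (harm (cell T r c))" shows "z \<le> last (harm (cell T r c))"
proof -
  obtain n where n: "n < length (harm (cell T r c))" "z = harm (cell T r c) ! n"
    using assms by (auto simp: in_set_conv_nth)
  then have "harm (cell T r c) \<noteq> []" by auto
  then show ?thesis
    using sorted_nth_mono[OF wf_hvt_cell(2)[OF w s], of n "length (harm (cell T r c)) - 1"] n by (simp add: last_conv_nth)
qed

text \<open>The arm is sorted, so its last entry is the largest; for an empty arm
  \<open>last\<close> is unspecified, but both filters return the empty list.\<close>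

lemma moved_eq: "filter (\<lambda>z. l \<le> z \<and> z \<le> last (harm (cell T r c))) (harm (cell T r c)) = moved"
  unfolding moved_def by (rule filter_cong) (auto simp: le_last)

lemma stay_eq: "filter (\<lambda>z. \<not> (l \<le> z \<and> z \<le> last (harm (cell T r c)))) (harm (cell T r c)) =
   filter (\<lambda>z. z < l) (harm (cell T r c))"
  by (rule filter_cong) (auto simp: le_last)

definition "Ta = upd_cell T r c (\<lambda>g. set_leg g (remove1 l (hleg g)))"
definition "Tb = upd_cell T r c (\<lambda>g. (hx g, remove1 l (hleg g), filter (\<lambda>z. z < l) (harm g)))"
definition "nums = concat (map (\<lambda>c'. hook_nums (row_above T r ! c') c') [0..<length (row_above T r)])"

lemma Tb_eq: "upd_cell T r c (\<lambda>g. (hx g, remove1 l (hleg g), filter (\<lambda>z. \<not> (l \<le> z \<and> z \<le> last (harm (cell T r c)))) (harm g))) = Tb"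
proof -
  have cong: "g (T ! r ! c) = g' (T ! r ! c) \<Longrightarrow> upd_cell T r c g = upd_cell T r c g'" for g g'
    by (simp add: upd_cell_def)
  show ?thesis unfolding Tb_def by (rule cong) (unfold cell_def[symmetric] stay_eq, rule refl)
qed

lemma Vb_eq: "Vb T = (case find (\<lambda>(_, _, v). l < v) nums of
      None \<Rightarrow> (if length (row_above T r) \<noteq> c then add_cell Ta (Suc r) (l, [], []) else add_cell Tb (Suc r) (l, [], sort moved))
    | Some (c1, p, v) \<Rightarrow>
        (if c1 \<noteq> c then
           upd_cell Ta (Suc r) c1 (\<lambda>g. case p of
                None \<Rightarrow> (l, insort v (hleg g), harm g)
              | Some j \<Rightarrow> (hx g, insort v (hleg g), (harm g)[j := l]))
         else upd_cell Tb (Suc r) c (\<lambda>g. (l, insort v (hleg g), sort (harm g @ moved)))))"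
  unfolding Vb_def Let_def top_row max_leg col_eq max_cell moved_eq Tb_eq Ta_def[symmetric]
    row_above_def[symmetric] hook_nums_def[symmetric] nums_def[symmetric]
  using ex0 by simp

lemma set1: "insert (hx (cell T r c)) (set (remove1 l (hleg (cell T r c)))) = leg_map T (r, c) - {l}"
proof -
  have "hx (cell T r c) < l" using wf_hvt_cell(1)[OF w s] lleg by (simp add: hLplus_def)
  then show ?thesis using wf_hvt_cell(5)[OF w s] s by (auto simp: set_remove1_eq leg_map_in hLplus_def)
qed

lemma sorted1: "sorted_wrt (<) (hx (cell T r c) # remove1 l (hleg (cell T r c)))"
  using wf_hvt_cell(1,4)[OF w s] by (auto simp: hLplus_def strict_sorted_remove1 dest: set_remove1_subset[THEN subsetD])

lemma Ta: "wf_hvt Ta" "leg_map Ta = (leg_map T)((r, c) := leg_map T (r, c) - {l})" "arm_map Ta = arm_map T"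
  "\<And>r' c'. in_shape Ta r' c' \<longleftrightarrow> in_shape T r' c'"
  "\<And>c'. in_shape T (Suc r) c' \<Longrightarrow> cell Ta (Suc r) c' = cell T (Suc r) c'"
proof -
  show "wf_hvt Ta" unfolding Ta_def using sorted1 wf_hvt_cell(2)[OF w s] by (intro wf_hvt_upd[OF w s]) simp_all
  show "leg_map Ta = (leg_map T)((r, c) := leg_map T (r, c) - {l})" unfolding Ta_def leg_map_upd[OF s] using set1 by simp
  show "arm_map Ta = arm_map T" unfolding Ta_def arm_map_upd[OF s] using s by (simp add: arm_map_in fun_upd_idem)
qed (simp_all add: Ta_def cell_upd[OF s])

lemma Tb: "wf_hvt Tb" "leg_map Tb = (leg_map T)((r, c) := leg_map T (r, c) - {l})"
  "arm_map Tb = (arm_map T)((r, c) := filter_mset (\<lambda>z. z < l) (arm_map T (r, c)))"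
  "\<And>r' c'. in_shape Tb r' c' \<longleftrightarrow> in_shape T r' c'"
  "\<And>c'. in_shape T (Suc r) c' \<Longrightarrow> cell Tb (Suc r) c' = cell T (Suc r) c'"
proof -
  show "wf_hvt Tb" unfolding Tb_def using sorted1 wf_hvt_cell(2)[OF w s]
    by (intro wf_hvt_upd[OF w s]) (simp_all add: sorted_wrt_filter)
  show "leg_map Tb = (leg_map T)((r, c) := leg_map T (r, c) - {l})" unfolding Tb_def leg_map_upd[OF s] using set1 by simp
  show "arm_map Tb = (arm_map T)((r, c) := filter_mset (\<lambda>z. z < l) (arm_map T (r, c)))"
    unfolding Tb_def arm_map_upd[OF s] using s by (simp add: arm_map_in)
qed (simp_all add: Tb_def cell_upd[OF s])

lemma len_T: "length Ta = length T" "length Tb = length T"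
  "length (Ta ! r') = length (T ! r')" "length (Tb ! r') = length (T ! r')"
proof -
  have "length (upd_cell T r c g ! r') = length (T ! r')" for g r'
    using rT by (cases "r' = r") (simp_all add: upd_cell_def)
  then show "length Ta = length T" "length Tb = length T"
    "length (Ta ! r') = length (T ! r')" "length (Tb ! r') = length (T ! r')"
    by (simp_all add: Ta_def Tb_def, simp_all add: upd_cell_def)
qed

lemma mset_moved: "mset moved = filter_mset (\<lambda>z. l \<le> z) (arm_map T (r, c))"
  using s by (simp add: moved_def arm_map_in)

lemma up_noleg: assumes "in_shape T (Suc r) c'" shows "hleg (cell T (Suc r) c') = []" "leg_map T (Suc r, c') = {hx (cell T (Suc r) c')}"
proof -
  show 1: "hleg (cell T (Suc r) c') = []"
  proof (rule ccontr)
    assume "hleg (cell T (Suc r) c') \<noteq> []"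
    then obtain u v where "u \<in> leg_map T (Suc r, c')" "v \<in> leg_map T (Suc r, c')" "u < v" using hleg_ne[OF w assms] by blast
    then show False using top[OF lessI, of u c' v] by simp
  qed
  show "leg_map T (Suc r, c') = {hx (cell T (Suc r) c')}" using assms 1 by (simp add: leg_map_in hLplus_def)
qed

lemma hook_nums_le: assumes "c' < ct" "x \<in> set (hook_nums (cell T (Suc r) c') c')" shows "\<not> (\<lambda>(_, _, v). l < v) x"
proof -
  have sh: "in_shape T (Suc r) c'" using before(1)[OF assms(1)] leg_map_nonempty by blast
  obtain v where "x = (fst x, fst (snd x), v)" "v \<in> set (hentries (cell T (Suc r) c'))"
    using assms(2) by (auto simp: hook_nums_def hentries_def)
  then show ?thesis using before(2)[OF assms(1), of v] sh by (cases x) (auto simp: ents_eq)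
qed

lemma Vb_bump: "wf_hvt (Vb T) \<and> leg_map (Vb T) = SL \<and> arm_map (Vb T) = SA"
proof (cases "in_shape T (Suc r) ct")
  case False
  then have ctn: "length (row_above T r) = ct"
  proof -
    have "ct' < length (row_above T r)" if "ct' < ct" for ct' using before(1)[OF that] leg_map_nonempty uprow_shape by blast
    then show ?thesis using False uprow_shape[of T r ct] by (metis linorder_neqE_nat not_less_iff_gr_or_eq)
  qed
  have E: "leg_map T (Suc r, ct) = {}" "arm_map T (Suc r, ct) = {#}" using False by (simp_all add: leg_map_def arm_map_def)
  then have hk: hk by (simp add: hook_above_def)
  have fn: "find (\<lambda>(_, _, v). l < v) nums = None"
  proof (rule find_none)
    fix x assume "x \<in> set nums"
    then obtain c' where "c' < ct" "x \<in> set (hook_nums (cell T (Suc r) c') c')"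
      unfolding nums_def using ctn by (auto simp: uprow_cell)
    then show "\<not> (\<lambda>(_, _, v). l < v) x" by (rule hook_nums_le)
  qed
  have le: "Suc r \<le> length Ta" "Suc r \<le> length Tb" using rT by (simp_all add: len_T)
  have nn: "ct = (if Suc r < length Ta then length (Ta ! Suc r) else 0)"
    "ct = (if Suc r < length Tb then length (Tb ! Suc r) else 0)"
    using ctn by (auto simp: len_T row_above_def)
  show ?thesis
  proof (cases "ct = c")
    case True
    have V: "Vb T = add_cell Tb (Suc r) (l, [], sort moved)" unfolding Vb_eq fn using ctn True by simp
    have "wf_hvt (Vb T)" unfolding V by (intro wf_hvt_add Tb le) simp_all
    moreover have "leg_map (Vb T) = SL" unfolding V leg_map_add[OF le(2) nn(2)] Tb SL_eq ins_hk[OF hk] E by simp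
    moreover have "arm_map (Vb T) = SA" unfolding V arm_map_add[OF le(2) nn(2)] Tb SA_hk_c[OF True]
      using E True mset_moved by simp
    ultimately show ?thesis by blast
  next
    case False
    have V: "Vb T = add_cell Ta (Suc r) (l, [], [])" unfolding Vb_eq fn using ctn False by simp
    have "wf_hvt (Vb T)" unfolding V by (intro wf_hvt_add Ta le) simp_all
    moreover have "leg_map (Vb T) = SL" unfolding V leg_map_add[OF le(1) nn(1)] Ta SL_eq ins_hk[OF hk] E by simp
    moreover have "arm_map (Vb T) = SA" unfolding V arm_map_add[OF le(1) nn(1)] Ta SA_hk[OF hk False]
      using E by (simp add: fun_upd_idem)
    ultimately show ?thesis by blast
  qed
next
  case sh: True
  let ?h = "cell T (Suc r) ct"
  note nl = up_noleg[OF sh]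
  note wc = wf_hvt_cell[OF w sh]
  have ctl: "ct < length (row_above T r)" using sh uprow_shape by blast
  have AAh: "arm_map T (Suc r, ct) = mset (harm ?h)" using sh by (simp add: arm_map_in)
  obtain rest where rest: "nums = concat (map (\<lambda>c'. hook_nums (row_above T r ! c') c') [0..<ct]) @ hook_nums ?h ct @ rest"
  proof
    have "[0..<length (row_above T r)] = [0..<ct] @ ct # [Suc ct..<length (row_above T r)]"
      using ctl upt_add_eq_append[of 0 ct "length (row_above T r) - ct"] upt_conv_Cons[of ct "length (row_above T r)"] by simp
    then show "nums = concat (map (\<lambda>c'. hook_nums (row_above T r ! c') c') [0..<ct]) @ hook_nums ?h ct @
       concat (map (\<lambda>c'. hook_nums (row_above T r ! c') c') [Suc ct..<length (row_above T r)])"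
      unfolding nums_def using ctl by (simp add: uprow_cell)
  qed
  have fb: "find (\<lambda>(_, _, v). l < v) nums = find (\<lambda>(_, _, v). l < v) (hook_nums ?h ct @ rest)"
    unfolding rest
  proof (rule find_skip)
    fix x assume "x \<in> set (concat (map (\<lambda>c'. hook_nums (row_above T r ! c') c') [0..<ct]))"
    then obtain c' where "c' < ct" "x \<in> set (hook_nums (cell T (Suc r) c') c')"
      using ctl by (auto simp: uprow_cell)
    then show "\<not> (\<lambda>(_, _, v). l < v) x" by (rule hook_nums_le)
  qed
  show ?thesis
  proof (cases hk)
    case True
    have lt: "l < hx ?h" using True nl(2) by (simp add: hook_above_def)
    have f: "find (\<lambda>(_, _, v). l < v) nums = Some (ct, None, hx ?h)" unfolding fb using lt by (simp add: hook_nums_def)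
    show ?thesis
    proof (cases "ct = c")
      case ctc: True
      have V: "Vb T = upd_cell Tb (Suc r) c (\<lambda>g. (l, insort (hx ?h) (hleg g), sort (harm g @ moved)))"
        unfolding Vb_eq f using ctc by simp
      have sb: "in_shape Tb (Suc r) c" "cell Tb (Suc r) c = ?h" using sh Tb(4,5) ctc by simp_all
      have "wf_hvt (Vb T)" unfolding V by (intro wf_hvt_upd[OF Tb(1) sb(1)]) (simp_all add: sb nl lt)
      moreover have "leg_map (Vb T) = SL" unfolding V leg_map_upd[OF sb(1)] Tb SL_eq ins_hk[OF True] sb(2)
        using nl ctc by simp
      moreover have "arm_map (Vb T) = SA" unfolding V arm_map_upd[OF sb(1)] Tb SA_hk_c[OF ctc] sb(2)
        using AAh ctc mset_moved by simp
      ultimately show ?thesis by blast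
    next
      case ctc: False
      have V: "Vb T = upd_cell Ta (Suc r) ct (\<lambda>g. (l, insort (hx ?h) (hleg g), harm g))"
        unfolding Vb_eq f using ctc by simp
      have sb: "in_shape Ta (Suc r) ct" "cell Ta (Suc r) ct = ?h" using sh Ta(4,5) by simp_all
      have "wf_hvt (Vb T)" unfolding V using wc by (intro wf_hvt_upd[OF Ta(1) sb(1)]) (simp_all add: sb nl lt)
      moreover have "leg_map (Vb T) = SL" unfolding V leg_map_upd[OF sb(1)] Ta SL_eq ins_hk[OF True] sb(2)
        using nl by simp
      moreover have "arm_map (Vb T) = SA" unfolding V arm_map_upd[OF sb(1)] Ta SA_hk[OF True ctc] sb(2)
        using AAh by (simp add: fun_upd_idem)
      ultimately show ?thesis by blast
    qed
  next
    case False
    note n = nhk[OF False]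
    have hl: "hx ?h \<le> l" using n(5) nl(2) by auto
    have kin: "k \<in> set (harm ?h)" using n(2) AAh by simp
    \<comment> \<open>The leftmost arm position with an entry above \<open>l\<close>, at which the
      search stops; by sortedness its entry is the least one above \<open>l\<close>, that is
      \<open>k\<close>.\<close>
    define j where "j = (LEAST j. j < length (harm ?h) \<and> l < harm ?h ! j)"
    obtain j0 where "j0 < length (harm ?h)" "harm ?h ! j0 = k" using kin by (metis in_set_conv_nth)
    then have j0: "j0 < length (harm ?h) \<and> l < harm ?h ! j0" using n(3) by simp
    have j: "j < length (harm ?h)" "l < harm ?h ! j" using LeastI[of "\<lambda>j. j < length (harm ?h) \<and> l < harm ?h ! j", OF j0] by (auto simp: j_def)
    have jm: "\<not> l < harm ?h ! m" if "m < j" for m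
      using not_less_Least[of m "\<lambda>j. j < length (harm ?h) \<and> l < harm ?h ! j"] that j(1) by (auto simp: j_def)
    have kj: "k = harm ?h ! j"
    proof (rule antisym)
      show "k \<le> harm ?h ! j" using n(4)[of "harm ?h ! j"] j AAh by simp
      obtain m where m: "m < length (harm ?h)" "harm ?h ! m = k" using kin by (metis in_set_conv_nth)
      then have "j \<le> m" using jm[of m] n(3) by (cases "j \<le> m") auto
      then show "harm ?h ! j \<le> k" using sorted_nth_mono[OF wc(2), of j m] m by simp
    qed
    have f: "find (\<lambda>(_, _, v). l < v) nums = Some (ct, Some j, k)"
    proof -
      have "find (\<lambda>(_, _, v). l < v) (map (\<lambda>j. (ct, Some j, harm ?h ! j)) [0..<length (harm ?h)] @ rest) = Some (ct, Some j, k)"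
        unfolding find_Some_iff
        using j jm kj by (intro exI[of _ j]) (auto simp: nth_append)
      then show ?thesis unfolding fb hook_nums_def using hl by simp
    qed
    have ctc: "ct \<noteq> c" using n(1) by simp
    have V: "Vb T = upd_cell Ta (Suc r) ct (\<lambda>g. (hx g, insort k (hleg g), (harm g)[j := l]))"
      unfolding Vb_eq f using ctc by simp
    have sb: "in_shape Ta (Suc r) ct" "cell Ta (Suc r) ct = ?h" using sh Ta(4,5) by simp_all
    have so: "sorted ((harm ?h)[j := l])"
      unfolding sorted_iff_nth_mono_less
    proof (intro allI impI)
      fix a b assume ab: "a < b" "b < length ((harm ?h)[j := l])"
      have m: "harm ?h ! a \<le> harm ?h ! b" using sorted_nth_mono[OF wc(2), of a b] ab by simp
      show "(harm ?h)[j := l] ! a \<le> (harm ?h)[j := l] ! b"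
        using m ab j jm[of a] by (auto simp: nth_list_update)
    qed
    have ms: "mset ((harm ?h)[j := l]) = add_mset l (mset (harm ?h) - {#k#})"
      unfolding kj using mset_update[OF j(1)] by simp
    have "wf_hvt (Vb T)" unfolding V using so hl n(3) by (intro wf_hvt_upd[OF Ta(1) sb(1)]) (simp_all add: sb nl)
    moreover have "leg_map (Vb T) = SL" unfolding V leg_map_upd[OF sb(1)] Ta SL_eq ins_nhk[OF False] sb(2)
      using nl by (simp add: insert_commute)
    moreover have "arm_map (Vb T) = SA" unfolding V arm_map_upd[OF sb(1)] Ta SA_nhk[OF False] sb(2)
      using AAh ms by simp
    ultimately show ?thesis by blast
  qed
qed

end

lemma bump_exists:
  assumes v: "hvt_valid T" and e: "leg_excess T \<noteq> 0"
  shows "\<exists>r c l ct. bump_hvt T r c l ct"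
proof -
  note w = valid_wf[OF v] and h = valid_semistd[OF v]
  interpret filling "leg_map T" "arm_map T" by unfold_locales (rule h)
  let ?P = "\<lambda>r. \<exists>c u v. u \<in> leg_map T (r, c) \<and> v \<in> leg_map T (r, c) \<and> u < v"
  have bd: "r < length T \<and> c < length (T ! r)" if "u \<in> leg_map T (r, c)" for r c u
    using that leg_map_nonempty[of T r c] by (auto simp: in_shape_def)
  obtain r0 c0 where "in_shape T r0 c0" "hleg (cell T r0 c0) \<noteq> []" using e unfolding leg_excess_0 by blast
  then have P0: "?P r0" using leg_row[OF w, of r0] by blast
  define r where "r = (GREATEST r. ?P r)"
  have Pb: "y \<le> length T" if "?P y" for y using that bd by (meson less_imp_le)
  have Pr: "?P r" unfolding r_def using GreatestI_nat[of ?P, OF P0] Pb by blast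
  have rmax: "y \<le> r" if "?P y" for y unfolding r_def using Greatest_le_nat[of ?P, OF that] Pb by blast
  let ?Q = "\<lambda>l. \<exists>c u. u \<in> leg_map T (r, c) \<and> l \<in> leg_map T (r, c) \<and> u < l"
  have fin: "finite {l. ?Q l}"
  proof (rule finite_subset)
    show "{l. ?Q l} \<subseteq> (\<Union>c\<in>{..<length (T ! r)}. leg_map T (r, c))" using bd by blast
  qed (simp add: leg_map_def)
  have ne: "{l. ?Q l} \<noteq> {}" using Pr by blast
  define l where "l = Max {l. ?Q l}"
  have Ql: "?Q l" using Max_in[OF fin ne] by (simp add: l_def)
  have lmax: "y \<le> l" if "?Q y" for y using Max_ge[OF fin] that by (simp add: l_def)
  let ?R = "\<lambda>c. \<exists>u. u \<in> leg_map T (r, c) \<and> l \<in> leg_map T (r, c) \<and> u < l"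
  define c where "c = (GREATEST c. ?R c)"
  obtain c1 where c1: "?R c1" using Ql by blast
  have Rb: "y \<le> length (T ! r)" if "?R y" for y using that bd by (meson less_imp_le)
  have Rc: "?R c" unfolding c_def using GreatestI_nat[of ?R, OF c1] Rb by blast
  have cmax: "y \<le> c" if "?R y" for y unfolding c_def using Greatest_le_nat[of ?R, OF that] Rb by blast
  let ?S = "\<lambda>c'. leg_map T (Suc r, c') = {} \<or> (\<exists>v\<in>ents (leg_map T) (arm_map T) (Suc r, c'). l < v)"
  define ct where "ct = (LEAST c'. ?S c')"
  \<comment> \<open>The place after the end of row \<open>r + 1\<close> is empty, so the least
    column exists. If this row does not exist, all its places are empty.\<close>
  have "leg_map T (Suc r, length (T ! Suc r)) = {}" using bd[of _ "Suc r" "length (T ! Suc r)"] by blast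
  then have St: "?S ct" unfolding ct_def by (intro LeastI[of ?S "length (T ! Suc r)"]) blast
  have Sb: "\<not> ?S c'" if "c' < ct" for c' using not_less_Least[of c' ?S] that by (simp add: ct_def)
  have "bump (leg_map T) (arm_map T) r c l ct"
  proof (intro bump.intro bump_axioms.intro filling.intro)
    show "semistd (leg_map T) (arm_map T)" by fact
    show "u = v" if "r < r'" "u \<in> leg_map T (r', c')" "v \<in> leg_map T (r', c')" for r' c' u v
    proof (rule ccontr)
      assume "u \<noteq> v"
      then have "?P r'" using that by (metis linorder_neqE_nat)
      then show False using rmax that(1) by fastforce
    qed
    show "l \<in> leg_map T (r, c)" "\<exists>u\<in>leg_map T (r, c). u < l" using Rc by blast+
    show "v < l \<or> v = l \<and> c' \<le> c" if "u \<in> leg_map T (r, c')" "v \<in> leg_map T (r, c')" "u < v" for c' u v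
    proof -
      have "v \<le> l" using lmax that by blast
      moreover have "c' \<le> c" if "v = l" using cmax \<open>u \<in> leg_map T (r, c')\<close> \<open>v \<in> leg_map T (r, c')\<close> \<open>u < v\<close> that by blast
      ultimately show ?thesis by linarith
    qed
    show "leg_map T (Suc r, c') \<noteq> {}" if "c' < ct" for c' using Sb[OF that] by blast
    show "v \<le> l" if "c' < ct" "v \<in> ents (leg_map T) (arm_map T) (Suc r, c')" for c' v using Sb[OF that(1)] that(2) by (meson not_less)
    show "?S ct" by (rule St)
  qed
  then have "bump_hvt T r c l ct" using w by (simp add: bump_hvt_def bump_hvt_axioms_def)
  then show ?thesis by blast
qed

lemma valid_Vb: assumes "hvt_valid T" shows "hvt_valid (Vb T)"
proof (cases "leg_excess T = 0")
  case True
  then show ?thesis using assms by (simp add: Vb_no_leg)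
next
  case False
  obtain r c l ct where "bump_hvt T r c l ct" using bump_exists[OF assms False] by blast
  then interpret B: bump_hvt T r c l ct .
  show ?thesis using semistd_valid[of "Vb T"] B.Vb_bump B.semistd_b by simp
qed

section \<open>f_i, shapes and leg lengths\<close>

lemma shape_f: "hvt_valid T \<Longrightarrow> f_op i T = Some T' \<Longrightarrow> shape T' = shape T"
  using f_op_Some by blast

lemma in_shape_shape: "shape T = shape T' \<Longrightarrow> in_shape T r c \<longleftrightarrow> in_shape T' r c"
proof -
  assume s: "shape T = shape T'"
  have "in_shape T r c \<longleftrightarrow> r < length (shape T) \<and> c < shape T ! r" for T
    by (auto simp: in_shape_def shape_def)
  then show ?thesis using s by simp
qed

text \<open>Only (S) changes leg lengths: one entry passes to the left neighbour. An extended leg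
  includes the hook, so the bounds 0 and 2 say that the left cell exists and that the right cell had
  a nonempty leg.\<close>

lemma (in f_site) card_f_legs:
  shows "(\<forall>x. card (f_legs i L A r c x) = card (L x)) \<or>
    (card (f_legs i L A r c (r, c)) = Suc (card (L (r, c))) \<and> 0 < card (L (r, c)) \<and>
     card (L (r, Suc c)) = Suc (card (f_legs i L A r c (r, Suc c))) \<and> 2 \<le> card (L (r, Suc c)) \<and>
     (\<forall>x. x \<noteq> (r, c) \<longrightarrow> x \<noteq> (r, Suc c) \<longrightarrow> card (f_legs i L A r c x) = card (L x)))"
proof -
  have fin: "finite (L x)" for x using semistd_finite[OF semistd] .
  consider (M) M | (S) "\<not> M" S | (Na) "\<not> M" "\<not> S" "i \<in># A (r, c)" | (Nl) "\<not> M" "\<not> S" "i \<notin># A (r, c)" by blast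
  then show ?thesis
  proof cases
    case Nl
    have "Suc i \<notin> L (r, c)" "i \<in> L (r, c)" using leg_no_suc leg_i Nl(3) by blast+
    then have "card (insert (Suc i) (L (r, c) - {i})) = card (L (r, c))"
      using fin card_gt_0_iff[of "L (r, c)"] by auto
    then show ?thesis using Nl by (simp add: f_legs_def)
  next
    case S
    have "Suc i \<notin> L (r, c)" using S_nosuc[OF S, of r] leg_ents by blast
    moreover have "L (r, c) \<noteq> {}" using ents_nonempty[OF semistd inc] .
    moreover have "card {i, Suc i} \<le> card (L (r, Suc c))"
      using S_data(6)[OF S] S(2) fin by (intro card_mono) auto
    moreover have "card (L (r, Suc c)) = Suc (card (L (r, Suc c) - {i}))"
      using S(2) fin card_Suc_Diff1 by metis
    moreover have "f_legs i L A r c = L((r, Suc c) := L (r, Suc c) - {i}, (r, c) := insert (Suc i) (L (r, c)))"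
      using S by (simp add: f_legs_def)
    ultimately show ?thesis
      using fin[of "(r, c)"] card_gt_0_iff[of "L (r, c)"] by (intro disjI2) (simp del: card_Diff_singleton)
  qed (simp_all add: f_legs_def)
qed

lemma card_leg_map: assumes "wf_hvt T" "in_shape T r c"
  shows "card (leg_map T (r, c)) = Suc (length (hleg (cell T r c)))"
proof -
  have "distinct (hLplus (cell T r c))"
    using assms strict_sorted_iff[of "hLplus (cell T r c)"] by (simp add: wf_hvt_def)
  then show ?thesis using distinct_card[of "hLplus (cell T r c)"] assms(2) by (simp add: leg_map_in hLplus_def)
qed

lemma leg_length_f:
  assumes v: "hvt_valid T" and f: "f_op i T = Some T'"
  obtains (same) "\<And>r c. in_shape T r c \<Longrightarrow> length (hleg (cell T' r c)) = length (hleg (cell T r c))"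
  | (move) r0 c0 where "in_shape T r0 (Suc c0)"
      "length (hleg (cell T' r0 c0)) = Suc (length (hleg (cell T r0 c0)))"
      "length (hleg (cell T r0 (Suc c0))) = Suc (length (hleg (cell T' r0 (Suc c0))))"
      "\<And>r c. in_shape T r c \<Longrightarrow> (r, c) \<noteq> (r0, c0) \<Longrightarrow> (r, c) \<noteq> (r0, Suc c0) \<Longrightarrow>
         length (hleg (cell T' r c)) = length (hleg (cell T r c))"
proof -
  obtain r0 c0 where F: "f_site (leg_map T) (arm_map T) i r0 c0" and T': "wf_hvt T'" "shape T' = shape T"
      "leg_map T' = f_legs i (leg_map T) (arm_map T) r0 c0"
    using f_op_Some[OF v f] by blast
  have sh: "in_shape T' r c \<longleftrightarrow> in_shape T r c" for r c using in_shape_shape[OF T'(2)] .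
  have cT: "card (leg_map T (r, c)) = Suc (length (hleg (cell T r c)))"
    and cT': "card (leg_map T' (r, c)) = Suc (length (hleg (cell T' r c)))" if "in_shape T r c" for r c
    using card_leg_map[OF valid_wf[OF v] that] card_leg_map[OF T'(1)] that sh by blast+
  from f_site.card_f_legs[OF F] show ?thesis unfolding T'(3)[symmetric]
  proof
    assume "\<forall>x. card (leg_map T' x) = card (leg_map T x)"
    then show ?thesis using cT cT' same by simp
  next
    assume H: "card (leg_map T' (r0, c0)) = Suc (card (leg_map T (r0, c0))) \<and> 0 < card (leg_map T (r0, c0)) \<and>
     card (leg_map T (r0, Suc c0)) = Suc (card (leg_map T' (r0, Suc c0))) \<and> 2 \<le> card (leg_map T (r0, Suc c0)) \<and>
     (\<forall>x. x \<noteq> (r0, c0) \<longrightarrow> x \<noteq> (r0, Suc c0) \<longrightarrow> card (leg_map T' x) = card (leg_map T x))"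
    have s: "in_shape T r0 c0" "in_shape T r0 (Suc c0)"
      using H leg_map_nonempty[of T r0 c0] leg_map_nonempty[of T r0 "Suc c0"] by fastforce+
    show ?thesis
    proof (rule move[OF s(2)])
      show "length (hleg (cell T' r c)) = length (hleg (cell T r c))"
        if "in_shape T r c" "(r, c) \<noteq> (r0, c0)" "(r, c) \<noteq> (r0, Suc c0)" for r c
        using H that cT[OF that(1)] cT'[OF that(1)] by simp
    qed (use H cT[OF s(1)] cT'[OF s(1)] cT[OF s(2)] cT'[OF s(2)] in simp_all)
  qed
qed

text \<open>(S) stays in one row: the right cell has a nonempty leg before, the left cell has one
  afterwards.\<close>

lemma leg_rows_f:
  assumes v: "hvt_valid T" and f: "f_op i T = Some T'"
  shows "(\<exists>c. in_shape T' r c \<and> hleg (cell T' r c) \<noteq> []) \<longleftrightarrow> (\<exists>c. in_shape T r c \<and> hleg (cell T r c) \<noteq> [])"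
proof -
  have sh: "in_shape T' r c \<longleftrightarrow> in_shape T r c" for r c using in_shape_shape[OF shape_f[OF v f]] .
  show ?thesis unfolding sh
  proof (cases rule: leg_length_f[OF v f])
    case 1
    then show "(\<exists>c. in_shape T r c \<and> hleg (cell T' r c) \<noteq> []) \<longleftrightarrow> (\<exists>c. in_shape T r c \<and> hleg (cell T r c) \<noteq> [])"
      by (metis length_0_conv)
  next
    case (2 r0 c0)
    show "(\<exists>c. in_shape T r c \<and> hleg (cell T' r c) \<noteq> []) \<longleftrightarrow> (\<exists>c. in_shape T r c \<and> hleg (cell T r c) \<noteq> [])"
    proof (cases "r = r0")
      case True
      have "in_shape T r0 c0" using 2(1) by (simp add: in_shape_def)
      moreover have "hleg (cell T' r0 c0) \<noteq> []" "hleg (cell T r0 (Suc c0)) \<noteq> []" using 2(2,3) by auto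
      ultimately show ?thesis using 2(1) True by blast
    next
      case False
      then show ?thesis using 2(4)[of r] by (metis Pair_inject length_0_conv)
    qed
  qed
qed

lemma leg_excess_sum: "leg_excess T = (\<Sum>r<length T. \<Sum>c<length (T ! r). length (hleg (cell T r c)))"
  by (simp add: leg_excess_def sum_list_sum_nth cell_def atLeast0LessThan)

lemma leg_excess_f:
  assumes v: "hvt_valid T" and f: "f_op i T = Some T'"
  shows "leg_excess T' = leg_excess T"
proof -
  have "map length T' = map length T" using shape_f[OF v f] by (simp add: shape_def)
  then have len: "length T' = length T" and lr: "length (T' ! r) = length (T ! r)" if "r < length T" for r
    using that by (metis length_map, metis length_map nth_map)
  have len: "length T' = length T" using shape_f[OF v f] by (metis length_map shape_def)
  have "(\<Sum>c<length (T ! r). length (hleg (cell T' r c))) = (\<Sum>c<length (T ! r). length (hleg (cell T r c)))"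
    if r: "r < length T" for r
  proof (cases rule: leg_length_f[OF v f])
    case 1
    then show ?thesis using r by (intro sum.cong) (auto simp: in_shape_def)
  next
    case (2 r0 c0)
    show ?thesis
    proof (cases "r = r0")
      case True
      let ?I = "{..<length (T ! r)} - {c0, Suc c0}"
      have c: "Suc c0 < length (T ! r)" using 2(1) True by (simp add: in_shape_def)
      have I: "{..<length (T ! r)} = insert c0 (insert (Suc c0) ?I)" using c by auto
      have split: "(\<Sum>c<length (T ! r). g c) = g c0 + (g (Suc c0) + sum g ?I)" for g :: "nat \<Rightarrow> nat"
        by (subst I) (subst sum.insert; simp)+
      have "(\<Sum>c\<in>?I. length (hleg (cell T' r c))) = (\<Sum>c\<in>?I. length (hleg (cell T r c)))"
        by (intro sum.cong refl 2(4)) (use r True in \<open>auto simp: in_shape_def\<close>)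
      then show ?thesis unfolding split using 2(2,3) True by simp
    next
      case False
      then show ?thesis using r by (intro sum.cong refl 2(4)) (auto simp: in_shape_def)
    qed
  qed
  then show ?thesis unfolding leg_excess_sum len using lr by simp
qed

lemma f_op_Vb:
  assumes v: "hvt_valid T" and i: "1 \<le> i"
  shows "f_op i (Vb T) = map_option Vb (f_op i T)"
proof (cases "leg_excess T = 0")
  case True
  then show ?thesis using leg_excess_f[OF v, of i] by (cases "f_op i T") (simp_all add: Vb_no_leg)
next
  case False
  obtain r c l ct where "bump_hvt T r c l ct" using bump_exists[OF v False] by blast
  then interpret B: bump_hvt T r c l ct .
  note V = B.Vb_bump and vV = valid_Vb[OF v]
  show ?thesis
  proof (cases "f_op i T")
    case None
    \<comment> \<open>The height bound 0 is inherited, so no column of the bumped tableau has a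
      positive peak.\<close>
    have "height_bound (leg_map (Vb T)) (arm_map (Vb T)) i 0" using B.height_bound_bump[OF f_op_None[OF valid_wf[OF v] None]] V by simp
    then have "\<not> first_max (leg_map (Vb T)) (arm_map (Vb T)) i c'" for c' unfolding height_bound_def first_max_def by (meson leD)
    then have "f_op i (Vb T) = None" using f_op_Some[OF vV, of i] f_site.fmx by (cases "f_op i (Vb T)") blast+
    then show ?thesis using None by simp
  next
    case (Some T')
    obtain r0 c0 where F: "f_site (leg_map T) (arm_map T) i r0 c0" and T': "wf_hvt T'"
      "leg_map T' = f_legs i (leg_map T) (arm_map T) r0 c0" "arm_map T' = f_arms i (leg_map T) (arm_map T) r0 c0"
      using f_op_Some[OF v Some] by blast
    interpret bump_f "leg_map T" "arm_map T" r c l ct i r0 c0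
      by (intro bump_f.intro B.bump_axioms F)
    obtain c' l' ct' r1 c1 where C: "bump (leg_map T') (arm_map T') r c' l' ct'" "first_max B.SL B.SA i c1" "i \<in> ents B.SL B.SA (r1, c1)"
      "f_legs i B.SL B.SA r1 c1 = bump_legs (leg_map T') (arm_map T') r c' l' ct'" "f_arms i B.SL B.SA r1 c1 = bump_arms (leg_map T') (arm_map T') r c' l' ct'"
      using comm unfolding comm_def T'(2,3) by blast
    \<comment> \<open>\<open>Vb\<close> realises any parameters with the extremal properties, so the
      bump found for the filling of \<open>T'\<close> is the one that \<open>Vb\<close> performs on
      \<open>T'\<close>.\<close>
    interpret B': bump_hvt T' r c' l' ct' using C(1) T'(1) by (simp add: bump_hvt_def bump_hvt_axioms_def)
    have "f_op i (Vb T) = Some (Vb T')"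
      by (rule f_op_eq[OF vV, of i c1 r1]) (use C V B'.Vb_bump in \<open>simp_all add: B'.SL_def B'.SA_def\<close>)
    then show ?thesis using Some by simp
  qed
qed

lemma e_op_None_height_bound:
  assumes v: "hvt_valid T" and i: "1 \<le> i"
  shows "e_op i T = None \<longleftrightarrow> (\<exists>N0. \<forall>N\<ge>N0. height_bound (leg_map T) (arm_map T) i (col_base (leg_map T) (arm_map T) i N))"
proof
  assume "\<exists>N0. \<forall>N\<ge>N0. height_bound (leg_map T) (arm_map T) i (col_base (leg_map T) (arm_map T) i N)"
  then obtain N0 where N0: "\<forall>N\<ge>N0. height_bound (leg_map T) (arm_map T) i (col_base (leg_map T) (arm_map T) i N)" by blast
  show "e_op i T = None"
  proof (rule ccontr)
    assume "e_op i T \<noteq> None"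
    then obtain U where "e_op i T = Some U" by auto
    then obtain r c arm where E: "e_site (leg_map T) (arm_map T) i r c arm" using e_op_Some[OF v i] by blast
    obtain M where M: "\<forall>B. height_bound (leg_map T) (arm_map T) i B \<longrightarrow> M \<le> B" "\<forall>N>c. col_base (leg_map T) (arm_map T) i N < M"
      using last_max_top[OF e_site.emx[OF E]] by blast
    define N where "N = max N0 (Suc c)"
    have "N0 \<le> N" "c < N" by (auto simp: N_def)
    then have "M \<le> col_base (leg_map T) (arm_map T) i N" "col_base (leg_map T) (arm_map T) i N < M" using N0 M by blast+
    then show False by simp
  qed
qed (rule e_op_None[OF valid_wf[OF v]])

text \<open>Bases beyond column \<open>c\<close> do not change and height bounds are inherited, so
  the final height stays maximal.\<close>

lemma e_op_Vb_None:
  assumes v: "hvt_valid T" and i: "1 \<le> i" and e: "e_op i T = None"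
  shows "e_op i (Vb T) = None"
proof (cases "leg_excess T = 0")
  case True
  then show ?thesis using e by (simp add: Vb_no_leg)
next
  case False
  obtain r c l ct where "bump_hvt T r c l ct" using bump_exists[OF v False] by blast
  then interpret B: bump_hvt T r c l ct .
  obtain N0 where N0: "\<forall>N\<ge>N0. height_bound (leg_map T) (arm_map T) i (col_base (leg_map T) (arm_map T) i N)"
    using e e_op_None_height_bound[OF v i] by blast
  have b: "col_base B.SL B.SA i N = col_base (leg_map T) (arm_map T) i N" if "c < N" for N
  proof (cases "ct = c")
    case True
    show ?thesis unfolding B.peak_c(2)[OF True] ..
  next
    case False
    then have "ct < c" using B.ct_le by simp
    then show ?thesis using B.col_base_bump[of i N] that by simp
  qed
  have "height_bound (leg_map (Vb T)) (arm_map (Vb T)) i (col_base (leg_map (Vb T)) (arm_map (Vb T)) i N)" if "max N0 (Suc c) \<le> N" for N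
    using B.height_bound_bump[of i "col_base (leg_map T) (arm_map T) i N"] N0 that b[of N] B.Vb_bump by simp
  then show ?thesis using e_op_None_height_bound[OF valid_Vb[OF v] i] by blast
qed

section \<open>Iterated bumps and the uncrowding map\<close>

lemma valid_Vb_pow: "hvt_valid T \<Longrightarrow> hvt_valid ((Vb ^^ d) T)"
  by (induction d) (auto intro: valid_Vb)

lemma f_op_Vb_pow: assumes "hvt_valid T" "1 \<le> i" "f_op i T = Some T'"
  shows "f_op i ((Vb ^^ d) T) = Some ((Vb ^^ d) T')"
  by (induction d) (use assms f_op_Vb[OF valid_Vb_pow[OF assms(1)] assms(2)] in auto)

lemma f_op_inj: assumes "hvt_valid T" "hvt_valid U" "1 \<le> i" "f_op i T = Some T'" "f_op i U = Some T'" shows "T = U"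
  using f_op_inverse(2)[OF assms(1,3,4)] f_op_inverse(2)[OF assms(2,3,5)] by simp

text \<open>The number of bumps is defined by shapes and by equality of iterates. f_i preserves
  shapes, and being injective it preserves and reflects equality, so the number is the same for
  \<open>T\<close> and \<open>T'\<close>.\<close>

lemma V_ins_f: assumes v: "hvt_valid T" and i: "1 \<le> i" and f: "f_op i T = Some T'"
  shows "f_op i (V_ins T) = Some (V_ins T')"
proof -
  have sh: "shape ((Vb ^^ d) T') = shape ((Vb ^^ d) T)" for d
    using shape_f[OF valid_Vb_pow[OF v] f_op_Vb_pow[OF v i f]] .
  have eq: "(Vb ^^ d) T' = (Vb ^^ e) T' \<longleftrightarrow> (Vb ^^ d) T = (Vb ^^ e) T" for d e
    using f_op_Vb_pow[OF v i f, of d] f_op_Vb_pow[OF v i f, of e]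
      f_op_inj[OF valid_Vb_pow[OF v] valid_Vb_pow[OF v] i, of d _ e] by auto
  show ?thesis unfolding V_ins_def sh sh[of 0, simplified] eq by (rule f_op_Vb_pow[OF v i f])
qed

lemma V_ins_pow: "\<exists>d. V_ins T = (Vb ^^ d) T"
  unfolding V_ins_def by blast

lemma unc_step_fst: "fst (unc_step a) = V_ins (fst a)"
  by (simp add: unc_step_def Let_def)

lemma unc_step_snd: "snd (unc_step a) = (snd a)
  ((THE p. in_shape (V_ins (fst a)) (fst p) (snd p) \<and> \<not> in_shape (fst a) (fst p) (snd p)) \<mapsto>
    fst (THE p. in_shape (V_ins (fst a)) (fst p) (snd p) \<and> \<not> in_shape (fst a) (fst p) (snd p)) - top_leg_row (fst a))"
  by (simp add: unc_step_def Let_def)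

lemma unc_step_pow_fst: "\<exists>d. fst ((unc_step ^^ n) (T, Q)) = (Vb ^^ d) T"
proof (induction n)
  case 0
  show ?case by (intro exI[of _ 0]) simp
next
  case (Suc n)
  then obtain d where "fst ((unc_step ^^ n) (T, Q)) = (Vb ^^ d) T" by blast
  moreover obtain e where "V_ins ((Vb ^^ d) T) = (Vb ^^ e) ((Vb ^^ d) T)" using V_ins_pow by blast
  ultimately show ?case by (intro exI[of _ "e + d"]) (simp add: unc_step_fst funpow_add)
qed

lemma top_leg_row_f: assumes "hvt_valid T" "f_op i T = Some T'" shows "top_leg_row T' = top_leg_row T"
  unfolding top_leg_row_def leg_rows_f[OF assms] ..

lemma unc_step_pow_f: assumes v: "hvt_valid T" and i: "1 \<le> i" and f: "f_op i T = Some T'"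
  shows "f_op i (fst ((unc_step ^^ n) (T, Q))) = Some (fst ((unc_step ^^ n) (T', Q))) \<and>
    snd ((unc_step ^^ n) (T, Q)) = snd ((unc_step ^^ n) (T', Q))"
proof (induction n)
  case (Suc n)
  let ?P = "fst ((unc_step ^^ n) (T, Q))" and ?P' = "fst ((unc_step ^^ n) (T', Q))"
  have vP: "hvt_valid ?P" using unc_step_pow_fst[of n T Q] valid_Vb_pow[OF v] by metis
  have fP: "f_op i ?P = Some ?P'" and Q: "snd ((unc_step ^^ n) (T, Q)) = snd ((unc_step ^^ n) (T', Q))"
    using Suc by blast+
  have fV: "f_op i (V_ins ?P) = Some (V_ins ?P')" using V_ins_f[OF vP i fP] .
  have "hvt_valid (V_ins ?P)" using V_ins_pow[of ?P] valid_Vb_pow[OF vP] by metis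
  then have "shape (V_ins ?P') = shape (V_ins ?P)" using shape_f[OF _ fV] by blast
  then have s1: "in_shape (V_ins ?P') r c \<longleftrightarrow> in_shape (V_ins ?P) r c" for r c by (rule in_shape_shape)
  have s2: "in_shape ?P' r c \<longleftrightarrow> in_shape ?P r c" for r c using in_shape_shape[OF shape_f[OF vP fP]] .
  show ?case using fV Q by (simp add: unc_step_fst unc_step_snd s1 s2 top_leg_row_f[OF vP fP])
qed (use f in simp)

lemma P_tilde_pow: "\<exists>d. P_tilde T = (Vb ^^ d) T"
  unfolding P_tilde_def by (rule unc_step_pow_fst)

lemma uncrowd_f: assumes v: "hvt_valid T" and i: "1 \<le> i" and f: "f_op i T = Some T'"
  shows "f_op i (P_tilde T) = Some (P_tilde T')" "Q_tilde T = Q_tilde T'"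
  using unc_step_pow_f[OF v i f, of "leg_excess T" Map.empty] leg_excess_f[OF v f] shape_f[OF v f]
  by (simp_all add: P_tilde_def Q_tilde_def)

theorem theorem3p38:
  fixes T :: hvt and i :: nat
  assumes "hvt_valid T" and "1 \<le> i"
  shows "(f_op i T = None \<longrightarrow> f_op i (P_tilde T) = None) \<and>
         (e_op i T = None \<longrightarrow> e_op i (P_tilde T) = None) \<and>
         (\<forall>T'. f_op i T = Some T' \<longrightarrow>
              f_op i (P_tilde T) = Some (P_tilde T') \<and> Q_tilde T = Q_tilde T') \<and>
         (\<forall>T'. e_op i T = Some T' \<longrightarrow>
              e_op i (P_tilde T) = Some (P_tilde T') \<and> Q_tilde T = Q_tilde T')"
proof (intro conjI allI impI)
  note v = assms(1) and i = assms(2)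
  obtain d where d: "P_tilde T = (Vb ^^ d) T" using P_tilde_pow by blast
  show "f_op i (P_tilde T) = None" if "f_op i T = None"
  proof -
    have "f_op i ((Vb ^^ n) T) = None" for n
      by (induction n) (use that f_op_Vb[OF valid_Vb_pow[OF v] i] in auto)
    then show ?thesis by (simp add: d)
  qed
  show "e_op i (P_tilde T) = None" if "e_op i T = None"
  proof -
    have "e_op i ((Vb ^^ n) T) = None" for n
      by (induction n) (use that e_op_Vb_None[OF valid_Vb_pow[OF v] i] in auto)
    then show ?thesis by (simp add: d)
  qed
  show "f_op i (P_tilde T) = Some (P_tilde T')" "Q_tilde T = Q_tilde T'" if "f_op i T = Some T'" for T'
    using uncrowd_f[OF v i that] by blast+
  fix T' assume e: "e_op i T = Some T'"
  \<comment> \<open>The claims for e_i are those for f_i at \<open>T'\<close>, whose image under f_i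
    is \<open>T\<close>.\<close>
  note v' = e_op_inverse[OF v i e]
  note u = uncrowd_f[OF v'(1) i v'(2)]
  obtain d' where d': "P_tilde T' = (Vb ^^ d') T'" using P_tilde_pow by blast
  show "e_op i (P_tilde T) = Some (P_tilde T')"
    using f_op_inverse(2)[OF _ i u(1)] valid_Vb_pow[OF v'(1), of d'] d' by simp
  show "Q_tilde T = Q_tilde T'" using u(2) by simp
qed

end
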